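(* Let $(G,x)$ be a planar weighted graph as in the context, with $\mathcal Z_{\mathrm{Ising}}(G,x)\neq0$. Let $e_1,\dots,e_{2n}$ be pairwise distinct oriented edges of $G$. Then the sign $\tau(P)$ defined in the context does not depend on the choices made in its definition, and $$\mathrm{Pf}\big[(\widehat K^{-1})_{e_j,e_k}\big]_{j,k=1}^{2n}=\frac{1}{\mathcal Z_{\mathrm{Ising}}(G,x)}\sum_{P\in\mathcal C(e_1,\dots,e_{2n})}\tau(P)\,x(P).$$
   Context: Planar setup. Let $G$ be a finite connected graph embedded in the plane without crossings, with every edge drawn as a straight segment. Let $x=(x_e)_{e\in E(G)}$ be edge weights. Let $\vec E(G)$ be the set of oriented edges, with origin $o(e)$, terminus $t(e)$ and reversal $\bar e$; put $x_e=x_{\bar e}$. For $t(e)=o(e')$ with $e'\ne\bar e$, let $w(e,e')\in(-\pi,\pi)$ be the oriented angle from the direction of $e$ to that of $e'$. Let $\mathcal{KW}=I-T$ with $T_{e,e'}=\exp(\tfrac i2w(e,e'))(x_ex_{e'})^{1/2}$ if $t(e)=o(e')$ and $e'\ne\bar e$, and $0$ otherwise. Let $J_{e,e'}=\delta_{\bar e,e'}$ and $K=J\mathcal{KW}$. Fix $\eta_e$ with $\eta_e^2$ the unit direction of $e$, let $U=\mathrm{diag}(\eta_e)$, and let $\widehat K=iUKU^*$ (real antisymmetric). $\mathcal E(G)$ denotes the even subgraphs, $x(P)=\prod_{e\in P}x_e$, and $\mathcal Z_{\mathrm{Ising}}(G,x)=\sum_{P\in\mathcal E(G)}x(P)$.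 Graph $G^\diamondsuit$. The graph $G^\diamondsuit$ is obtained by inserting a vertex $z_e$ at the midpoint of each edge $e$. Each of the two resulting half-edges gets weight $x_e^{1/2}$, and $x(P)$ is the product of the weights of the half-edges in $P$. Configurations. Let $\mathrm E=\{e_1,\dots,e_{2n}\}$. Then $\mathcal C(e_1,\dots,e_{2n})$ is the set of subgraphs $P$ of $G^\diamondsuit$ such that: - $P$ does not contain the half-edges $(o(e_k),z_{e_k})$; - $P$ contains $(z_{e_k},t(e_k))$ whenever $\bar e_k\notin\mathrm E$; - every vertex of $G^\diamondsuit$ other than $z_{e_1},\dots,z_{e_{2n}}$ has even degree in $P$. Sign $\tau(P)$. At each vertex, pair up the half-edges of $P$ incident to it without crossing. This decomposes $P$ as $C\sqcup\gamma_1\sqcup\dots\sqcup\gamma_n$, where $C$ is a collection of closed loops and $\gamma_1,\dots,\gamma_n$ are paths matching the half-edges $(z_{e_k},t(e_k))$. If both $e,\bar e\in\mathrm E$, the pair $e,\bar e$ is matched by an empty path. Orient each $\gamma_k$ and choose a permutation $s$ of $\{1,\dots,2n\}$ so that $\gamma_k$ runs from $z_{e_{s(2k-1)}}$ to $z_{e_{s(2k)}}$. Set $$\tau(P)=\mathrm{sign}(s)\prod_{k=1}^n\Big(i\,\bar\eta_{e_{s(2k-1)}}\eta_{e_{s(2k)}}\exp\big[-\tfrac i2\mathrm{wind}(\gamma_k)\big]\Big).$$ Here $\mathrm{wind}(\gamma_k)$ is the total rotation angle of the velocity vector of the polygonal path $\gamma_k$, i.e. the sum of its turning angles in $(-\pi,\pi)$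 at interior vertices; it is $0$ for empty paths. *)

theory Defs
  imports "HOL-Analysis.Analysis"
begin

text \<open>
  Conventions. Vertices have an arbitrary type 'v; a straight-line embedding is a map
  pos :: 'v => complex. An (undirected) edge is a two-element vertex set {u,v};
  an oriented edge is a pair (u,v) with {u,v} an edge, origin fst, terminus snd.
  Edge weights x and their chosen square roots r (x_e^(1/2)) live on undirected edges.
  Indices are 0-based: the oriented edges e_1..e_2n are es 0, ..., es (2n-1).
\<close>

definition orev :: "'v \<times> 'v \<Rightarrow> 'v \<times> 'v" where
  "orev e = (snd e, fst e)"

definition OE :: "'v set set \<Rightarrow> ('v \<times> 'v) set" where
  "OE E = {e. {fst e, snd e} \<in> E}"

definition dir :: "('v \<Rightarrow> complex) \<Rightarrow> 'v \<times> 'v \<Rightarrow> complex" where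
  "dir pos e = pos (snd e) - pos (fst e)"

text \<open>oriented angle w(e,e') from the direction of e to that of e'\<close>
definition wang :: "('v \<Rightarrow> complex) \<Rightarrow> 'v \<times> 'v \<Rightarrow> 'v \<times> 'v \<Rightarrow> real" where
  "wang pos e e' = Arg (dir pos e' / dir pos e)"

text \<open>finite connected graph, straight-line embedded in the plane without crossings\<close>
definition planar_straight_graph :: "'v set \<Rightarrow> 'v set set \<Rightarrow> ('v \<Rightarrow> complex) \<Rightarrow> bool" where
  "planar_straight_graph V E pos \<longleftrightarrow>
     finite V \<and>
     (\<forall>e\<in>E. \<exists>u v. e = {u, v} \<and> u \<noteq> v \<and> u \<in> V \<and> v \<in> V) \<and>
     inj_on pos V \<and>
     (\<forall>u v w. {u, v} \<in> E \<longrightarrow> w \<in> V \<longrightarrow> w \<noteq> u \<longrightarrow> w \<noteq> v \<longrightarrow>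
        pos w \<notin> closed_segment (pos u) (pos v)) \<and>
     (\<forall>a b c d. {a, b} \<in> E \<longrightarrow> {c, d} \<in> E \<longrightarrow> {a, b} \<noteq> {c, d} \<longrightarrow>
        closed_segment (pos a) (pos b) \<inter> closed_segment (pos c) (pos d)
          \<subseteq> pos ` ({a, b} \<inter> {c, d})) \<and>
     (\<forall>u\<in>V. \<forall>v\<in>V. (u, v) \<in> {(a, b). {a, b} \<in> E}\<^sup>*)"

text \<open>Kac--Ward matrix; r e is the chosen square root x_e^(1/2)\<close>
definition Tmat :: "('v \<Rightarrow> complex) \<Rightarrow> ('v set \<Rightarrow> complex) \<Rightarrow> 'v \<times> 'v \<Rightarrow> 'v \<times> 'v \<Rightarrow> complex" where
  "Tmat pos r e e' =
     (if snd e = fst e' \<and> e' \<noteq> orev e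
      then exp (\<i> / 2 * complex_of_real (wang pos e e')) * r {fst e, snd e} * r {fst e', snd e'}
      else 0)"

definition KWmat :: "('v \<Rightarrow> complex) \<Rightarrow> ('v set \<Rightarrow> complex) \<Rightarrow> 'v \<times> 'v \<Rightarrow> 'v \<times> 'v \<Rightarrow> complex" where
  "KWmat pos r e e' = (if e = e' then 1 else 0) - Tmat pos r e e'"

text \<open>K = J KW, i.e. K_{e,e'} = KW_{rev e, e'}; Khat = i U K U^*\<close>
definition Kmat :: "('v \<Rightarrow> complex) \<Rightarrow> ('v set \<Rightarrow> complex) \<Rightarrow> 'v \<times> 'v \<Rightarrow> 'v \<times> 'v \<Rightarrow> complex" where
  "Kmat pos r e e' = KWmat pos r (orev e) e'"

definition Khat :: "('v \<Rightarrow> complex) \<Rightarrow> ('v set \<Rightarrow> complex) \<Rightarrow> ('v \<times> 'v \<Rightarrow> complex)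
                     \<Rightarrow> 'v \<times> 'v \<Rightarrow> 'v \<times> 'v \<Rightarrow> complex" where
  "Khat pos r eta e e' = \<i> * eta e * Kmat pos r e e' * cnj (eta e')"

text \<open>inverse of a matrix indexed by a finite set S (entries outside S x S set to 0)\<close>
definition mat_inv_on :: "'a set \<Rightarrow> ('a \<Rightarrow> 'a \<Rightarrow> complex) \<Rightarrow> 'a \<Rightarrow> 'a \<Rightarrow> complex" where
  "mat_inv_on S A = (THE M.
      (\<forall>e\<in>S. \<forall>g\<in>S. (\<Sum>f\<in>S. A e f * M f g) = (if e = g then 1 else 0) \<and>
                     (\<Sum>f\<in>S. M e f * A f g) = (if e = g then 1 else 0)) \<and>
      (\<forall>e g. e \<notin> S \<or> g \<notin> S \<longrightarrow> M e g = 0))"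

text \<open>Pfaffian of the 2n x 2n matrix (A j k), j,k < 2n\<close>
definition pfaffian :: "nat \<Rightarrow> (nat \<Rightarrow> nat \<Rightarrow> complex) \<Rightarrow> complex" where
  "pfaffian n A =
     (\<Sum>\<sigma>\<in>{\<sigma>. \<sigma> permutes {0..<2*n}}.
        of_int (sign \<sigma>) * (\<Prod>i<n. A (\<sigma> (2*i)) (\<sigma> (2*i+1)))) / (2^n * fact n)"

definition even_subgraphs :: "'v set \<Rightarrow> 'v set set \<Rightarrow> 'v set set set" where
  "even_subgraphs V E = {F. F \<subseteq> E \<and> (\<forall>v\<in>V. even (card {e\<in>F. v \<in> e}))}"

definition Z_Ising :: "'v set \<Rightarrow> 'v set set \<Rightarrow> ('v set \<Rightarrow> complex) \<Rightarrow> complex" where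
  "Z_Ising V E x = (\<Sum>F\<in>even_subgraphs V E. \<Prod>e\<in>F. x e)"

text \<open>
  Subgraphs of G^diamond: a half-edge (o(h), z_h) is identified with the oriented edge h
  (the half of the edge at the origin of h). So (o(e_k),z_{e_k}) is e_k and
  (z_{e_k},t(e_k)) is orev e_k. A subgraph P is a set H of oriented edges.
\<close>
definition configs :: "'v set \<Rightarrow> 'v set set \<Rightarrow> (nat \<Rightarrow> 'v \<times> 'v) \<Rightarrow> nat \<Rightarrow> ('v \<times> 'v) set set" where
  "configs V E es n = {H. H \<subseteq> OE E \<and>
      (\<forall>k<2*n. es k \<notin> H) \<and>
      (\<forall>k<2*n. orev (es k) \<notin> es ` {0..<2*n} \<longrightarrow> orev (es k) \<in> H) \<and>
      (\<forall>v\<in>V. even (card {h\<in>H. fst h = v})) \<and>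
      (\<forall>h\<in>OE E. (\<forall>k<2*n. {fst (es k), snd (es k)} \<noteq> {fst h, snd h}) \<longrightarrow>
                   (h \<in> H \<longleftrightarrow> orev h \<in> H))}"

text \<open>weight x(P): product of the half-edge weights x_e^(1/2)\<close>
definition cweight :: "('v set \<Rightarrow> complex) \<Rightarrow> ('v \<times> 'v) set \<Rightarrow> complex" where
  "cweight r H = (\<Prod>h\<in>H. r {fst h, snd h})"

definition hang :: "('v \<Rightarrow> complex) \<Rightarrow> 'v \<times> 'v \<Rightarrow> real" where
  "hang pos h = Arg (dir pos h)"

definition btw :: "('v \<Rightarrow> complex) \<Rightarrow> 'v \<times> 'v \<Rightarrow> 'v \<times> 'v \<Rightarrow> 'v \<times> 'v \<Rightarrow> bool" where
  "btw pos a a' b \<longleftrightarrow> min (hang pos a) (hang pos a') < hang pos b \<and>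
                       hang pos b < max (hang pos a) (hang pos a')"

text \<open>
  A choice of non-crossing pairings at the original vertices: p pairs each half-edge of H
  with another half-edge of H at the same vertex; two pairs at a vertex do not interleave
  in the cyclic order of directions. (At midpoint vertices the pairing is forced.)
\<close>
definition noncrossing_pairing :: "('v \<Rightarrow> complex) \<Rightarrow> ('v \<times> 'v) set \<Rightarrow> ('v \<times> 'v \<Rightarrow> 'v \<times> 'v) \<Rightarrow> bool" where
  "noncrossing_pairing pos H p \<longleftrightarrow>
     (\<forall>h\<in>H. p h \<in> H \<and> fst (p h) = fst h \<and> p h \<noteq> h \<and> p (p h) = h) \<and>
     (\<forall>a\<in>H. \<forall>b\<in>H. fst b = fst a \<longrightarrow> b \<noteq> a \<longrightarrow> b \<noteq> p a \<longrightarrow>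
        (btw pos a (p a) b \<longleftrightarrow> btw pos a (p a) (p b)))"

text \<open>
  path_rel pos H p es a b W: under the pairing p, the path of the decomposition starting at
  z_{e_a} ends at z_{e_b}, and W is its winding (total turning). Either the path is empty
  (e_b = rev e_a), or it is the list hs of half-edges traversed (each from its midpoint
  towards its origin vertex; at that vertex one leaves along p h, then continues through the
  midpoint onto orev (p h)); the turning at the vertex is w(rev h, p h), and turning at
  midpoints is 0.
\<close>
definition path_rel :: "('v \<Rightarrow> complex) \<Rightarrow> ('v \<times> 'v) set \<Rightarrow> ('v \<times> 'v \<Rightarrow> 'v \<times> 'v)
                        \<Rightarrow> (nat \<Rightarrow> 'v \<times> 'v) \<Rightarrow> nat \<Rightarrow> nat \<Rightarrow> real \<Rightarrow> bool" where
  "path_rel pos H p es a b W \<longleftrightarrow>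
     (es b = orev (es a) \<and> W = 0) \<or>
     (\<exists>hs. hs \<noteq> [] \<and> hd hs = orev (es a) \<and> set hs \<subseteq> H \<and>
        (\<forall>i. Suc i < length hs \<longrightarrow> hs ! Suc i = orev (p (hs ! i)) \<and> orev (p (hs ! i)) \<in> H) \<and>
        orev (p (last hs)) = es b \<and>
        W = (\<Sum>i<length hs. wang pos (orev (hs ! i)) (p (hs ! i))))"

text \<open>
  tau_rel pos eta es n H t: t is the value of tau(P) obtained from some admissible set of
  choices (pairing p, numbering and orientation of the paths encoded by the permutation s,
  path gamma_k running from z_{e_{s(2k)}} to z_{e_{s(2k+1)}}, 0-based).
\<close>
definition tau_rel :: "('v \<Rightarrow> complex) \<Rightarrow> ('v \<times> 'v \<Rightarrow> complex) \<Rightarrow> (nat \<Rightarrow> 'v \<times> 'v) \<Rightarrow> nat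
                       \<Rightarrow> ('v \<times> 'v) set \<Rightarrow> complex \<Rightarrow> bool" where
  "tau_rel pos eta es n H t \<longleftrightarrow>
     (\<exists>p s W. noncrossing_pairing pos H p \<and> s permutes {0..<2*n} \<and>
        (\<forall>k<n. path_rel pos H p es (s (2*k)) (s (2*k+1)) (W k)) \<and>
        t = of_int (sign s) *
            (\<Prod>k<n. \<i> * cnj (eta (es (s (2*k)))) * eta (es (s (2*k+1)))
                      * exp (- \<i> / 2 * complex_of_real (W k))))"

end

theory Submission
  imports Defs
begin

text \<open>
  Order the half-edges by the height of their origin and, at a common origin, by their direction.
  Up to conjugation by a diagonal matrix of signs, an entry of \<open>Khat\<close> is then \<open>-1\<close> or \<open>1\<close>, as its
  first index precedes or follows the second, times \<open>1\<close> for the two halves of an edge,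
  \<open>r e * r e'\<close> for two half-edges with the same origin, and \<open>0\<close> otherwise. Give a configuration \<open>H\<close> the
  sign of the word consisting of \<open>e\<^sub>1, \<dots>, e\<^sub>2\<^sub>n\<close>, the half-edges of \<open>H\<close> in increasing order, and
  the remaining half-edges grouped into edges. Alternating sums over the half-edges at one vertex
  collapse, so the signed generating function of the configurations satisfies the linear recursion
  that characterizes Pfaffians of \<open>Khat\<^sup>-\<^sup>1\<close>. Shortening paths step by step identifies the
  sign of the word with \<open>\<tau>(H)\<close> up to a constant, whatever the choices in the definition of
  \<open>\<tau>\<close>. Planarity is used only to see that the word signs of even subgraphs all agree:
  two edges that do not cross keep their left-right order along the range of heights they share,
  so the number of pairs of edges interleaved in the order is even.
\<close>

section \<open>Signs of words of half-edges\<close>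

text \<open>The shape of a vertex block of the matrix is what makes sums over subsets work. A
  skew-symmetric matrix of even size with all entries above the diagonal equal to 1 has Pfaffian 1,
  so an even set of half-edges at a vertex enters with a single sign and not with a signed sum over
  its pairings. The alternating sums are this fact in the form that a row expansion needs. They
  require the half-edges of one vertex to be consecutive in the order, so that any other half-edge
  sees all of them on the same side; therefore the origin is compared before the direction.

  The word sign involves neither a pairing nor a numbering of paths. Hence two decompositions are
  never compared: every admissible choice is computed to give the same expression. The factor
  between \<open>\<tau>\<close> and the word sign is \<open>Lam S\<close> times the product of
  \<open>sn\<close> over the chosen edges. The same \<open>Lam S\<close> relates the signed sum over
  even subgraphs to the Ising partition function, and its square is 1, so it drops out of the
  quotient.\<close>

lemma even_card_involution:
  assumes "finite A" "\<And>a. a \<in> A \<Longrightarrow> f a \<in> A \<and> f a \<noteq> a \<and> f (f a) = a"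
  shows "even (card A)"
  using assms
proof (induction "card A" arbitrary: A rule: less_induct)
  case less
  show ?case
  proof (cases "A = {}")
    case False
    then obtain a where a: "a \<in> A" by blast
    let ?B = "A - {a, f a}"
    have fa: "f a \<in> A" "f a \<noteq> a" "f (f a) = a" using less.prems a by auto
    have c: "card A = card ?B + 2"
    proof -
      have "card {a, f a} = 2" using fa by simp
      moreover have "card {a, f a} \<le> card A" using less.prems a fa by (intro card_mono) auto
      moreover have "card ?B = card A - card {a, f a}" using a fa by (intro card_Diff_subset) auto
      ultimately show ?thesis by simp
    qed
    have "even (card ?B)"
    proof (rule less.hyps)
      show "card ?B < card A" using c by simp
      show "finite ?B" using less.prems by simp
      show "f b \<in> ?B \<and> f b \<noteq> b \<and> f (f b) = b" if "b \<in> ?B" for b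
        using less.prems(2)[of b] that fa by auto
    qed
    then show ?thesis using c by simp
  qed simp
qed

text \<open>Products over unordered pairs are written with the element of smaller rank first. As
  \<open>F\<close> is symmetric, a new element \<open>g\<close> brings one factor for each old
  element, on whichever side of \<open>g\<close> that element lies.\<close>

lemma prod_triangle_insert:
  fixes F :: "'h \<Rightarrow> 'h \<Rightarrow> complex" and rk :: "'h \<Rightarrow> nat"
  assumes "finite U" "g \<notin> U" "inj_on rk (insert g U)" "\<And>a b. F a b = F b a"
  shows "(\<Prod>a\<in>insert g U. \<Prod>b\<in>{b \<in> insert g U. rk a < rk b}. F a b) =
         (\<Prod>a\<in>U. \<Prod>b\<in>{b \<in> U. rk a < rk b}. F a b) * (\<Prod>b\<in>U. F g b)"
proof -
  have neq: "rk a < rk g \<or> rk g < rk a" if "a \<in> U" for a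
    using that assms(2,3) by (metis inj_onD insertCI nat_neq_iff)
  have 1: "(\<Prod>b\<in>{b \<in> insert g U. rk a < rk b}. F a b) =
        (\<Prod>b\<in>{b \<in> U. rk a < rk b}. F a b) * (if rk a < rk g then F g a else 1)" if "a \<in> U" for a
  proof (cases "rk a < rk g")
    case True
    then have "{b \<in> insert g U. rk a < rk b} = insert g {b \<in> U. rk a < rk b}" by auto
    then show ?thesis using True assms(1,2) assms(4)[of a g] by (simp add: mult.commute)
  next
    case False
    then have "{b \<in> insert g U. rk a < rk b} = {b \<in> U. rk a < rk b}" by auto
    then show ?thesis using False by simp
  qed
  have 2: "{b \<in> insert g U. rk g < rk b} = {b \<in> U. rk g < rk b}" by auto
  have 3: "(\<Prod>b\<in>{b \<in> U. rk g < rk b}. F g b) = (\<Prod>b\<in>U. if rk g < rk b then F g b else 1)"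
    using assms(1) by (simp add: prod.inter_filter)
  have "(\<Prod>b\<in>U. F g b) = (\<Prod>b\<in>U. (if rk g < rk b then F g b else 1) * (if rk b < rk g then F g b else 1))"
    by (rule prod.cong) (use neq in force)+
  also have "\<dots> = (\<Prod>b\<in>{b \<in> U. rk g < rk b}. F g b) * (\<Prod>a\<in>U. if rk a < rk g then F g a else 1)"
    by (simp add: prod.distrib 3)
  finally have 4: "(\<Prod>b\<in>{b \<in> U. rk g < rk b}. F g b) * (\<Prod>a\<in>U. if rk a < rk g then F g a else 1) = (\<Prod>b\<in>U. F g b)"
    by simp
  have "(\<Prod>a\<in>insert g U. \<Prod>b\<in>{b \<in> insert g U. rk a < rk b}. F a b) =
     (\<Prod>b\<in>{b \<in> U. rk g < rk b}. F g b) * (\<Prod>a\<in>U. \<Prod>b\<in>{b \<in> insert g U. rk a < rk b}. F a b)"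
    using assms(1,2) by (subst prod.insert) (auto simp only: 2)
  also have "(\<Prod>a\<in>U. \<Prod>b\<in>{b \<in> insert g U. rk a < rk b}. F a b) =
     (\<Prod>a\<in>U. \<Prod>b\<in>{b \<in> U. rk a < rk b}. F a b) * (\<Prod>a\<in>U. if rk a < rk g then F g a else 1)"
    unfolding prod.distrib[symmetric] by (rule prod.cong[OF refl 1])
  finally show ?thesis unfolding 4[symmetric] by (simp only: mult_ac)
qed

text \<open>The passage to ordered pairs allows double counting with the first element held fixed,
  as in \<open>Lam_even\<close>.\<close>

lemma prod_triangle_symmetrize:
  fixes F :: "'h \<Rightarrow> 'h \<Rightarrow> complex" and rk :: "'h \<Rightarrow> nat"
  assumes "finite U" "inj_on rk U"
  shows "(\<Prod>a\<in>U. \<Prod>b\<in>{b \<in> U. rk a < rk b}. F a b * F b a) = (\<Prod>a\<in>U. \<Prod>b\<in>U - {a}. F a b)"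
proof -
  have A: "(\<Prod>a\<in>U. \<Prod>b\<in>{b \<in> U. rk a < rk b}. F b a) = (\<Prod>a\<in>U. \<Prod>b\<in>{b \<in> U. rk b < rk a}. F a b)"
    using prod.swap_restrict[of U U "\<lambda>a b. F b a" "\<lambda>a b. rk a < rk b"] assms(1) by simp
  have "(\<Prod>b\<in>U - {a}. F a b) = (\<Prod>b\<in>{b \<in> U. rk a < rk b}. F a b) * (\<Prod>b\<in>{b \<in> U. rk b < rk a}. F a b)"
    if "a \<in> U" for a
  proof -
    have eq: "U - {a} = {b \<in> U. rk a < rk b} \<union> {b \<in> U. rk b < rk a}"
      using assms(2) that by (auto simp: inj_on_def) (metis nat_neq_iff)
    show ?thesis unfolding eq by (rule prod.union_disjoint) (use assms(1) in auto)
  qed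
  then show ?thesis by (simp add: prod.distrib A)
qed

text \<open>A setting without coordinates. Through \<open>contiguous\<close> the half-edges at one
  vertex form an interval of the order; \<open>sn\<close> supplies the conjugating signs, and
  \<open>rho\<close> is later instantiated by the square roots of the weights.\<close>

locale halfedges =
  fixes S :: "'h set" and bar :: "'h \<Rightarrow> 'h" and org :: "'h \<Rightarrow> 'v" and rk :: "'h \<Rightarrow> nat"
    and sn rho :: "'h \<Rightarrow> complex"
  assumes fin: "finite S"
    and bar_in [simp]: "h \<in> S \<Longrightarrow> bar h \<in> S"
    and bar_bar [simp]: "bar (bar h) = h"
    and org_bar: "h \<in> S \<Longrightarrow> org (bar h) \<noteq> org h"
    and inj_rk: "inj_on rk S"
    and contiguous: "\<lbrakk>a \<in> S; b \<in> S; c \<in> S; org a = org b; org c \<noteq> org a\<rbrakk> \<Longrightarrow> rk a < rk c \<longleftrightarrow> rk b < rk c"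
    and sn_square: "h \<in> S \<Longrightarrow> sn h * sn h = 1"
begin

text \<open>The value 0 at equal ranks makes words with repetitions and the diagonal of
  \<open>B\<close> vanish without separate cases.\<close>

definition sg :: "'h \<Rightarrow> 'h \<Rightarrow> complex" where
  "sg a b = (if rk a < rk b then 1 else if rk b < rk a then -1 else 0)"

definition sgp :: "'h \<Rightarrow> 'h set \<Rightarrow> complex" where
  "sgp a B = (\<Prod>b\<in>B. sg a b)"

definition cr :: "'h set \<Rightarrow> 'h set \<Rightarrow> complex" where
  "cr A B = (\<Prod>a\<in>A. sgp a B)"

text \<open>For two distinct edges this is -1 exactly if their halves interleave in the
  order.\<close>

definition chi :: "'h \<Rightarrow> 'h \<Rightarrow> complex" where
  "chi a b = sg a b * sg a (bar b) * sg (bar a) b * sg (bar a) (bar b)"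

definition lo :: "'h set \<Rightarrow> 'h set" where
  "lo L = {h \<in> L. rk h < rk (bar h)}"

text \<open>For a closed \<open>L\<close>, this is -1 to the number of interleaved pairs of edges.
  Equivalently, it is the sign of the word that lists the edges as adjacent pairs, lower half first;
  the order of the edges is immaterial, as blocks of even length commute.\<close>

definition Lam :: "'h set \<Rightarrow> complex" where
  "Lam L = (\<Prod>a\<in>lo L. \<Prod>b\<in>{b \<in> lo L. rk a < rk b}. chi a b)"

definition closed :: "'h set \<Rightarrow> bool" where
  "closed L \<longleftrightarrow> L \<subseteq> S \<and> (\<forall>h\<in>L. bar h \<in> L)"

primrec lsgn :: "'h list \<Rightarrow> complex" where
  "lsgn [] = 1" |
  "lsgn (x # xs) = (\<Prod>y\<leftarrow>xs. sg x y) * lsgn xs"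

lemma bar_neq [simp]: "h \<in> S \<Longrightarrow> bar h \<noteq> h" "h \<in> S \<Longrightarrow> h \<noteq> bar h"
  using org_bar by force+

lemma bar_eq_iff: "bar a = bar b \<longleftrightarrow> a = b"
  by (metis bar_bar)

lemma finite_sub: "A \<subseteq> S \<Longrightarrow> finite A"
  using fin finite_subset by blast

lemma rk_neq: "a \<in> S \<Longrightarrow> b \<in> S \<Longrightarrow> a \<noteq> b \<Longrightarrow> rk a \<noteq> rk b"
  using inj_rk by (meson inj_onD)

lemma sg_swap: "sg b a = - sg a b"
  by (auto simp: sg_def)

lemma sg_self [simp]: "sg a a = 0"
  by (simp add: sg_def)

lemma sg_square: "a \<in> S \<Longrightarrow> b \<in> S \<Longrightarrow> a \<noteq> b \<Longrightarrow> sg a b * sg a b = 1"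
  using rk_neq by (force simp: sg_def)

lemma sgp_empty [simp]: "sgp a {} = 1"
  by (simp add: sgp_def)

lemma sgp_insert: "finite B \<Longrightarrow> b \<notin> B \<Longrightarrow> sgp a (insert b B) = sg a b * sgp a B"
  by (simp add: sgp_def)

lemma sgp_Un: "finite A \<Longrightarrow> finite B \<Longrightarrow> A \<inter> B = {} \<Longrightarrow> sgp a (A \<union> B) = sgp a A * sgp a B"
  by (simp add: sgp_def prod.union_disjoint)

lemma sgp_square: "a \<in> S \<Longrightarrow> B \<subseteq> S \<Longrightarrow> a \<notin> B \<Longrightarrow> sgp a B * sgp a B = 1"
  unfolding sgp_def prod.distrib[symmetric]
  by (rule prod.neutral) (metis sg_square subset_iff)

lemma cr_empty [simp]: "cr {} B = 1"
  by (simp add: cr_def)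

lemma cr_empty2 [simp]: "cr A {} = 1"
  by (simp add: cr_def)

lemma cr_insert: "finite A \<Longrightarrow> a \<notin> A \<Longrightarrow> cr (insert a A) B = sgp a B * cr A B"
  by (simp add: cr_def)

lemma prod_sg_flip: "(\<Prod>a\<in>A. sg a b) = (-1) ^ card A * sgp b A"
  unfolding sgp_def by (subst prod_constant[symmetric], subst prod.distrib[symmetric])
    (auto intro!: prod.cong simp: sg_swap[of b])

lemma cr_insert2:
  "finite B \<Longrightarrow> b \<notin> B \<Longrightarrow> cr A (insert b B) = (-1) ^ card A * sgp b A * cr A B"
  unfolding cr_def by (simp add: sgp_insert prod.distrib prod_sg_flip)

text \<open>Reversing the arguments of \<open>sg\<close> costs \<open>(-1) ^ card A\<close> for each
  new element, and for two elements at once the costs cancel.\<close>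

lemma cr_insert_pair:
  assumes "finite B" "b \<notin> B" "b' \<notin> B" "b \<noteq> b'"
  shows "cr A (insert b (insert b' B)) = sgp b A * sgp b' A * cr A B"
proof -
  have "(-1) ^ card A * (-1 :: complex) ^ card A = 1" by (simp add: power_mult_distrib[symmetric])
  moreover have "cr A (insert b (insert b' B)) =
     ((-1) ^ card A * (-1) ^ card A) * (sgp b A * sgp b' A * cr A B)"
    using assms by (simp add: cr_insert2 mult_ac)
  ultimately show ?thesis by simp
qed

lemma chi_commute: "chi a b = chi b a"
  unfolding chi_def sg_swap[of b a] sg_swap[of b "bar a"] sg_swap[of "bar b" a] sg_swap[of "bar b" "bar a"]
  by (simp add: mult_ac)

lemma lo_cases: "h \<in> S \<Longrightarrow> rk h < rk (bar h) \<or> rk (bar h) < rk (bar (bar h))"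
  using rk_neq[of h "bar h"] by auto

lemma closed_split:
  assumes "closed L"
  shows "L = lo L \<union> bar ` lo L" "lo L \<inter> bar ` lo L = {}"
  using assms lo_cases unfolding closed_def lo_def
  by (auto simp: image_iff) (metis bar_bar lo_cases subset_iff)

lemma prod_closed:
  fixes F :: "'h \<Rightarrow> complex"
  assumes "closed L"
  shows "(\<Prod>h\<in>L. F h) = (\<Prod>h\<in>lo L. F h * F (bar h))"
proof -
  have f: "finite (lo L)" using assms finite_sub unfolding closed_def lo_def by auto
  have i: "inj_on bar (lo L)" by (auto intro: inj_onI simp: bar_eq_iff)
  have "(\<Prod>h\<in>L. F h) = (\<Prod>h\<in>lo L \<union> bar ` lo L. F h)" using closed_split(1)[OF assms] by simp
  also have "\<dots> = (\<Prod>h\<in>lo L. F h) * (\<Prod>h\<in>bar ` lo L. F h)"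
    using f closed_split(2)[OF assms] by (simp add: prod.union_disjoint)
  also have "\<dots> = (\<Prod>h\<in>lo L. F h * F (bar h))"
    by (simp add: prod.reindex[OF i] prod.distrib)
  finally show ?thesis .
qed

lemma Lam_empty [simp]: "Lam {} = 1"
  by (simp add: Lam_def lo_def)

lemma Lam_insert:
  assumes L: "closed L" and g: "g \<in> S" "g \<notin> L"
  shows "Lam (insert g (insert (bar g) L)) = Lam L * sgp g L * sgp (bar g) L"
proof -
  have main: "Lam (insert g (insert (bar g) L)) = Lam L * sgp g L * sgp (bar g) L"
    if g: "g \<in> S" "g \<notin> L" "rk g < rk (bar g)" for g
  proof -
    have lo: "lo (insert g (insert (bar g) L)) = insert g (lo L)"
      using g by (auto simp: lo_def)
    have fl: "finite (lo L)" and sub: "lo L \<subseteq> S"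
      using L finite_sub unfolding closed_def lo_def by auto
    have "Lam (insert g (insert (bar g) L)) = Lam L * (\<Prod>b\<in>lo L. chi g b)"
      unfolding Lam_def lo
    proof (rule prod_triangle_insert)
      show "g \<notin> lo L" using g by (simp add: lo_def)
      show "inj_on rk (insert g (lo L))" by (rule inj_on_subset[OF inj_rk]) (use g sub in auto)
    qed (use fl chi_commute in auto)
    also have "(\<Prod>b\<in>lo L. chi g b) = (\<Prod>b\<in>L. sg g b * sg (bar g) b)"
      by (subst prod_closed[OF L]) (simp add: chi_def mult_ac)
    finally show ?thesis by (simp add: sgp_def prod.distrib)
  qed
  show ?thesis
  proof (cases "rk g < rk (bar g)")
    case True then show ?thesis using main g by blast
  next
    case False
    then have "rk (bar g) < rk (bar (bar g))" using lo_cases g by blast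
    moreover have "bar g \<notin> L" using L g unfolding closed_def by (metis bar_bar)
    ultimately have "Lam (insert (bar g) (insert (bar (bar g)) L)) = Lam L * sgp (bar g) L * sgp (bar (bar g)) L"
      using main[of "bar g"] g bar_in[of g] by simp
    then show ?thesis by (simp add: insert_commute mult_ac)
  qed
qed

lemma closed_induct [consumes 1, case_names empty insert]:
  assumes "closed L"
    and "P {}"
    and "\<And>g L. closed L \<Longrightarrow> g \<in> S \<Longrightarrow> g \<notin> L \<Longrightarrow> bar g \<notin> L \<Longrightarrow> P L \<Longrightarrow> P (insert g (insert (bar g) L))"
  shows "P L"
proof -
  have "finite L" using assms(1) finite_sub by (auto simp: closed_def)
  then show ?thesis using assms(1)
  proof (induction "card L" arbitrary: L rule: less_induct)
    case less
    show ?case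
    proof (cases "L = {}")
      case False
      then obtain g where g: "g \<in> L" by blast
      let ?L = "L - {g, bar g}"
      have c: "closed ?L" using less.prems unfolding closed_def by (auto simp: bar_eq_iff)
      have "card ?L < card L" using g less.prems by (intro psubset_card_mono) auto
      then have "P ?L" using less c by auto
      then have "P (insert g (insert (bar g) ?L))"
        using c g less.prems by (intro assms(3)) (auto simp: closed_def)
      moreover have "insert g (insert (bar g) ?L) = L" using g less.prems by (auto simp: closed_def)
      ultimately show ?thesis by simp
    qed (use assms(2) in simp)
  qed
qed

lemma Lam_square: "closed L \<Longrightarrow> Lam L * Lam L = 1"
proof (induction rule: closed_induct)
  case (insert g L)
  have "(Lam L * sgp g L * sgp (bar g) L) * (Lam L * sgp g L * sgp (bar g) L) =
     (Lam L * Lam L) * (sgp g L * sgp g L) * (sgp (bar g) L * sgp (bar g) L)"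
    by (simp add: mult_ac)
  also have "\<dots> = 1" using insert by (simp add: sgp_square closed_def)
  finally show ?case using insert by (simp add: Lam_insert)
qed simp

text \<open>Concatenating two lists of edges multiplies their signs by the sign of interlacing the
  two sets. With \<open>L\<close> the complement of \<open>H\<close>, this compares an even subgraph
  with the full set of edges in \<open>W_Nil\<close>.\<close>

lemma Lam_Un:
  assumes H: "closed H" and "closed L" and "H \<inter> L = {}"
  shows "Lam (H \<union> L) = Lam H * Lam L * cr H L"
  using assms(2,3)
proof (induction rule: closed_induct)
  case (insert g L)
  have f: "finite H" "finite L" using H insert finite_sub by (auto simp: closed_def)
  have g: "g \<notin> H" "bar g \<notin> H" "H \<inter> L = {}" using insert by auto
  have "H \<union> insert g (insert (bar g) L) = insert g (insert (bar g) (H \<union> L))" by auto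
  moreover have "closed (H \<union> L)" using H insert by (auto simp: closed_def)
  ultimately have "Lam (H \<union> insert g (insert (bar g) L)) = Lam (H \<union> L) * sgp g (H \<union> L) * sgp (bar g) (H \<union> L)"
    using Lam_insert[of "H \<union> L" g] insert g by simp
  also have "\<dots> = Lam H * (Lam L * sgp g L * sgp (bar g) L) * (sgp g H * sgp (bar g) H * cr H L)"
    using insert g f by (simp add: sgp_Un mult_ac)
  also have "sgp g H * sgp (bar g) H * cr H L = cr H (insert g (insert (bar g) L))"
    by (rule cr_insert_pair[symmetric]) (use f insert in auto)
  finally show ?case using insert by (simp add: Lam_insert)
qed simp

text \<open>
  The sign of the word that lists \<open>es\<close>, then \<open>H\<close> in increasing order, then the half-edges outside
  \<open>es\<close> and \<open>H\<close> as adjacent pairs \<open>h, bar h\<close>. Words with repetitions have sign \<open>0\<close>.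
\<close>

definition W :: "'h list \<Rightarrow> 'h set \<Rightarrow> complex" where
  "W es H = lsgn es * cr (set es) (S - set es) * cr H (S - set es - H) * Lam (S - set es - H)"

lemma lsgn_Cons:
  "distinct es \<Longrightarrow> lsgn (f # es) = sgp f (set es) * lsgn es"
  by (simp add: sgp_def prod.distinct_set_conv_list)

text \<open>Bringing \<open>f\<close> to the front of \<open>X\<close> passes the smaller elements
  of \<open>X\<close> and gives \<open>sgp f (X - {f})\<close>; bringing it on to the front of
  \<open>es\<close> gives \<open>(-1) ^ length es\<close>.\<close>

lemma W_Cons:
  assumes "distinct es" "set es \<subseteq> S" "X \<subseteq> S - set es" "f \<in> X"
  shows "W (f # es) (X - {f}) = (-1) ^ length es * W es X * sgp f (X - {f})"
proof -
  define L where "L = S - set es - X"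
  let ?E = "set es" and ?H = "X - {f}" and ?L = L
  have fins: "finite ?E" "finite X" "finite ?L" using assms(2,3) fin finite_sub[of X] by (auto simp: subset_iff L_def)
  have f: "f \<in> S" "f \<notin> ?E" using assms by auto
  have L: "S - set (f # es) - ?H = ?L" using assms by (auto simp: L_def)
  have Y: "S - set (f # es) = ?H \<union> ?L" using assms by (auto simp: L_def)
  have Y2: "S - ?E = insert f (?H \<union> ?L)" using assms by (auto simp: L_def)
  have sL: "L \<subseteq> S" "f \<notin> L" "L \<inter> X = {}" using assms by (auto simp: L_def)
  have 1: "cr ?E (S - ?E) = (-1) ^ length es * sgp f ?E * cr ?E (?H \<union> ?L)"
    unfolding Y2 using fins assms sL by (subst cr_insert2) (auto simp: distinct_card)
  have 2: "cr (set (f # es)) (S - set (f # es)) = sgp f ?H * sgp f ?L * cr ?E (?H \<union> ?L)"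
    unfolding Y using fins f sL by (simp add: cr_insert) (subst sgp_Un, auto)
  have 3: "cr X ?L = sgp f ?L * cr ?H ?L"
    using cr_insert[of ?H f ?L] fins assms by (simp add: insert_absorb)
  have sq: "sgp f ?E * sgp f ?E = 1" "sgp f ?L * sgp f ?L = 1"
    using f assms sL by (auto intro!: sgp_square)
  have "W (f # es) ?H = sgp f ?E * lsgn es * (sgp f ?H * sgp f ?L * cr ?E (?H \<union> ?L)) * cr ?H ?L * Lam ?L"
    unfolding W_def L 2 using assms(1) by (simp only: lsgn_Cons)
  moreover have "(-1) ^ length es * W es X * sgp f ?H =
      ((-1) ^ length es * (-1) ^ length es) * sgp f ?E * lsgn es * (sgp f ?H * sgp f ?L * cr ?E (?H \<union> ?L)) * cr ?H ?L * Lam ?L"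
    unfolding W_def 1 L_def[symmetric] 3 by (simp add: mult_ac)
  moreover have "(-1) ^ length es * (-1 :: complex) ^ length es = 1"
    by (simp add: power_mult_distrib[symmetric])
  ultimately show ?thesis by (simp only: mult_1 mult_ac)
qed

text \<open>Two adjacent letters move together through a word at no cost, so an edge of the
  remainder can be brought to the front. Only its internal order leaves a sign, since
  \<open>Lam\<close> lists the lower half first.\<close>

lemma W_pair:
  assumes "distinct es" "set es \<subseteq> S" "X \<subseteq> S - set es" "closed (S - set es - X)" "g \<in> S - set es - X"
  shows "W (bar g # g # es) X = sg (bar g) g * W es X"
proof -
  define M where "M = S - set es - X - {g, bar g}"
  let ?E = "set es" and ?M = M
  have bg: "bar g \<in> S - ?E - X" using assms by (auto simp: closed_def)
  have fins: "finite ?E" "finite X" "finite ?M" using assms(2,3) fin finite_sub[of X] by (auto simp: subset_iff M_def)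
  have clM: "closed ?M" using assms(4) unfolding closed_def M_def
    by (auto simp: bar_eq_iff)
  have L: "S - ?E - X = insert g (insert (bar g) ?M)" using assms bg by (auto simp: M_def)
  have Y: "S - ?E = insert g (insert (bar g) (X \<union> ?M))" using assms bg by (auto simp: M_def)
  have E1: "set (bar g # g # es) = insert g (insert (bar g) ?E)" by auto
  have Y1: "S - set (bar g # g # es) = X \<union> ?M" using assms bg by (auto simp: M_def)
  have L1: "S - set (bar g # g # es) - X = ?M" by (auto simp: M_def)
  have sM: "M \<subseteq> S" "g \<notin> M" "bar g \<notin> M" "M \<inter> X = {}" "X \<inter> M = {}" by (auto simp: M_def)
  have gn: "g \<noteq> bar g" "bar g \<noteq> g" using assms by auto
  have ls: "lsgn (bar g # g # es) = sg (bar g) g * sgp (bar g) ?E * sgp g ?E * lsgn es"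
    using assms bg gn by (subst lsgn_Cons, simp, subst lsgn_Cons, simp)
      (use assms fins bg gn in \<open>simp add: sgp_insert mult_ac\<close>)
  have c1: "cr (insert g (insert (bar g) ?E)) (X \<union> ?M) =
     sgp g X * sgp g ?M * sgp (bar g) X * sgp (bar g) ?M * cr ?E (X \<union> ?M)"
    using fins assms bg gn sM by (simp add: cr_insert sgp_Un mult_ac)
  have c2: "cr ?E (S - ?E) = sgp g ?E * sgp (bar g) ?E * cr ?E (X \<union> ?M)"
    unfolding Y by (rule cr_insert_pair) (use fins assms bg gn sM in auto)
  have c3: "cr X (S - ?E - X) = sgp g X * sgp (bar g) X * cr X ?M"
    unfolding L by (rule cr_insert_pair) (use fins assms bg gn sM in auto)
  have c4: "Lam (S - ?E - X) = Lam ?M * sgp g ?M * sgp (bar g) ?M"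
    unfolding L using assms clM sM by (intro Lam_insert) auto
  show ?thesis
    unfolding W_def c2 c3 c4 L1 unfolding Y1 ls unfolding E1 c1 by (simp add: mult_ac)
qed

lemma lsgn_append: "lsgn (u @ v) = lsgn u * lsgn v * (\<Prod>x\<leftarrow>u. \<Prod>y\<leftarrow>v. sg x y)"
  by (induction u) (auto simp: mult_ac)

lemma prod_list_sg_flip: "(\<Prod>x\<leftarrow>u. sg x a) = (-1) ^ length u * (\<Prod>x\<leftarrow>u. sg a x)"
  by (induction u) (auto simp: sg_swap[of a])

lemma lsgn_swap: "lsgn (u @ a # v @ b # w) = - lsgn (u @ b # v @ a # w)"
proof -
  have pl: "(\<Prod>x\<leftarrow>v. f x * g x) = (\<Prod>x\<leftarrow>v. f x) * (\<Prod>x\<leftarrow>v. g x)" for f g :: "'h \<Rightarrow> complex" and v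
    by (induction v) auto
  show ?thesis
    by (simp add: lsgn_append pl prod_list_sg_flip sg_swap[of a b] mult_ac)
qed

lemma W_swap: "W (u @ a # v @ b # w) H = - W (u @ b # v @ a # w) H"
proof -
  have "set (u @ a # v @ b # w) = set (u @ b # v @ a # w)" by auto
  then show ?thesis unfolding W_def by (simp only: lsgn_swap[of u a v b w]) simp
qed

end

section \<open>The recursion for the signed generating function\<close>

context halfedges
begin

lemma sgp_less: "(\<And>b. b \<in> B \<Longrightarrow> rk a < rk b) \<Longrightarrow> sgp a B = 1"
  unfolding sgp_def by (rule prod.neutral) (auto simp: sg_def)

lemma sgp_greater: "(\<And>b. b \<in> B \<Longrightarrow> rk b < rk a) \<Longrightarrow> sgp a B = (-1) ^ card B"
  unfolding sgp_def by (subst prod_constant[symmetric], rule prod.cong) (auto simp: sg_def not_less_iff_gr_or_eq)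

text \<open>In increasing order the terms are 1, -1, 1, ..., because \<open>f\<close> contributes
  one minus sign for each smaller element. Induction adds the largest element, which leaves the
  earlier terms unchanged.\<close>

lemma sum_sgp_Diff:
  assumes "finite A" "A \<subseteq> S"
  shows "(\<Sum>f\<in>A. sgp f (A - {f})) = (if odd (card A) then 1 else 0)"
  using assms
proof (induction A rule: finite_ranking_induct[where f = rk])
  case (insert m A)
  show ?case
  proof (cases "m \<in> A")
    case True then show ?thesis using insert by (simp add: insert_absorb)
  next
    case False
    have less: "rk f < rk m" if "f \<in> A" for f
      using insert.hyps(2)[OF that] rk_neq[of f m] insert.prems that False by fastforce
    have "sgp f (insert m A - {f}) = sgp f (A - {f})" if "f \<in> A" for f
    proof -
      have "insert m A - {f} = insert m (A - {f})" using that False by auto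
      then show ?thesis using False insert.hyps(1) less[OF that] by (simp add: sgp_insert sg_def)
    qed
    moreover have "sgp m (insert m A - {m}) = (-1) ^ card A"
      using False less by (simp add: sgp_greater)
    ultimately show ?thesis using False insert by simp
  qed
qed simp

text \<open>The elements below and above \<open>g\<close> give two alternating sums, each 0 or 1 up
  to sign. If \<open>g\<close> is outside \<open>A\<close>, exactly one of the two parts is odd and
  its sum survives. If \<open>g\<close> is in \<open>A\<close>, the parts have equal parity, and the
  contributions cancel when both are odd.\<close>

lemma alternating_sum:
  assumes "finite A" "A \<subseteq> S" "odd (card A)" "g \<in> S"
  shows "(\<Sum>f\<in>A. sg g f * sgp f (A - {f})) = (if g \<in> A then 0 else sgp g A)"
proof -
  define A1 where "A1 = {f \<in> A. rk f < rk g}"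
  define A2 where "A2 = {f \<in> A. rk g < rk f}"
  define G where "G = A \<inter> {g}"
  have tri: "rk x < rk g \<or> rk g < rk x \<or> x = g" if "x \<in> A" for x
    using that assms rk_neq[of x g] by (auto simp: neq_iff)
  have A: "A = A1 \<union> A2 \<union> G"
    using tri by (auto simp: A1_def A2_def G_def)
  have fins: "finite A1" "finite A2" "finite G" using assms by (auto simp: A1_def A2_def G_def)
  have dis: "A1 \<inter> A2 = {}" "(A1 \<union> A2) \<inter> G = {}" by (auto simp: A1_def A2_def G_def)
  have card: "card A = card A1 + card A2 + card G"
    using fins dis by (subst A) (simp add: card_Un_disjoint)
  have 1: "sg g f * sgp f (A - {f}) = - sgp f (A1 - {f})" if "f \<in> A1" for f
  proof -
    have "A - {f} = (A1 - {f}) \<union> (A2 \<union> G)" using that tri by (auto simp: A1_def A2_def G_def)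
    moreover have "(A1 - {f}) \<inter> (A2 \<union> G) = {}" using dis by auto
    moreover have "sgp f (A2 \<union> G) = 1" using that by (intro sgp_less) (auto simp: A1_def A2_def G_def)
    ultimately have "sgp f (A - {f}) = sgp f (A1 - {f})"
      using fins by (simp add: sgp_Un)
    then show ?thesis using that by (simp add: sg_def A1_def)
  qed
  have 2: "sg g f * sgp f (A - {f}) = (-1) ^ (card A1 + card G) * sgp f (A2 - {f})" if "f \<in> A2" for f
  proof -
    have "A - {f} = (A2 - {f}) \<union> (A1 \<union> G)" using that tri by (auto simp: A1_def A2_def G_def)
    moreover have "sgp f (A1 \<union> G) = (-1) ^ card (A1 \<union> G)"
      using that by (intro sgp_greater) (auto simp: A1_def A2_def G_def)
    moreover have "card (A1 \<union> G) = card A1 + card G" using fins dis by (intro card_Un_disjoint) auto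
    moreover have "(A2 - {f}) \<inter> (A1 \<union> G) = {}" using dis by auto
    ultimately have "sgp f (A - {f}) = sgp f (A2 - {f}) * (-1) ^ (card A1 + card G)"
      using fins by (simp add: sgp_Un)
    then show ?thesis using that by (simp add: sg_def A2_def)
  qed
  have "(\<Sum>f\<in>A. sg g f * sgp f (A - {f})) = (\<Sum>f\<in>A1 \<union> A2. sg g f * sgp f (A - {f}))"
    by (rule sum.mono_neutral_right) (use assms(1) in \<open>auto simp: A1_def A2_def dest: tri\<close>)
  also have "\<dots> = (\<Sum>f\<in>A1. sg g f * sgp f (A - {f})) + (\<Sum>f\<in>A2. sg g f * sgp f (A - {f}))"
    using fins dis by (intro sum.union_disjoint) auto
  also have "\<dots> = - (\<Sum>f\<in>A1. sgp f (A1 - {f})) + (-1) ^ (card A1 + card G) * (\<Sum>f\<in>A2. sgp f (A2 - {f}))"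
    using 1 2 by (simp add: sum_negf sum_distrib_left)
  also have "\<dots> = - (if odd (card A1) then 1 else 0) + (-1) ^ (card A1 + card G) * (if odd (card A2) then 1 else 0)"
  proof -
    have "A1 \<subseteq> S" "A2 \<subseteq> S" using assms by (auto simp: A1_def A2_def)
    then show ?thesis using fins by (simp only: sum_sgp_Diff)
  qed
  also have "\<dots> = (if g \<in> A then 0 else sgp g A)"
  proof (cases "g \<in> A")
    case True
    then have "card G = 1" by (simp add: G_def)
    then show ?thesis using True card assms(3) by auto
  next
    case False
    then have G: "G = {}" by (simp add: G_def)
    then have "sgp g A = sgp g A1 * sgp g A2" using fins dis by (subst A) (simp add: sgp_Un)
    also have "sgp g A1 = (-1) ^ card A1" by (rule sgp_greater) (auto simp: A1_def)
    also have "sgp g A2 = 1" by (rule sgp_less) (auto simp: A2_def)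
    finally show ?thesis using False card assms(3) G by auto
  qed
  finally show ?thesis .
qed

lemma sgp_same_org:
  assumes "a \<in> S" "b \<in> S" "org a = org b" "B \<subseteq> S" "\<And>c. c \<in> B \<Longrightarrow> org c \<noteq> org a"
  shows "sgp a B = sgp b B"
  unfolding sgp_def
proof (rule prod.cong)
  fix c assume c: "c \<in> B"
  then have "c \<in> S" "org c \<noteq> org a" using assms by auto
  then have "rk a < rk c \<longleftrightarrow> rk b < rk c" "rk a \<noteq> rk c" "rk b \<noteq> rk c"
    using contiguous[of a b c] rk_neq[of a c] rk_neq[of b c] assms by auto
  then show "sg a c = sg b c" unfolding sg_def by (auto simp: neq_iff)
qed simp

text \<open>By contiguity the elements of \<open>X\<close> at other vertices give the same factor
  for every \<open>f\<close> at the origin of \<open>g\<close>. What remains is the alternating sum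
  over the half-edges at this vertex.\<close>

lemma vertex_sum:
  assumes "X \<subseteq> S" "g \<in> S" "odd (card {h \<in> X. org h = org g})"
  shows "(\<Sum>f\<in>{f \<in> X. org f = org g}. sg g f * sgp f (X - {f})) = (if g \<in> X then 0 else sgp g X)"
proof -
  define A where "A = {h \<in> X. org h = org g}"
  have fins: "finite X" "finite A" using assms finite_sub by (auto simp: A_def)
  have split: "sgp f (X - {f}) = sgp f (A - {f}) * sgp g (X - A)" if "f \<in> A" for f
  proof -
    have "X - {f} = (A - {f}) \<union> (X - A)" using that by (auto simp: A_def)
    then have "sgp f (X - {f}) = sgp f (A - {f}) * sgp f (X - A)"
      using fins by (simp only:) (subst sgp_Un, auto)
    also have "sgp f (X - A) = sgp g (X - A)"
      by (rule sgp_same_org) (use that assms in \<open>auto simp: A_def\<close>)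
    finally show ?thesis .
  qed
  have "(\<Sum>f\<in>A. sg g f * sgp f (X - {f})) = (\<Sum>f\<in>A. sg g f * sgp f (A - {f})) * sgp g (X - A)"
    by (simp add: split sum_distrib_right mult.assoc)
  also have "(\<Sum>f\<in>A. sg g f * sgp f (A - {f})) = (if g \<in> A then 0 else sgp g A)"
    by (rule alternating_sum) (use assms fins in \<open>auto simp: A_def\<close>)
  also have "(if g \<in> A then 0 else sgp g A) * sgp g (X - A) = (if g \<in> X then 0 else sgp g X)"
  proof -
    have "sgp g X = sgp g A * sgp g (X - A)"
      using sgp_Un[of A "X - A" g] fins by (simp add: A_def Un_Diff_cancel2 Un_absorb1 Collect_restrict)
    then show ?thesis by (simp add: A_def)
  qed
  finally show ?thesis by (simp add: A_def)
qed

definition deg :: "'h set \<Rightarrow> 'v \<Rightarrow> nat" where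
  "deg H v = card {h \<in> H. org h = v}"

text \<open>Closedness of the remainder encodes two requirements at midpoints: an edge with no half
  in \<open>E\<close> is used with both halves or not at all, and if \<open>e\<close> is in
  \<open>E\<close> but \<open>bar e\<close> is not, then \<open>bar e\<close> belongs to
  \<open>H\<close>.\<close>

definition C :: "'h set \<Rightarrow> 'h set set" where
  "C E = {H. H \<subseteq> S - E \<and> closed (S - E - H) \<and> (\<forall>v. even (deg H v))}"

text \<open>
  Removing from such a set \<open>X\<close> a half-edge \<open>f\<close> at \<open>v\<close> gives an element of \<open>C (insert f E)\<close>.
\<close>

definition CX :: "'h set \<Rightarrow> 'v \<Rightarrow> 'h set set" where
  "CX E v = {X. X \<subseteq> S - E \<and> closed (S - E - X) \<and> (\<forall>u. odd (deg X u) \<longleftrightarrow> u = v)}"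

definition wt :: "'h set \<Rightarrow> complex" where
  "wt H = (\<Prod>h\<in>H. rho h)"

text \<open>For an even number of distinct entries this turns out to be the sum of
  \<open>\<tau>(H)\<close> times the weight of \<open>H\<close>, up to the constant sign
  \<open>Lam S\<close>.\<close>

definition R :: "'h list \<Rightarrow> complex" where
  "R es = (\<Prod>e\<leftarrow>es. sn e) * (\<Sum>H\<in>C (set es). W es H * wt H)"

text \<open>This is \<open>Khat\<close>, as \<open>Khat_eq_B\<close> shows. The branch for a common
  origin includes \<open>f = g\<close>, where \<open>sg g g = 0\<close> gives the zero
  diagonal.\<close>

definition B :: "'h \<Rightarrow> 'h \<Rightarrow> complex" where
  "B g f = - sn g * sn f * sg g f *
     (if f = bar g then 1 else if org f = org g then rho g * rho f else 0)"

lemma finite_C: "finite (C E)"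
  by (rule finite_subset[of _ "Pow S"]) (use fin in \<open>auto simp: C_def\<close>)

lemma finite_CX: "finite (CX E v)"
  by (rule finite_subset[of _ "Pow S"]) (use fin in \<open>auto simp: CX_def\<close>)

lemma B_antisym: "g \<in> S \<Longrightarrow> f \<in> S \<Longrightarrow> B f g = - B g f"
  unfolding B_def by (subst sg_swap) auto

lemma lsgn_repeat: "f \<in> set es \<Longrightarrow> lsgn (f # es) = 0"
proof -
  assume "f \<in> set es"
  then have "sg f f \<in> set (map (sg f) es)" by force
  then have "(\<Prod>y\<leftarrow>es. sg f y) = 0" by (simp add: prod_list_zero_iff)
  then show ?thesis by simp
qed

lemma R_repeat: "f \<in> set es \<Longrightarrow> R (f # es) = 0"
  unfolding R_def W_def by (simp only: lsgn_repeat) simp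

lemma deg_insert:
  assumes "finite H" "f \<notin> H"
  shows "deg (insert f H) u = deg H u + (if org f = u then 1 else 0)"
proof -
  have "{h \<in> insert f H. org h = u} = (if org f = u then insert f {h \<in> H. org h = u} else {h \<in> H. org h = u})"
    by auto
  then show ?thesis using assms by (simp add: deg_def)
qed

text \<open>Adding \<open>f\<close> to the set instead of to \<open>E\<close> does not change the
  remainder and flips the parity at the origin of \<open>f\<close> only.\<close>

lemma C_insert_iff:
  assumes "f \<in> S - E" "f \<notin> H" "finite H"
  shows "H \<in> C (insert f E) \<longleftrightarrow> insert f H \<in> CX E (org f)"
    and "H \<in> CX (insert f E) (org f) \<longleftrightarrow> insert f H \<in> C E"
proof -
  have L: "S - insert f E - H = S - E - insert f H" by auto
  have sub: "H \<subseteq> S - insert f E \<longleftrightarrow> insert f H \<subseteq> S - E" using assms by auto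
  have "even (deg H u) \<longleftrightarrow> (odd (deg (insert f H) u) \<longleftrightarrow> u = org f)" for u
    using assms by (auto simp: deg_insert)
  then show "H \<in> C (insert f E) \<longleftrightarrow> insert f H \<in> CX E (org f)"
    unfolding C_def CX_def mem_Collect_eq L sub by blast
  have "(odd (deg H u) \<longleftrightarrow> u = org f) \<longleftrightarrow> even (deg (insert f H) u)" for u
    using assms by (auto simp: deg_insert)
  then show "H \<in> CX (insert f E) (org f) \<longleftrightarrow> insert f H \<in> C E"
    unfolding C_def CX_def mem_Collect_eq L sub by blast
qed

lemma C_insert_bij:
  assumes "f \<in> S - E"
  shows "bij_betw (insert f) (C (insert f E)) {X \<in> CX E (org f). f \<in> X}"
proof (rule bij_betw_byWitness[where f' = "\<lambda>X. X - {f}"])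
  show "\<forall>H\<in>C (insert f E). insert f H - {f} = H" by (auto simp: C_def)
  show "\<forall>X\<in>{X \<in> CX E (org f). f \<in> X}. insert f (X - {f}) = X" by auto
  have fX: "finite X" if "X \<subseteq> S - E" for X using that finite_sub by auto
  show "insert f ` C (insert f E) \<subseteq> {X \<in> CX E (org f). f \<in> X}"
  proof safe
    fix H assume H: "H \<in> C (insert f E)"
    then have f: "finite H" "f \<notin> H" using fX by (auto simp: C_def)
    show "insert f H \<in> CX E (org f)"
      using H C_insert_iff(1)[OF assms f(2,1)] by simp
  qed
  show "(\<lambda>X. X - {f}) ` {X \<in> CX E (org f). f \<in> X} \<subseteq> C (insert f E)"
  proof safe
    fix X assume X: "X \<in> CX E (org f)" "f \<in> X"
    then have f: "finite (X - {f})" "f \<notin> X - {f}" "insert f (X - {f}) = X" using fX by (auto simp: CX_def)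
    show "X - {f} \<in> C (insert f E)"
      using X C_insert_iff(1)[OF assms f(2,1)] f(3) by simp
  qed
qed

lemma wt_remove: "X \<subseteq> S \<Longrightarrow> f \<in> X \<Longrightarrow> wt X = rho f * wt (X - {f})"
  unfolding wt_def using finite_sub by (simp add: prod.remove)

text \<open>The factor \<open>rho f\<close>, which an entry of \<open>B\<close> at a common origin
  brings along, is the weight of \<open>f\<close>. Putting \<open>f\<close> back into the
  configuration makes the summation sets comparable for different \<open>f\<close>.\<close>

lemma sum_C_insert:
  assumes "distinct es" "set es \<subseteq> S" "f \<in> S - set es"
  shows "(\<Sum>H\<in>C (set (f # es)). W (f # es) H * wt H) * rho f =
     (-1) ^ length es * (\<Sum>X\<in>{X \<in> CX (set es) (org f). f \<in> X}. W es X * wt X * sgp f (X - {f}))"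
proof -
  have "(\<Sum>X\<in>{X \<in> CX (set es) (org f). f \<in> X}. W (f # es) (X - {f}) * wt (X - {f})) =
     (\<Sum>H\<in>C (insert f (set es)). W (f # es) (insert f H - {f}) * wt (insert f H - {f}))"
    by (rule sum.reindex_bij_betw[OF C_insert_bij[OF assms(3)], symmetric])
  also have "\<dots> = (\<Sum>H\<in>C (set (f # es)). W (f # es) H * wt H)"
  proof (rule sum.cong)
    fix H assume "H \<in> C (set (f # es))"
    then have "insert f H - {f} = H" by (auto simp: C_def)
    then show "W (f # es) (insert f H - {f}) * wt (insert f H - {f}) = W (f # es) H * wt H" by (simp only:)
  qed simp
  finally have "(\<Sum>H\<in>C (set (f # es)). W (f # es) H * wt H) * rho f =
     (\<Sum>X\<in>{X \<in> CX (set es) (org f). f \<in> X}. W (f # es) (X - {f}) * wt (X - {f})) * rho f"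
    by (simp only:)
  also have "\<dots> = (\<Sum>X\<in>{X \<in> CX (set es) (org f). f \<in> X}. W (f # es) (X - {f}) * (rho f * wt (X - {f})))"
    by (simp add: sum_distrib_left mult_ac)
  also have "\<dots> = (\<Sum>X\<in>{X \<in> CX (set es) (org f). f \<in> X}. (-1) ^ length es * (W es X * wt X * sgp f (X - {f})))"
  proof (rule sum.cong)
    fix X assume "X \<in> {X \<in> CX (set es) (org f). f \<in> X}"
    then have X: "X \<subseteq> S - set es" "f \<in> X" "X \<subseteq> S" by (auto simp: CX_def)
    then show "W (f # es) (X - {f}) * (rho f * wt (X - {f})) = (-1) ^ length es * (W es X * wt X * sgp f (X - {f}))"
      using W_Cons[OF assms(1,2) X(1,2)] wt_remove[OF X(3,2)] by simp
  qed simp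
  finally show ?thesis by (simp add: sum_distrib_left)
qed

text \<open>After the sums over \<open>f\<close> and \<open>X\<close> are exchanged, each fixed
  \<open>X\<close> carries the sum over its half-edges at the origin of \<open>g\<close>, which
  \<open>vertex_sum\<close> evaluates.\<close>

lemma short_sum:
  assumes "distinct es" "set es \<subseteq> S" "odd (length es)" "g \<in> S"
  shows "(\<Sum>f\<in>{f \<in> S. org f = org g}. - sn g * sn f * sg g f * (rho g * rho f) * R (f # es)) =
    sn g * rho g * (\<Prod>e\<leftarrow>es. sn e) *
      (\<Sum>X\<in>CX (set es) (org g). W es X * wt X * (if g \<in> X then 0 else sgp g X))"
proof -
  let ?v = "org g" and ?p = "\<Prod>e\<leftarrow>es. sn e"
  have "(\<Sum>f\<in>{f \<in> S. org f = ?v}. - sn g * sn f * sg g f * (rho g * rho f) * R (f # es)) =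
     (\<Sum>f\<in>{f \<in> S - set es. org f = ?v}. - sn g * sn f * sg g f * (rho g * rho f) * R (f # es))"
    by (rule sum.mono_neutral_right) (use fin R_repeat in auto)
  also have "\<dots> = (\<Sum>f\<in>{f \<in> S - set es. org f = ?v}. sn g * rho g * ?p *
      (\<Sum>X\<in>{X \<in> CX (set es) ?v. f \<in> X}. W es X * wt X * (sg g f * sgp f (X - {f}))))"
  proof (rule sum.cong)
    fix f assume f: "f \<in> {f \<in> S - set es. org f = ?v}"
    then have "- sn g * sn f * sg g f * (rho g * rho f) * R (f # es) =
      - sn g * (sn f * sn f) * sg g f * rho g * ?p * ((\<Sum>H\<in>C (set (f # es)). W (f # es) H * wt H) * rho f)"
      by (simp add: R_def mult_ac)
    also have "\<dots> = sn g * rho g * ?p * sg g f * (\<Sum>X\<in>{X \<in> CX (set es) ?v. f \<in> X}. W es X * wt X * sgp f (X - {f}))"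
      using f assms by (subst sum_C_insert) (auto simp: sn_square mult_ac)
    finally show "- sn g * sn f * sg g f * (rho g * rho f) * R (f # es) = sn g * rho g * ?p *
      (\<Sum>X\<in>{X \<in> CX (set es) ?v. f \<in> X}. W es X * wt X * (sg g f * sgp f (X - {f})))"
      by (simp add: sum_distrib_left mult_ac)
  qed simp
  also have "\<dots> = sn g * rho g * ?p * (\<Sum>f\<in>{f \<in> S - set es. org f = ?v}.
      (\<Sum>X\<in>{X \<in> CX (set es) ?v. f \<in> X}. W es X * wt X * (sg g f * sgp f (X - {f}))))"
    by (simp add: sum_distrib_left)
  also have "(\<Sum>f\<in>{f \<in> S - set es. org f = ?v}.
      (\<Sum>X\<in>{X \<in> CX (set es) ?v. f \<in> X}. W es X * wt X * (sg g f * sgp f (X - {f})))) =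
    (\<Sum>X\<in>CX (set es) ?v. \<Sum>f\<in>{f \<in> {f \<in> S - set es. org f = ?v}. f \<in> X}. W es X * wt X * (sg g f * sgp f (X - {f})))"
    by (rule sum.swap_restrict) (use fin finite_CX in auto)
  also have "\<dots> = (\<Sum>X\<in>CX (set es) ?v. W es X * wt X * (if g \<in> X then 0 else sgp g X))"
  proof (rule sum.cong)
    fix X assume X: "X \<in> CX (set es) ?v"
    then have "{f \<in> {f \<in> S - set es. org f = ?v}. f \<in> X} = {f \<in> X. org f = ?v}" by (auto simp: CX_def)
    moreover have "(\<Sum>f\<in>{f \<in> X. org f = ?v}. sg g f * sgp f (X - {f})) = (if g \<in> X then 0 else sgp g X)"
      by (rule vertex_sum) (use X assms(4) in \<open>auto simp: CX_def deg_def\<close>)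
    ultimately show "(\<Sum>f\<in>{f \<in> {f \<in> S - set es. org f = ?v}. f \<in> X}. W es X * wt X * (sg g f * sgp f (X - {f}))) =
       W es X * wt X * (if g \<in> X then 0 else sgp g X)"
      by (simp only: sum_distrib_left[symmetric])
  qed simp
  finally show ?thesis .
qed

lemma sum_B_R:
  assumes "distinct es" "set es \<subseteq> S" "odd (length es)" "g \<in> S"
  shows "(\<Sum>f\<in>S. B g f * R (f # es)) =
    sn g * rho g * (\<Prod>e\<leftarrow>es. sn e) *
      (\<Sum>X\<in>{X \<in> CX (set es) (org g). g \<notin> X}. W es X * wt X * sgp g X)
    - sn g * sn (bar g) * sg g (bar g) * R (bar g # es)"
proof -
  have "(\<Sum>f\<in>S. B g f * R (f # es)) = (\<Sum>f\<in>S. (if f = bar g then - sn g * sn (bar g) * sg g (bar g) * R (bar g # es) else 0)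
      + (if org f = org g then - sn g * sn f * sg g f * (rho g * rho f) * R (f # es) else 0))"
    by (rule sum.cong) (auto simp: B_def org_bar[OF assms(4)])
  also have "\<dots> = - sn g * sn (bar g) * sg g (bar g) * R (bar g # es) +
     (\<Sum>f\<in>{f \<in> S. org f = org g}. - sn g * sn f * sg g f * (rho g * rho f) * R (f # es))"
    unfolding sum.distrib sum.inter_filter[OF fin] using fin assms(4) by simp
  also have "(\<Sum>f\<in>{f \<in> S. org f = org g}. - sn g * sn f * sg g f * (rho g * rho f) * R (f # es)) =
    sn g * rho g * (\<Prod>e\<leftarrow>es. sn e) *
      (\<Sum>X\<in>CX (set es) (org g). W es X * wt X * (if g \<in> X then 0 else sgp g X))"
    by (rule short_sum[OF assms])
  also have "(\<Sum>X\<in>CX (set es) (org g). W es X * wt X * (if g \<in> X then 0 else sgp g X)) =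
     (\<Sum>X\<in>{X \<in> CX (set es) (org g). g \<notin> X}. W es X * wt X * sgp g X)"
    by (rule sum.mono_neutral_cong_right) (use finite_CX in auto)
  finally show ?thesis by simp
qed

lemma sg_bar_square: "g \<in> S \<Longrightarrow> sg g (bar g) * sg g (bar g) = 1"
  by (rule sg_square) auto

text \<open>
  With \<open>B_R_Cons_notin\<close> below, this is the expansion of a Pfaffian along a row: as a function of
  its first entry, \<open>R\<close> is mapped by \<open>B\<close> to a vector supported on the other entries.
\<close>

theorem B_R_Cons_Cons:
  assumes d: "distinct (g # es)" "set (g # es) \<subseteq> S" "even (length es)"
  shows "(\<Sum>f\<in>S. B g f * R (f # g # es)) = R es"
proof -
  let ?E = "set es" and ?p = "\<Prod>e\<leftarrow>es. sn e"
  have g: "g \<in> S" "g \<notin> ?E" "distinct es" "?E \<subseteq> S" using d by auto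
  let ?Y = "{X \<in> CX ?E (org g). g \<in> X}"
  \<comment> \<open>Here \<open>X\<close> avoids \<open>g\<close> because \<open>g\<close> is in the
    list. Putting \<open>g\<close> back yields exactly the configurations for \<open>es\<close> that
    contain \<open>g\<close>.\<close>
  have 1: "sn g * rho g * (\<Prod>e\<leftarrow>g # es. sn e) *
      (\<Sum>X\<in>{X \<in> CX (set (g # es)) (org g). g \<notin> X}. W (g # es) X * wt X * sgp g X) =
     ?p * (\<Sum>H\<in>{H \<in> C ?E. g \<in> H}. W es H * wt H)"
  proof -
    have "(\<Sum>X\<in>{X \<in> CX (set (g # es)) (org g). g \<notin> X}. rho g * (W (g # es) X * wt X * sgp g X)) =
       (\<Sum>H\<in>{H \<in> C ?E. g \<in> H}. W es H * wt H)"
    proof (rule sum.reindex_bij_witness[where i = "\<lambda>H. H - {g}" and j = "insert g"])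
      fix X assume X: "X \<in> {X \<in> CX (set (g # es)) (org g). g \<notin> X}"
      then have f: "finite X" "g \<notin> X" "X \<subseteq> S" using finite_sub by (auto simp: CX_def)
      show "insert g X - {g} = X" using f by auto
      show "insert g X \<in> {H \<in> C ?E. g \<in> H}"
        using X g C_insert_iff(2)[of g ?E X] f by auto
      have "W (g # es) (insert g X - {g}) = (-1) ^ length es * W es (insert g X) * sgp g (insert g X - {g})"
        by (rule W_Cons) (use g X in \<open>auto simp: CX_def\<close>)
      then have "W (g # es) X = W es (insert g X) * sgp g X" using f d(3) by simp
      moreover have "sgp g X * sgp g X = 1" using f g by (intro sgp_square) auto
      ultimately have "W (g # es) X * sgp g X = W es (insert g X)" by simp
      moreover have "wt (insert g X) = rho g * wt X" using f by (simp add: wt_def)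
      ultimately show "W es (insert g X) * wt (insert g X) = rho g * (W (g # es) X * wt X * sgp g X)"
        by (metis (no_types, opaque_lifting) mult.assoc mult.commute)
    next
      fix H assume H: "H \<in> {H \<in> C ?E. g \<in> H}"
      then have f: "finite (H - {g})" "g \<notin> H - {g}" "insert g (H - {g}) = H" "H \<subseteq> S"
        using finite_sub[of H] by (auto simp: C_def)
      show "insert g (H - {g}) = H" by fact
      show "H - {g} \<in> {X \<in> CX (set (g # es)) (org g). g \<notin> X}"
        using H g C_insert_iff(2)[of g ?E "H - {g}"] f by auto
    qed
    moreover have "sn g * rho g * (\<Prod>e\<leftarrow>g # es. sn e) *
        (\<Sum>X\<in>{X \<in> CX (set (g # es)) (org g). g \<notin> X}. W (g # es) X * wt X * sgp g X) =
      (sn g * sn g) * ?p *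
        (\<Sum>X\<in>{X \<in> CX (set (g # es)) (org g). g \<notin> X}. rho g * (W (g # es) X * wt X * sgp g X))"
      unfolding sum_distrib_left[symmetric] by simp
    ultimately show ?thesis using sn_square[OF g(1)] by simp
  qed
  \<comment> \<open>A configuration for \<open>es\<close> without \<open>g\<close> has the whole
    edge of \<open>g\<close> in its remainder, so \<open>W_pair\<close> applies. If
    \<open>bar g\<close> is in \<open>es\<close>, then \<open>g\<close> is forced into every
    configuration and both sides vanish.\<close>
  have 2: "- sn g * sn (bar g) * sg g (bar g) * R (bar g # g # es) = ?p * (\<Sum>H\<in>{H \<in> C ?E. g \<notin> H}. W es H * wt H)"
  proof (cases "bar g \<in> ?E")
    case True
    have emp: "{H \<in> C ?E. g \<notin> H} = {}"
    proof safe
      fix H assume "H \<in> C ?E" "g \<notin> H"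
      then have "bar g \<in> S - ?E - H" using g by (auto simp: C_def closed_def)
      then show "H \<in> {}" using True by auto
    qed
    show ?thesis unfolding emp using True by (simp add: R_repeat)
  next
    case False
    have bg: "bar g \<in> S" "bar g \<noteq> g" using g by auto
    have CE: "C (set (bar g # g # es)) = {H \<in> C ?E. g \<notin> H}"
    proof (intro equalityI subsetI)
      fix H assume H: "H \<in> C (set (bar g # g # es))"
      then have "S - ?E - H = insert g (insert (bar g) (S - set (bar g # g # es) - H))"
        using g bg False by (auto simp: C_def)
      then show "H \<in> {H \<in> C ?E. g \<notin> H}" using H g bg by (auto simp: C_def closed_def)
    next
      fix H assume H: "H \<in> {H \<in> C ?E. g \<notin> H}"
      then have "bar g \<in> S - ?E - H" using g by (auto simp: C_def closed_def)
      then show "H \<in> C (set (bar g # g # es))" using H g bg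
        by (auto simp: C_def closed_def bar_eq_iff)
    qed
    have "W (bar g # g # es) H = sg (bar g) g * W es H" if "H \<in> {H \<in> C ?E. g \<notin> H}" for H
      by (rule W_pair) (use that g in \<open>auto simp: C_def\<close>)
    then have "R (bar g # g # es) = sn (bar g) * sn g * ?p * (sg (bar g) g * (\<Sum>H\<in>{H \<in> C ?E. g \<notin> H}. W es H * wt H))"
      unfolding R_def CE by (simp add: sum_distrib_left mult_ac)
    then have "- sn g * sn (bar g) * sg g (bar g) * R (bar g # g # es) =
       (sn g * sn g) * (sn (bar g) * sn (bar g)) * (sg g (bar g) * sg g (bar g)) * (?p * (\<Sum>H\<in>{H \<in> C ?E. g \<notin> H}. W es H * wt H))"
      by (simp add: sg_swap[of "bar g" g] mult_ac)
    then show ?thesis using g bg by (simp add: sn_square sg_bar_square)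
  qed
  have "(\<Sum>f\<in>S. B g f * R (f # g # es)) = ?p * (\<Sum>H\<in>{H \<in> C ?E. g \<in> H}. W es H * wt H)
     + ?p * (\<Sum>H\<in>{H \<in> C ?E. g \<notin> H}. W es H * wt H)"
    using sum_B_R[OF d(1,2) _ g(1)] d(3) unfolding 1 2[symmetric] by simp
  also have "\<dots> = R es"
    unfolding R_def distrib_left[symmetric]
    by (subst sum.union_disjoint[symmetric]) (use finite_C in \<open>auto intro!: sum.cong arg_cong2[where f="(*)"]\<close>)
  finally show ?thesis .
qed

theorem B_R_Cons_notin:
  assumes d: "distinct es" "set es \<subseteq> S" "odd (length es)" and g: "g \<in> S" "g \<notin> set es"
  shows "(\<Sum>f\<in>S. B g f * R (f # es)) = 0"
proof -
  let ?E = "set es" and ?p = "\<Prod>e\<leftarrow>es. sn e"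
  \<comment> \<open>The entry at \<open>bar g\<close> cancels those at the common origin:
    \<open>g\<close> is forced into every configuration for \<open>bar g # es\<close>, and removing
    it gives the sets \<open>X\<close>.\<close>
  have "sn g * sn (bar g) * sg g (bar g) * R (bar g # es) =
    sn g * rho g * ?p * (\<Sum>X\<in>{X \<in> CX ?E (org g). g \<notin> X}. W es X * wt X * sgp g X)"
  proof (cases "bar g \<in> ?E")
    case True
    have emp: "{X \<in> CX ?E (org g). g \<notin> X} = {}"
    proof safe
      fix X assume "X \<in> CX ?E (org g)" "g \<notin> X"
      then have "bar g \<in> S - ?E - X" using g by (auto simp: CX_def closed_def)
      then show "X \<in> {}" using True by auto
    qed
    show ?thesis unfolding emp using True by (simp add: R_repeat)
  next
    case False
    have bg: "bar g \<in> S" "bar g \<noteq> g" using g by auto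
    have L: "S - ?E - X = insert g (insert (bar g) (S - set (bar g # es) - insert g X))"
      if "X \<subseteq> S - ?E" "g \<notin> X" "bar g \<notin> X" for X using that g bg False by auto
    have "(\<Sum>X\<in>{X \<in> CX ?E (org g). g \<notin> X}. sg g (bar g) * rho g * (W es X * wt X * sgp g X)) =
       (\<Sum>H\<in>C (set (bar g # es)). W (bar g # es) H * wt H)"
    proof (rule sum.reindex_bij_witness[where i = "\<lambda>H. H - {g}" and j = "insert g"])
      fix X assume X: "X \<in> {X \<in> CX ?E (org g). g \<notin> X}"
      then have f: "finite X" "g \<notin> X" "X \<subseteq> S" "X \<subseteq> S - ?E" and clX: "closed (S - ?E - X)"
        using finite_sub by (auto simp: CX_def)
      then have gL: "g \<in> S - ?E - X" "bar g \<in> S - ?E - X" using g by (auto simp: closed_def)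
      show "insert g X - {g} = X" using f by auto
      have "S - set (bar g # es) - insert g X = (S - ?E - X) - {g, bar g}" by auto
      moreover have "closed ((S - ?E - X) - {g, bar g})" using clX
        unfolding closed_def by (auto simp: bar_eq_iff)
      ultimately have cl: "closed (S - set (bar g # es) - insert g X)" by simp
      then show "insert g X \<in> C (set (bar g # es))"
        using X g bg gL by (simp add: CX_def C_def deg_insert[OF f(1,2)]) (auto, metis)
      \<comment> \<open>The word sign of \<open>g # bar g # es\<close> with \<open>X\<close> is
        computed twice: by extracting \<open>g\<close> from the larger set, and by deleting the
        adjacent pair \<open>g\<close>, \<open>bar g\<close>.\<close>
      have "W (g # bar g # es) (insert g X - {g}) =
          (-1) ^ length (bar g # es) * W (bar g # es) (insert g X) * sgp g (insert g X - {g})"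
        by (rule W_Cons) (use g bg False d gL f in auto)
      then have "W (g # bar g # es) X = W (bar g # es) (insert g X) * sgp g X" using f d(3) by simp
      moreover have "W (bar (bar g) # bar g # es) X = sg (bar (bar g)) (bar g) * W es X"
        by (rule W_pair) (use d f clX gL in auto)
      moreover have "sgp g X * sgp g X = 1" using f g by (intro sgp_square) auto
      ultimately have "W (bar g # es) (insert g X) = sg g (bar g) * W es X * sgp g X"
        by (metis (no_types, opaque_lifting) bar_bar mult.assoc mult.right_neutral)
      moreover have "wt (insert g X) = rho g * wt X" using f by (simp add: wt_def)
      ultimately show "W (bar g # es) (insert g X) * wt (insert g X) = sg g (bar g) * rho g * (W es X * wt X * sgp g X)"
        by (simp add: mult_ac)
    next
      fix H assume H: "H \<in> C (set (bar g # es))"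
      have gH: "g \<in> H"
      proof (rule ccontr)
        assume "g \<notin> H"
        then have "g \<in> S - set (bar g # es) - H" using g bg by auto
        then have "bar g \<in> S - set (bar g # es) - H" using H by (auto simp: C_def closed_def)
        then show False by simp
      qed
      then have f: "finite (H - {g})" "g \<notin> H - {g}" "insert g (H - {g}) = H" "H \<subseteq> S - set (bar g # es)"
        using H finite_sub[of H] by (auto simp: C_def)
      show "insert g (H - {g}) = H" by fact
      have "S - ?E - (H - {g}) = insert g (insert (bar g) (S - set (bar g # es) - H))"
        using f g bg False gH by auto
      then have "closed (S - ?E - (H - {g}))" using H g bg by (auto simp: C_def closed_def)
      moreover have "odd (deg (H - {g}) u) \<longleftrightarrow> u = org g" for u
      proof -
        have "even (deg H u)" using H by (simp add: C_def)
        then show ?thesis using deg_insert[OF f(1,2), of u] unfolding f(3) by (auto split: if_splits)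
      qed
      ultimately show "H - {g} \<in> {X \<in> CX ?E (org g). g \<notin> X}"
        using f unfolding CX_def by auto
    qed
    then have RR: "R (bar g # es) = sn (bar g) * ?p * (sg g (bar g) * rho g * (\<Sum>X\<in>{X \<in> CX ?E (org g). g \<notin> X}. W es X * wt X * sgp g X))"
      unfolding R_def by (simp add: sum_distrib_left)
    have "sn g * sn (bar g) * sg g (bar g) * R (bar g # es) = (sn (bar g) * sn (bar g)) * (sg g (bar g) * sg g (bar g)) *
      (sn g * rho g * ?p * (\<Sum>X\<in>{X \<in> CX ?E (org g). g \<notin> X}. W es X * wt X * sgp g X))"
      unfolding RR by (simp add: mult_ac)
    then show ?thesis using bg g by (simp add: sn_square sg_bar_square)
  qed
  then show ?thesis unfolding sum_B_R[OF d g(1)] by (simp only: diff_self)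
qed

end

section \<open>Pfaffian of the inverse\<close>

lemma map_transpose_upt:
  assumes "l \<le> a" "a < b" "b < m"
  shows "map (e \<circ> Transposition.transpose a b) [l..<m] =
    map e [l..<a] @ e b # map e [Suc a..<b] @ e a # map e [Suc b..<m]"
    and "map e [l..<m] = map e [l..<a] @ e a # map e [Suc a..<b] @ e b # map e [Suc b..<m]"
proof -
  have *: "[l..<m] = [l..<a] @ a # [Suc a..<b] @ b # [Suc b..<m]"
    using upt_add_eq_append[of l a "m - a"] upt_add_eq_append[of "Suc a" b "m - b"] assms
    by (simp add: upt_conv_Cons)
  show "map e [l..<m] = map e [l..<a] @ e a # map e [Suc a..<b] @ e b # map e [Suc b..<m]"
    by (simp add: *)
  show "map (e \<circ> Transposition.transpose a b) [l..<m] =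
    map e [l..<a] @ e b # map e [Suc a..<b] @ e a # map e [Suc b..<m]"
    unfolding * using assms by (auto simp: Transposition.transpose_def)
qed

lemma prod_list_permute:
  fixes F :: "'a \<Rightarrow> complex"
  assumes "\<sigma> permutes {0..<m}"
  shows "(\<Prod>x\<leftarrow>map (e \<circ> \<sigma>) [0..<m]. F x) = (\<Prod>x\<leftarrow>map e [0..<m]. F x)"
proof -
  have "(\<Prod>i\<in>{0..<m}. F (e (\<sigma> i))) = (\<Prod>i\<in>{0..<m}. F (e i))"
    using prod.permute[OF assms, of "\<lambda>i. F (e i)"] by (simp add: o_def)
  then show ?thesis
    using prod.distinct_set_conv_list[of "[0..<m]" "\<lambda>i. F (e (\<sigma> i))"]
      prod.distinct_set_conv_list[of "[0..<m]" "\<lambda>i. F (e i)"] by (simp add: o_def)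
qed

context halfedges
begin

lemma R_swap: "R (u @ a # v @ b # w) = - R (u @ b # v @ a # w)"
proof -
  have s: "set (u @ a # v @ b # w) = set (u @ b # v @ a # w)" by auto
  show ?thesis unfolding R_def s W_swap[of u a v b w] by (simp add: sum_negf mult_ac)
qed

lemma lsgn_permute:
  assumes "\<sigma> permutes {0..<m}"
  shows "lsgn (map (e \<circ> \<sigma>) [0..<m]) = of_int (sign \<sigma>) * lsgn (map e [0..<m])"
  using finite_atLeastLessThan assms
proof (induction rule: permutes_rev_induct)
  case (swap a b p)
  have *: "lsgn (map ((e \<circ> p) \<circ> Transposition.transpose a b) [0..<m]) = - lsgn (map (e \<circ> p) [0..<m])" if "a < b" "b < m" for a b
    using that by (simp only: map_transpose_upt(1)[of 0 a b m "e \<circ> p"] map_transpose_upt(2)[of 0 a b m "e \<circ> p"]) (rule lsgn_swap)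
  show ?case
  proof (cases "a = b")
    case False
    have "lsgn (map ((e \<circ> p) \<circ> Transposition.transpose a b) [0..<m]) = - lsgn (map (e \<circ> p) [0..<m])"
      using *[of a b] *[of b a] False swap.hyps by (cases "a < b") (auto simp: Transposition.transpose_commute)
    moreover have "sign (p \<circ> Transposition.transpose a b) = - sign p"
      using False permutes_imp_permutation[OF _ swap.hyps(4)]
      by (simp add: sign_compose permutation_swap_id sign_swap_id)
    ultimately show ?thesis unfolding comp_assoc[symmetric] by (simp only: swap.IH) simp
  qed (use swap in simp)
qed simp_all

text \<open>The normalized two-point function, which \<open>B_M\<close> and \<open>M_B\<close>
  identify as the inverse of \<open>B\<close>.\<close>

definition M :: "'h \<Rightarrow> 'h \<Rightarrow> complex" where
  "M f e = R [f, e] / R []"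

lemma M_antisym: "M f e = - M e f"
  using R_swap[of "[]" f "[]" e "[]"] by (simp add: M_def)

lemma B_M:
  assumes "R [] \<noteq> 0" "g \<in> S" "e \<in> S"
  shows "(\<Sum>f\<in>S. B g f * M f e) = (if g = e then 1 else 0)"
proof -
  have "(\<Sum>f\<in>S. B g f * R [f, e]) = (if g = e then R [] else 0)"
    using B_R_Cons_Cons[of e "[]"] B_R_Cons_notin[of "[e]" g] assms by auto
  moreover have "(\<Sum>f\<in>S. B g f * M f e) = (\<Sum>f\<in>S. B g f * R [f, e]) / R []"
    by (simp add: M_def sum_divide_distrib)
  ultimately show ?thesis using assms(1) by simp
qed

lemma M_B:
  assumes "R [] \<noteq> 0" "g \<in> S" "e \<in> S"
  shows "(\<Sum>f\<in>S. M e f * B f g) = (if e = g then 1 else 0)"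
proof -
  have "(\<Sum>f\<in>S. M e f * B f g) = (\<Sum>f\<in>S. B g f * M f e)"
    by (rule sum.cong) (use assms B_antisym[of g] in \<open>simp_all add: M_antisym[of e] mult_ac\<close>)
  then show ?thesis using B_M[OF assms] by auto
qed

text \<open>Inserting the identity as \<open>M\<close> times \<open>B\<close> moves the first entry
  into \<open>M\<close>. By \<open>B_R_Cons_notin\<close> only those \<open>g\<close> survive that
  are among the other entries.\<close>

lemma R_row:
  assumes "R [] \<noteq> 0" "distinct es" "set es \<subseteq> S" "odd (length es)" "f \<in> S"
  shows "R (f # es) = (\<Sum>g\<in>set es. M f g * (\<Sum>h\<in>S. B g h * R (h # es)))"
proof -
  have "R (f # es) = (\<Sum>h\<in>S. (if f = h then 1 else 0) * R (h # es))"
    using fin assms(5) by (simp add: if_distrib[where f = "\<lambda>c. c * _"] cong: if_cong)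
  also have "\<dots> = (\<Sum>h\<in>S. \<Sum>g\<in>S. M f g * (B g h * R (h # es)))"
    by (rule sum.cong) (use M_B[OF assms(1) _ assms(5)] in \<open>simp_all add: sum_distrib_right[symmetric] mult.assoc[symmetric]\<close>)
  also have "\<dots> = (\<Sum>g\<in>S. M f g * (\<Sum>h\<in>S. B g h * R (h # es)))"
    by (subst sum.swap) (simp add: sum_distrib_left)
  also have "\<dots> = (\<Sum>g\<in>set es. M f g * (\<Sum>h\<in>S. B g h * R (h # es)))"
    by (rule sum.mono_neutral_right) (use fin assms B_R_Cons_notin in auto)
  finally show ?thesis .
qed

text \<open>To apply the recursion at \<open>e k\<close>, this entry must stand directly after the
  summation variable; the transposition with \<open>Suc a\<close> puts it there. The sign is that of
  the transposition, which is the identity for \<open>k = Suc a\<close>.\<close>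

lemma R_row_upt:
  assumes R: "R [] \<noteq> 0" and e: "inj_on e {a..<m}" "e ` {a..<m} \<subseteq> S" and a: "a < m" "even (m - a)"
  shows "R (map e [a..<m]) = (\<Sum>k\<in>{Suc a..<m}. M (e a) (e k) *
     ((if k = Suc a then 1 else -1) * R (map (e \<circ> Transposition.transpose (Suc a) k) [a+2..<m])))"
proof -
  let ?es = "map e [Suc a..<m]"
  have es: "distinct ?es" "set ?es \<subseteq> S" "odd (length ?es)" "e a \<in> S"
    using e a by (auto simp: distinct_map intro: inj_on_subset)
  have i: "inj_on e {Suc a..<m}" using e by (auto intro: inj_on_subset)
  have key: "(\<Sum>h\<in>S. B (e k) h * R (h # ?es)) =
     (if k = Suc a then 1 else -1) * R (map (e \<circ> Transposition.transpose (Suc a) k) [a+2..<m])"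
    if k: "k \<in> {Suc a..<m}" for k
  proof -
    let ?e = "e \<circ> Transposition.transpose (Suc a) k"
    have c: "map ?e [Suc a..<m] = e k # map ?e [a+2..<m]"
      using k by (simp add: upt_conv_Cons)
    have t: "Transposition.transpose (Suc a) k permutes {Suc a..<m}"
      using k by (intro permutes_swap_id) auto
    have "distinct (map ?e [Suc a..<m])"
      using comp_inj_on[OF permutes_inj_on[OF t, of "{Suc a..<m}"], of e] i permutes_image[OF t]
      by (simp add: distinct_map)
    moreover have "set (map ?e [Suc a..<m]) = set ?es"
      by (simp only: set_map image_comp[symmetric] set_upt permutes_image[OF t])
    moreover have "even (length (map ?e [a+2..<m]))" using a by auto
    ultimately have B: "(\<Sum>h\<in>S. B (e k) h * R (h # map ?e [Suc a..<m])) = R (map ?e [a+2..<m])"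
      unfolding c by (intro B_R_Cons_Cons) (use es in auto)
    have "R (h # map ?e [Suc a..<m]) = (if k = Suc a then 1 else -1) * R (h # ?es)" for h
    proof (cases "k = Suc a")
      case False
      then have k': "Suc a \<le> Suc a" "Suc a < k" "k < m" using k by auto
      show ?thesis
        using False R_swap[of "[h]" "e k" "map e [Suc (Suc a)..<k]" "e (Suc a)" "map e [Suc k..<m]"]
        unfolding map_transpose_upt[OF k', of e] by simp
    qed simp
    then have "(\<Sum>h\<in>S. B (e k) h * R (h # map ?e [Suc a..<m])) =
       (if k = Suc a then 1 else -1) * (\<Sum>h\<in>S. B (e k) h * R (h # ?es))"
      by (simp add: sum_distrib_left mult_ac)
    then show ?thesis unfolding B by auto
  qed
  have "R (map e [a..<m]) = R (e a # ?es)" using a by (simp add: upt_conv_Cons)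
  also have "\<dots> = (\<Sum>g\<in>e ` {Suc a..<m}. M (e a) g * (\<Sum>h\<in>S. B g h * R (h # ?es)))"
    using R_row[OF R es] by simp
  also have "\<dots> = (\<Sum>k\<in>{Suc a..<m}. M (e a) (e k) * (\<Sum>h\<in>S. B (e k) h * R (h # ?es)))"
    by (simp only: sum.reindex[OF i] o_def)
  finally show ?thesis using key by simp
qed

text \<open>
  \<open>T e n j\<close> interpolates between \<open>R\<close> (\<open>j = 0\<close>) and the sum defining the Pfaffian (\<open>j = n\<close>).
  In each step all terms of the row expansion contribute equally, as they differ by a
  transposition that the sum over permutations absorbs.
\<close>

definition T :: "(nat \<Rightarrow> 'h) \<Rightarrow> nat \<Rightarrow> nat \<Rightarrow> complex" where
  "T e n j = (\<Sum>\<sigma>\<in>{\<sigma>. \<sigma> permutes {0..<2*n}}. of_int (sign \<sigma>) *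
     (\<Prod>i<j. M (e (\<sigma> (2*i))) (e (\<sigma> (2*i+1)))) * R (map (e \<circ> \<sigma>) [2*j..<2*n]))"

lemma T_step:
  assumes R: "R [] \<noteq> 0" and e: "inj_on e {0..<2*n}" "e ` {0..<2*n} \<subseteq> S" and j: "j < n"
  shows "T e n j = of_nat (2 * (n - j) - 1) * T e n (Suc j)"
proof -
  let ?P = "{\<sigma>. \<sigma> permutes {0..<2*n}}" and ?a = "2 * j"
  define F where "F \<sigma> = of_int (sign \<sigma>) * (\<Prod>i<Suc j. M (e (\<sigma> (2*i))) (e (\<sigma> (2*i+1)))) *
     R (map (e \<circ> \<sigma>) [2 * Suc j..<2*n])" for \<sigma>
  have "T e n j = (\<Sum>\<sigma>\<in>?P. \<Sum>k\<in>{Suc ?a..<2*n}. F (\<sigma> \<circ> Transposition.transpose (Suc ?a) k))"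
    unfolding T_def
  proof (rule sum.cong)
    fix \<sigma> assume "\<sigma> \<in> ?P"
    then have \<sigma>: "\<sigma> permutes {0..<2*n}" by simp
    let ?c = "of_int (sign \<sigma>) * (\<Prod>i<j. M (e (\<sigma> (2*i))) (e (\<sigma> (2*i+1)))) :: complex"
    have "inj_on (e \<circ> \<sigma>) {0..<2*n}"
      using comp_inj_on[OF permutes_inj_on[OF \<sigma>, of "{0..<2*n}"], of e] e(1) permutes_image[OF \<sigma>] by simp
    then have "inj_on (e \<circ> \<sigma>) {?a..<2*n}" by (rule inj_on_subset) auto
    moreover have "(e \<circ> \<sigma>) ` {?a..<2*n} \<subseteq> S"
    proof -
      have "(e \<circ> \<sigma>) ` {?a..<2*n} \<subseteq> (e \<circ> \<sigma>) ` {0..<2*n}" by auto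
      also have "\<dots> = e ` {0..<2*n}" using permutes_image[OF \<sigma>] by (metis image_comp)
      finally show ?thesis using e by blast
    qed
    ultimately have "R (map (e \<circ> \<sigma>) [?a..<2*n]) = (\<Sum>k\<in>{Suc ?a..<2*n}. M ((e \<circ> \<sigma>) ?a) ((e \<circ> \<sigma>) k) *
     ((if k = Suc ?a then 1 else -1) * R (map ((e \<circ> \<sigma>) \<circ> Transposition.transpose (Suc ?a) k) [?a+2..<2*n])))"
      using R_row_upt[OF R, of "e \<circ> \<sigma>" ?a "2*n"] j by simp
    moreover have "?c * (M ((e \<circ> \<sigma>) ?a) ((e \<circ> \<sigma>) k) *
     ((if k = Suc ?a then 1 else -1) * R (map ((e \<circ> \<sigma>) \<circ> Transposition.transpose (Suc ?a) k) [?a+2..<2*n])))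
      = F (\<sigma> \<circ> Transposition.transpose (Suc ?a) k)" if k: "k \<in> {Suc ?a..<2*n}" for k
    proof -
      let ?t = "Transposition.transpose (Suc ?a) k"
      have s: "of_int (sign (\<sigma> \<circ> ?t)) = (of_int (sign \<sigma>) * (if k = Suc ?a then 1 else -1) :: complex)"
        using permutes_imp_permutation[OF _ \<sigma>] by (simp add: sign_compose permutation_swap_id sign_swap_id)
      have "(\<Prod>i<j. M (e ((\<sigma> \<circ> ?t) (2*i))) (e ((\<sigma> \<circ> ?t) (2*i+1)))) = (\<Prod>i<j. M (e (\<sigma> (2*i))) (e (\<sigma> (2*i+1))))"
        by (rule prod.cong) (use k in \<open>auto simp: Transposition.transpose_def\<close>)
      moreover have "M (e ((\<sigma> \<circ> ?t) (2*j))) (e ((\<sigma> \<circ> ?t) (2*j+1))) = M ((e \<circ> \<sigma>) ?a) ((e \<circ> \<sigma>) k)"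
        using k by (auto simp: Transposition.transpose_def)
      ultimately show ?thesis unfolding F_def s prod.lessThan_Suc
        by (simp add: comp_assoc mult_ac)
    qed
    ultimately show "?c * R (map (e \<circ> \<sigma>) [?a..<2*n]) = (\<Sum>k\<in>{Suc ?a..<2*n}. F (\<sigma> \<circ> Transposition.transpose (Suc ?a) k))"
      by (simp only: sum_distrib_left) simp
  qed simp
  also have "\<dots> = (\<Sum>k\<in>{Suc ?a..<2*n}. \<Sum>\<sigma>\<in>?P. F (\<sigma> \<circ> Transposition.transpose (Suc ?a) k))"
    by (rule sum.swap)
  also have "\<dots> = (\<Sum>k\<in>{Suc ?a..<2*n}. T e n (Suc j))"
  proof (rule sum.cong)
    fix k assume k: "k \<in> {Suc ?a..<2*n}"
    have t: "Transposition.transpose (Suc ?a) k permutes {0..<2*n}" using k by (intro permutes_swap_id) auto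
    have "(\<Sum>\<sigma>\<in>?P. F (\<sigma> \<circ> Transposition.transpose (Suc ?a) k)) = (\<Sum>\<sigma>\<in>?P. F \<sigma>)"
      by (rule sum.reindex_bij_witness[where i = "\<lambda>\<sigma>. \<sigma> \<circ> Transposition.transpose (Suc ?a) k" and j = "\<lambda>\<sigma>. \<sigma> \<circ> Transposition.transpose (Suc ?a) k"])
        (use permutes_compose[OF t] in \<open>auto simp: comp_assoc\<close>)
    then show "(\<Sum>\<sigma>\<in>?P. F (\<sigma> \<circ> Transposition.transpose (Suc ?a) k)) = T e n (Suc j)"
      by (simp only: F_def T_def)
  qed simp
  \<comment> \<open>The factor is the number of possible partners of the first remaining
    entry.\<close>
  also have "\<dots> = of_nat (2 * (n - j) - 1) * T e n (Suc j)"
    by (simp add: diff_mult_distrib2)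
  finally show ?thesis .
qed

theorem R_pfaffian:
  assumes R: "R [] \<noteq> 0" and e: "inj_on e {0..<2*n}" "e ` {0..<2*n} \<subseteq> S"
  shows "R (map e [0..<2*n]) = R [] * pfaffian n (\<lambda>j k. M (e j) (e k))"
proof -
  \<comment> \<open>The constant is the product of the odd numbers 1, 3, ...,
    \<open>2 * k - 1\<close> collected in \<open>k\<close> steps.\<close>
  have "T e n (n - k) = fact (2 * k) / (2 ^ k * fact k) * T e n n" if "k \<le> n" for k
    using that
  proof (induction k)
    case (Suc k)
    have "T e n (n - Suc k) = of_nat (2 * Suc k - 1) * T e n (n - k)"
      using T_step[OF R e, of "n - Suc k"] Suc.prems by (simp add: Suc_diff_Suc)
    also have "\<dots> = of_nat (2 * Suc k - 1) * (fact (2 * k) / (2 ^ k * fact k)) * T e n n"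
      using Suc by simp
    also have "of_nat (2 * Suc k - 1) * (fact (2 * k) / (2 ^ k * fact k)) = (fact (2 * Suc k) / (2 ^ Suc k * fact (Suc k)) :: complex)"
    proof -
      have "(of_nat (Suc k) :: complex) \<noteq> 0" by (simp del: of_nat_Suc)
      then show ?thesis by (simp add: divide_simps del: of_nat_Suc) (simp add: algebra_simps)
    qed
    finally show ?case .
  qed simp
  from this[of n] have "T e n 0 = fact (2 * n) / (2 ^ n * fact n) * T e n n" by simp
  moreover have "T e n 0 = fact (2 * n) * R (map e [0..<2*n])"
  proof -
    have "of_int (sign \<sigma>) * R (map (e \<circ> \<sigma>) [0..<2*n]) = R (map e [0..<2*n])" if \<sigma>: "\<sigma> permutes {0..<2*n}" for \<sigma>
    proof -
      have st: "set (map (e \<circ> \<sigma>) [0..<2*n]) = set (map e [0..<2*n])"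
        by (simp only: set_map image_comp[symmetric] set_upt permutes_image[OF \<sigma>])
      have "(\<Prod>x\<leftarrow>map (e \<circ> \<sigma>) [0..<2*n]. sn x) = (\<Prod>x\<leftarrow>map e [0..<2*n]. sn x)"
        by (rule prod_list_permute[OF \<sigma>])
      moreover have "of_int (sign \<sigma>) * of_int (sign \<sigma>) = (1 :: complex)"
        by (simp add: sign_def)
      ultimately show ?thesis
        unfolding R_def W_def st lsgn_permute[OF \<sigma>] by (simp add: sum_distrib_left mult_ac) (simp add: sign_def)
    qed
    then show ?thesis by (simp add: T_def card_permutations)
  qed
  moreover have "T e n n = (2 ^ n * fact n) * (R [] * pfaffian n (\<lambda>j k. M (e j) (e k)))"
    by (simp add: T_def pfaffian_def sum_distrib_right[symmetric])
  ultimately show ?thesis by simp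
qed

end

section \<open>Path decompositions\<close>

text \<open>Pair the two largest elements and recurse. No element lies strictly between these two,
  and both lie on the same side of every other pair.\<close>

lemma exists_noncrossing_matching:
  fixes \<kappa> :: "'a \<Rightarrow> real"
  assumes "finite A" "inj_on \<kappa> A" "even (card A)"
  shows "\<exists>p. (\<forall>a\<in>A. p a \<in> A \<and> p a \<noteq> a \<and> p (p a) = a) \<and>
    (\<forall>a\<in>A. \<forall>b\<in>A. b \<noteq> a \<longrightarrow> b \<noteq> p a \<longrightarrow>
      (min (\<kappa> a) (\<kappa> (p a)) < \<kappa> b \<and> \<kappa> b < max (\<kappa> a) (\<kappa> (p a)) \<longleftrightarrow>
       min (\<kappa> a) (\<kappa> (p a)) < \<kappa> (p b) \<and> \<kappa> (p b) < max (\<kappa> a) (\<kappa> (p a))))"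
  using assms
proof (induction "card A" arbitrary: A rule: less_induct)
  case less
  show ?case
  proof (cases "A = {}")
    case False
    have max: "\<exists>m\<in>B. \<forall>b\<in>B. \<kappa> b \<le> \<kappa> m" if "finite B" "B \<noteq> {}" for B
      using Max_in[of "\<kappa> ` B"] Max_ge[of "\<kappa> ` B"] that by (metis (no_types, lifting) finite_imageI image_iff image_is_empty imageI)
    obtain m where m: "m \<in> A" "\<And>a. a \<in> A \<Longrightarrow> \<kappa> a \<le> \<kappa> m" using max[of A] False less.prems by blast
    have "A \<noteq> {m}" using less.prems by auto
    then have "A - {m} \<noteq> {}" using m by auto
    then obtain m' where m': "m' \<in> A - {m}" "\<And>a. a \<in> A - {m} \<Longrightarrow> \<kappa> a \<le> \<kappa> m'"
      using max[of "A - {m}"] less.prems by blast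
    let ?A = "A - {m, m'}"
    have c: "card A = card ?A + 2"
    proof -
      have "card {m, m'} = 2" using m' by auto
      moreover have "card {m, m'} \<le> card A" using less.prems m m' by (intro card_mono) auto
      moreover have "card ?A = card A - card {m, m'}" using m m' by (intro card_Diff_subset) auto
      ultimately show ?thesis by simp
    qed
    have "inj_on \<kappa> ?A" using less.prems(2) by (rule inj_on_subset) auto
    then obtain p where p: "\<And>a. a \<in> ?A \<Longrightarrow> p a \<in> ?A \<and> p a \<noteq> a \<and> p (p a) = a"
      and nc: "\<And>a b. a \<in> ?A \<Longrightarrow> b \<in> ?A \<Longrightarrow> b \<noteq> a \<Longrightarrow> b \<noteq> p a \<Longrightarrow>
      (min (\<kappa> a) (\<kappa> (p a)) < \<kappa> b \<and> \<kappa> b < max (\<kappa> a) (\<kappa> (p a)) \<longleftrightarrow>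
       min (\<kappa> a) (\<kappa> (p a)) < \<kappa> (p b) \<and> \<kappa> (p b) < max (\<kappa> a) (\<kappa> (p a)))"
      using less.hyps[of ?A] less.prems c by auto
    define p' where "p' = p(m := m', m' := m)"
    have pm: "p' m = m'" "p' m' = m" using m' by (auto simp: p'_def)
    have pA: "p' a = p a" if "a \<in> ?A" for a using that by (auto simp: p'_def)
    have ord: "\<kappa> a < \<kappa> m \<and> \<kappa> a < \<kappa> m'" if "a \<in> ?A" for a
    proof -
      have "\<kappa> a \<le> \<kappa> m" "\<kappa> a \<le> \<kappa> m'" using m(2) m'(2) that by auto
      moreover have "\<kappa> a \<noteq> \<kappa> m" "\<kappa> a \<noteq> \<kappa> m'" using less.prems(2) m m' that by (auto dest: inj_onD)
      ultimately show ?thesis by simp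
    qed
    have "p' a \<in> A \<and> p' a \<noteq> a \<and> p' (p' a) = a" if "a \<in> A" for a
    proof (cases "a \<in> ?A")
      case True
      then show ?thesis using p[OF True] pA[OF True] pA[of "p a"] by auto
    next
      case False
      then show ?thesis using that pm m m' by auto
    qed
    moreover have "min (\<kappa> a) (\<kappa> (p' a)) < \<kappa> b \<and> \<kappa> b < max (\<kappa> a) (\<kappa> (p' a)) \<longleftrightarrow>
       min (\<kappa> a) (\<kappa> (p' a)) < \<kappa> (p' b) \<and> \<kappa> (p' b) < max (\<kappa> a) (\<kappa> (p' a))"
      if a: "a \<in> A" and b: "b \<in> A" "b \<noteq> a" "b \<noteq> p' a" for a b
    proof (cases "a \<in> ?A")
      case aA: True
      show ?thesis
      proof (cases "b \<in> ?A")
        case True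
        then show ?thesis using nc[OF aA True] b pA[OF aA] pA[OF True] by simp
      next
        case False
        then have "b = m \<and> p' b = m' \<or> b = m' \<and> p' b = m" using b pm by auto
        then show ?thesis using ord[OF aA] ord[of "p a"] p[OF aA] pA[OF aA] by auto
      qed
    next
      case False
      then have am: "a = m \<and> p' a = m' \<or> a = m' \<and> p' a = m" using a pm by auto
      then have bA: "b \<in> ?A" using b by auto
      show ?thesis using am ord[OF bA] ord[of "p b"] p[OF bA] pA[OF bA] by auto
    qed
    ultimately show ?thesis by blast
  qed simp
qed

lemma exists_pair_enumeration:
  assumes "finite A" "\<And>a. a \<in> A \<Longrightarrow> f a \<in> A \<and> f a \<noteq> a \<and> f (f a) = a"
  shows "\<exists>xs. distinct xs \<and> set xs = A \<and> (\<forall>k. 2 * k + 1 < length xs \<longrightarrow> xs ! (2 * k + 1) = f (xs ! (2 * k)))"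
  using assms
proof (induction "card A" arbitrary: A rule: less_induct)
  case less
  show ?case
  proof (cases "A = {}")
    case False
    then obtain a where a: "a \<in> A" by blast
    let ?B = "A - {a, f a}"
    have fa: "f a \<in> A" "f a \<noteq> a" "f (f a) = a" using less.prems a by auto
    have "\<exists>xs. distinct xs \<and> set xs = ?B \<and> (\<forall>k. 2 * k + 1 < length xs \<longrightarrow> xs ! (2 * k + 1) = f (xs ! (2 * k)))"
    proof (rule less.hyps)
      show "card ?B < card A" using a less.prems by (intro psubset_card_mono) auto
      show "f b \<in> ?B \<and> f b \<noteq> b \<and> f (f b) = b" if "b \<in> ?B" for b
        using less.prems(2)[of b] that fa by auto
    qed (use less.prems in auto)
    then obtain xs where xs: "distinct xs" "set xs = ?B"
      "\<And>k. 2 * k + 1 < length xs \<Longrightarrow> xs ! (2 * k + 1) = f (xs ! (2 * k))" by blast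
    have "(a # f a # xs) ! (2 * k + 1) = f ((a # f a # xs) ! (2 * k))"
      if "2 * k + 1 < length (a # f a # xs)" for k
      using that xs(3)[of "k - 1"] by (cases k) auto
    moreover have "distinct (a # f a # xs)" "set (a # f a # xs) = A" using xs a fa by auto
    ultimately show ?thesis by blast
  qed auto
qed

lemma exists_pairing_permutation:
  fixes n :: nat
  assumes "\<And>a. a < 2 * n \<Longrightarrow> f a < 2 * n \<and> f a \<noteq> a \<and> f (f a) = a"
  shows "\<exists>s. s permutes {0..<2*n} \<and> (\<forall>k<n. s (2 * k + 1) = f (s (2 * k)))"
proof -
  have "\<exists>xs. distinct xs \<and> set xs = {0..<2*n} \<and>
      (\<forall>k. 2 * k + 1 < length xs \<longrightarrow> xs ! (2 * k + 1) = f (xs ! (2 * k)))"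
  proof (rule exists_pair_enumeration)
    fix a assume "a \<in> {0..<2*n}"
    then show "f a \<in> {0..<2*n} \<and> f a \<noteq> a \<and> f (f a) = a" using assms[of a] by simp
  qed simp
  then obtain xs where xs: "distinct xs" "set xs = {0..<2*n}"
    "\<forall>k. 2 * k + 1 < length xs \<longrightarrow> xs ! (2 * k + 1) = f (xs ! (2 * k))" by blast
  have len: "length xs = 2 * n" using distinct_card[OF xs(1)] xs(2) by simp
  define s where "s i = (if i < 2 * n then xs ! i else i)" for i
  have "bij_betw ((!) xs) {0..<2*n} {0..<2*n}"
    by (rule bij_betw_nth[OF xs(1)]) (use len xs(2) in \<open>simp_all only: lessThan_atLeast0\<close>)
  then have "bij_betw s {0..<2*n} {0..<2*n}"
    by (subst bij_betw_cong[of _ _ "(!) xs"]) (auto simp: s_def)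
  then have "s permutes {0..<2*n}" by (intro bij_imp_permutes) (auto simp: s_def)
  then show ?thesis using xs(3) len by (intro exI[of _ s]) (auto simp: s_def)
qed

lemma path_rel_iff:
  "path_rel pos H p es a b w \<longleftrightarrow>
     (es b = orev (es a) \<and> w = 0) \<or>
     (\<exists>hs. hs \<noteq> [] \<and> hd hs = orev (es a) \<and> set hs \<subseteq> H \<and>
        successively (\<lambda>x y. y = orev (p x)) hs \<and> orev (p (last hs)) = es b \<and>
        w = (\<Sum>h\<leftarrow>hs. wang pos (orev h) (p h)))"
proof -
  have "(\<forall>i. Suc i < length hs \<longrightarrow> hs ! Suc i = orev (p (hs ! i)) \<and> orev (p (hs ! i)) \<in> H) \<longleftrightarrow>
     successively (\<lambda>x y. y = orev (p x)) hs" if "set hs \<subseteq> H" for hs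
    using that by (auto simp: successively_conv_nth) (metis nth_mem subsetD)
  moreover have "(\<Sum>i<length hs. wang pos (orev (hs ! i)) (p (hs ! i))) = (\<Sum>h\<leftarrow>hs. wang pos (orev h) (p h))" for hs
    by (simp add: sum_list_sum_nth lessThan_atLeast0)
  ultimately show ?thesis unfolding path_rel_def by (auto cong: conj_cong)
qed

text \<open>The half-edge \<open>h\<close> is a dead end, since its other half is not in
  \<open>H\<close>. In mid-course a path could reach \<open>h\<close> only out of
  \<open>orev h\<close>, and after \<open>p h\<close> it would have to continue into
  \<open>orev h\<close>. So a path that neither starts with \<open>h\<close> nor ends at
  \<open>orev h\<close> uses neither \<open>h\<close> nor \<open>p h\<close>.\<close>

lemma path_avoids:
  assumes p: "\<And>x. x \<in> H \<Longrightarrow> p x \<in> H \<and> p (p x) = x"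
    and hs: "successively (\<lambda>x y. y = orev (p x)) hs" "set hs \<subseteq> H" "hs \<noteq> []"
    and h: "h \<in> H" "orev h \<notin> H" "hd hs \<noteq> h" "orev (p (last hs)) \<noteq> orev h"
  shows "h \<notin> set hs" "p h \<notin> set hs"
proof -
  have succ: "hs ! Suc i = orev (p (hs ! i))" if "Suc i < length hs" for i
    using hs(1) that by (simp add: successively_conv_nth)
  have oo: "orev (orev x) = x" for x :: "'a \<times> 'a" by (simp add: orev_def)
  show "h \<notin> set hs"
  proof
    assume "h \<in> set hs"
    then obtain i where i: "i < length hs" "hs ! i = h" by (auto simp: in_set_conv_nth)
    then have "i \<noteq> 0" using h(3) hs(3) by (metis hd_conv_nth)
    then obtain j where j: "i = Suc j" by (cases i) auto
    then have "orev h = p (hs ! j)" using succ[of j] i oo by metis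
    moreover have "hs ! j \<in> set hs" using i j by simp
    then have "hs ! j \<in> H" using hs(2) by blast
    ultimately show False using p h(2) by metis
  qed
  show "p h \<notin> set hs"
  proof
    assume "p h \<in> set hs"
    then obtain i where i: "i < length hs" "hs ! i = p h" by (auto simp: in_set_conv_nth)
    show False
    proof (cases "Suc i < length hs")
      case True
      then have "hs ! Suc i = orev h" using succ[OF True] i p h(1) by simp
      then show False using True hs(2) h(2) nth_mem by (metis subsetD)
    next
      case False
      then have "last hs = p h" using i hs(3) by (metis Suc_lessI last_conv_nth diff_Suc_1 )
      then show False using h(1,4) p by simp
    qed
  qed
qed

context halfedges
begin

lemma closed_Diff: "closed A \<Longrightarrow> closed (S - A)"
  unfolding closed_def by auto

lemma lsgn_move: "lsgn (u @ x # v) = (-1) ^ length u * lsgn (x # u @ v)"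
proof (induction u)
  case (Cons a u)
  then show ?case by (simp add: sg_swap[of x a] mult_ac)
qed simp

lemma W_move: "W (u @ x # v) H = (-1) ^ length u * W (x # u @ v) H"
proof -
  have s: "set (u @ x # v) = set (x # u @ v)" by auto
  show ?thesis unfolding W_def lsgn_move s by (simp add: mult_ac)
qed

text \<open>
  A path that starts at \<open>e\<close>, passes through \<open>bar e\<close> and leaves the next vertex along \<open>q\<close> becomes
  a path that starts at \<open>q\<close>.
\<close>

lemma shorten:
  assumes d: "distinct (u @ e # v)" "set (u @ e # v) \<subseteq> S" and H: "H \<in> C (set (u @ e # v))"
    and h: "bar e \<in> H" and q: "q \<in> H" "q \<noteq> bar e" "org q = org (bar e)"
    and even: "sgp (bar e) (H - {bar e, q}) * sgp q (H - {bar e, q}) = 1"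
  shows "H - {bar e, q} \<in> C (set (u @ q # v))"
    and "W (u @ e # v) H = sg e (bar e) * sg (bar e) q * W (u @ q # v) (H - {bar e, q})"
proof -
  let ?h = "bar e" and ?es = "u @ v" and ?H = "H - {bar e, q}"
  have HS: "H \<subseteq> S - set (u @ e # v)" "closed (S - set (u @ e # v) - H)" using H by (auto simp: C_def)
  have e: "e \<in> S" "?h \<in> S" "e \<notin> set ?es" "e \<notin> H" "e \<noteq> ?h" using d HS h by auto
  have qS: "q \<in> S" "q \<notin> set ?es" "q \<noteq> e" "q \<noteq> ?h" using q HS by auto
  have hn: "?h \<notin> set ?es" using h HS by auto
  have fin': "finite ?H" "finite H" using HS finite_sub by auto
  have L: "S - set (u @ q # v) - ?H = insert e (insert ?h (S - set (u @ e # v) - H))"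
    using e qS hn q HS h by auto
  have cl: "closed (S - set (u @ q # v) - ?H)"
    unfolding L using HS(2) e by (auto simp: closed_def)
  have dg: "deg H w = deg ?H w + (if org q = w then 2 else 0)" for w
  proof -
    have "H = insert ?h (insert q ?H)" using h q by auto
    then have "deg H w = deg (insert ?h (insert q ?H)) w" by simp
    also have "\<dots> = deg ?H w + (if org q = w then 2 else 0)"
      using fin' q by (simp add: deg_insert)
    finally show ?thesis .
  qed
  have "even (deg ?H w)" for w
  proof -
    have "even (deg H w)" using H by (simp add: C_def)
    then show ?thesis using dg[of w] by (auto split: if_splits)
  qed
  then show C': "?H \<in> C (set (u @ q # v))"
    using cl HS qS by (auto simp: C_def)
  have dd: "distinct (e # ?es)" "set (e # ?es) \<subseteq> S" using d by auto
  have s1: "set (u @ e # v) = set (e # ?es)" "set (u @ q # v) = set (q # ?es)" by auto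
  \<comment> \<open>The word sign of \<open>q\<close>, \<open>bar e\<close>, \<open>e\<close>,
    \<open>u\<close>, \<open>v\<close> with the smaller set is computed twice: by taking
    \<open>bar e\<close> and then \<open>q\<close> out of \<open>H\<close>, where the assumption
    \<open>even\<close> cancels the cost of passing the rest of \<open>H\<close>, and by deleting
    the adjacent pair \<open>bar e\<close>, \<open>e\<close>.\<close>
  have W1: "W (?h # e # ?es) (H - {?h}) = (-1) ^ length (e # ?es) * W (e # ?es) H * sgp ?h (H - {?h})"
    by (rule W_Cons) (use dd HS h in auto)
  have W2: "W (q # ?h # e # ?es) (H - {?h} - {q}) =
      (-1) ^ length (?h # e # ?es) * W (?h # e # ?es) (H - {?h}) * sgp q (H - {?h} - {q})"
    by (rule W_Cons) (use dd HS h q e hn in auto)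
  have sp: "sgp ?h (H - {?h}) = sg ?h q * sgp ?h ?H"
  proof -
    have "H - {?h} = insert q ?H" using q by auto
    then show ?thesis using fin' by (simp add: sgp_insert)
  qed
  have HH: "H - {?h} - {q} = ?H" by auto
  have "W (q # ?h # e # ?es) ?H = - (((-1) ^ length ?es * (-1) ^ length ?es) * sg ?h q * W (e # ?es) H * (sgp ?h ?H * sgp q ?H))"
    using W2 unfolding W1 HH sp by (simp add: mult_ac)
  moreover have sq: "(-1) ^ length ?es * (-1 :: complex) ^ length ?es = 1"
    by (simp add: power_mult_distrib[symmetric])
  ultimately have A: "W (q # ?h # e # ?es) ?H = - (sg ?h q * W (e # ?es) H)"
    unfolding even by simp
  have "W (?h # e # q # ?es) ?H = sg ?h e * W (q # ?es) ?H"
    by (rule W_pair) (use dd qS cl[unfolded s1] e hn HS in auto)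
  moreover have "W (?h # e # q # ?es) ?H = W (q # ?h # e # ?es) ?H"
    using W_move[of "[?h, e]" q ?es ?H] by simp
  ultimately have "sg ?h q * W (e # ?es) H = sg e ?h * W (q # ?es) ?H"
    using A sg_swap[of ?h e] by simp
  then have "(sg ?h q * sg ?h q) * W (e # ?es) H = sg e ?h * sg ?h q * W (q # ?es) ?H"
    by (simp add: mult_ac)
  then have "W (e # ?es) H = sg e ?h * sg ?h q * W (q # ?es) ?H"
    using sg_square[of ?h q] e qS by simp
  then show "W (u @ e # v) H = sg e ?h * sg ?h q * W (u @ q # v) ?H"
    unfolding W_move[of u] by (simp add: mult_ac)
qed

end

text \<open>The geometric input of the comparison with \<open>\<tau>\<close>: \<open>turn\<close> is
  the phase picked up at one vertex of a path, \<open>reverse\<close> is the whole factor of an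
  empty path, and \<open>planar\<close> fixes the sign of even subgraphs.\<close>

locale kac_ward = halfedges S orev fst rk sn rho
  for S :: "('v \<times> 'v) set" and rk :: "'v \<times> 'v \<Rightarrow> nat" and sn rho :: "'v \<times> 'v \<Rightarrow> complex" +
  fixes pos :: "'v \<Rightarrow> complex" and eta :: "'v \<times> 'v \<Rightarrow> complex"
  assumes eta_unit: "h \<in> S \<Longrightarrow> eta h * cnj (eta h) = 1"
    and turn: "\<lbrakk>e \<in> S; q \<in> S; fst q = snd e; q \<noteq> orev e\<rbrakk> \<Longrightarrow>
      cnj (eta e) * eta q * exp (- \<i> / 2 * complex_of_real (wang pos e q)) =
      sn e * sn q * (sg e (orev e) * sg (orev e) q)"
    and reverse: "e \<in> S \<Longrightarrow> \<i> * cnj (eta e) * eta (orev e) = sn e * sn (orev e) * sg e (orev e)"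
    and hang_rk: "\<lbrakk>a \<in> S; b \<in> S; fst a = fst b\<rbrakk> \<Longrightarrow> hang pos a < hang pos b \<longleftrightarrow> rk a < rk b"
    and planar: "\<lbrakk>closed H; \<And>v. even (deg H v)\<rbrakk> \<Longrightarrow> Lam H = 1"
begin

lemma inj_on_hang: "inj_on (hang pos) {h \<in> S. fst h = v}"
proof (rule inj_onI, rule ccontr)
  fix a b assume a: "a \<in> {h \<in> S. fst h = v}" "b \<in> {h \<in> S. fst h = v}" "hang pos a = hang pos b" "a \<noteq> b"
  then have "\<not> rk a < rk b" "\<not> rk b < rk a" using hang_rk[of a b] hang_rk[of b a] by auto
  then show False using a rk_neq[of a b] by auto
qed

lemma exists_noncrossing_pairing:
  assumes "H \<subseteq> S" "\<And>v. even (deg H v)"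
  shows "\<exists>p. noncrossing_pairing pos H p"
proof -
  define Q where "Q v p \<longleftrightarrow> (\<forall>a\<in>{h \<in> H. fst h = v}. p a \<in> {h \<in> H. fst h = v} \<and> p a \<noteq> a \<and> p (p a) = a) \<and>
    (\<forall>a\<in>{h \<in> H. fst h = v}. \<forall>b\<in>{h \<in> H. fst h = v}. b \<noteq> a \<longrightarrow> b \<noteq> p a \<longrightarrow>
      (btw pos a (p a) b \<longleftrightarrow> btw pos a (p a) (p b)))" for v p
  have "\<exists>p. Q v p" for v
    unfolding Q_def btw_def
  proof (rule exists_noncrossing_matching)
    show "finite {h \<in> H. fst h = v}" using assms finite_sub by auto
    show "inj_on (hang pos) {h \<in> H. fst h = v}"
      using inj_on_hang[of v] by (rule inj_on_subset) (use assms in auto)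
    show "even (card {h \<in> H. fst h = v})" using assms(2)[of v] by (simp add: deg_def)
  qed
  then obtain P where P: "\<And>v. Q v (P v)" by metis
  have "noncrossing_pairing pos H (\<lambda>h. P (fst h) h)"
    unfolding noncrossing_pairing_def
  proof (intro conjI ballI impI)
    fix h assume h: "h \<in> H"
    then have *: "P (fst h) h \<in> H \<and> fst (P (fst h) h) = fst h \<and> P (fst h) h \<noteq> h \<and> P (fst h) (P (fst h) h) = h"
      using P[of "fst h"] unfolding Q_def by blast
    then show "P (fst h) h \<in> H" "fst (P (fst h) h) = fst h" "P (fst h) h \<noteq> h" by auto
    show "P (fst (P (fst h) h)) (P (fst h) h) = h" using * by auto
  next
    fix a b assume ab: "a \<in> H" "b \<in> H" "fst b = fst a" "b \<noteq> a" "b \<noteq> P (fst a) a"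
    then have *: "a \<in> {h \<in> H. fst h = fst a}" "b \<in> {h \<in> H. fst h = fst a}" by auto
    have "\<forall>c\<in>{h \<in> H. fst h = fst a}. \<forall>b\<in>{h \<in> H. fst h = fst a}. b \<noteq> c \<longrightarrow> b \<noteq> P (fst a) c \<longrightarrow>
        btw pos c (P (fst a) c) b = btw pos c (P (fst a) c) (P (fst a) b)"
      using P[of "fst a"] unfolding Q_def by (rule conjunct2)
    from this[rule_format, OF * ab(4,5)]
    show "btw pos a (P (fst a) a) b = btw pos a (P (fst a) a) (P (fst b) b)"
      unfolding ab(3) .
  qed
  then show ?thesis by blast
qed

text \<open>Half-edges at other vertices lie on the same side of \<open>h\<close> and
  \<open>p h\<close>. Those at the same vertex that lie between the two are paired among themselves,
  so their number is even.\<close>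

lemma noncrossing_sgp:
  assumes p: "noncrossing_pairing pos H p" and H: "H \<subseteq> S" and h: "h \<in> H"
  shows "sgp h (H - {h, p h}) * sgp (p h) (H - {h, p h}) = 1"
proof -
  let ?H = "H - {h, p h}" and ?q = "p h"
  have pp: "p x \<in> H" "fst (p x) = fst x" "p x \<noteq> x" "p (p x) = x" if "x \<in> H" for x
    using p that unfolding noncrossing_pairing_def by auto
  define A where "A = {x \<in> ?H. fst x = fst h \<and> btw pos h ?q x}"
  have finA: "finite ?H" "finite A" using finite_sub H by (auto simp: A_def)
  have "even (card A)"
  proof (rule even_card_involution)
    fix x assume x: "x \<in> A"
    then have x': "x \<in> H" "x \<noteq> h" "x \<noteq> ?q" "fst x = fst h" "btw pos h ?q x" by (auto simp: A_def)
    then have "btw pos h ?q (p x)" using p h unfolding noncrossing_pairing_def by blast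
    moreover have "p x \<noteq> h" "p x \<noteq> ?q" using pp x' h by metis+
    ultimately show "p x \<in> A \<and> p x \<noteq> x \<and> p (p x) = x" using pp[OF x'(1)] x' by (auto simp: A_def)
  qed (rule finA)
  have "sg h x * sg ?q x = (if x \<in> A then -1 else 1)" if x: "x \<in> ?H" for x
  proof -
    have S: "x \<in> S" "h \<in> S" "?q \<in> S" using x h pp(1)[OF h] H by blast+
    have ne: "rk x \<noteq> rk h" "rk x \<noteq> rk ?q" using x S rk_neq by blast+
    show ?thesis
    proof (cases "fst x = fst h")
      case True
      have "x \<in> A \<longleftrightarrow> (rk h < rk x \<and> rk x < rk ?q \<or> rk ?q < rk x \<and> rk x < rk h)"
        using x True hang_rk[of h x] hang_rk[of x h] hang_rk[of ?q x] hang_rk[of x ?q] hang_rk[of h ?q] S pp(2)[OF h]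
        unfolding A_def btw_def min_def max_def by auto
      then show ?thesis using ne by (auto simp: sg_def)
    next
      case False
      then have "x \<notin> A" by (simp add: A_def)
      moreover have "rk h < rk x \<longleftrightarrow> rk ?q < rk x" using contiguous[of h ?q x] S pp(2)[OF h] False by auto
      ultimately show ?thesis using ne by (auto simp: sg_def)
    qed
  qed
  then have "sgp h ?H * sgp ?q ?H = (\<Prod>x\<in>?H. if x \<in> A then -1 else 1)"
    unfolding sgp_def prod.distrib[symmetric] by (rule prod.cong[OF refl])
  also have "\<dots> = (\<Prod>x\<in>A. -1)"
  proof -
    have "?H \<inter> {x. x \<in> A} = A" unfolding A_def by blast
    then show ?thesis using finA(1) by (simp add: prod.If_cases)
  qed
  also have "\<dots> = 1" using \<open>even (card A)\<close> by simp
  finally show ?thesis .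
qed

lemma noncrossing_remove:
  assumes p: "noncrossing_pairing pos H p" and h: "h \<in> H"
  shows "noncrossing_pairing pos (H - {h, p h}) p"
proof -
  have "p x \<in> H - {h, p h}" if "x \<in> H - {h, p h}" for x
    using p that h unfolding noncrossing_pairing_def by (metis Diff_iff insert_iff singletonD)
  then show ?thesis using p unfolding noncrossing_pairing_def by auto
qed

text \<open>By \<open>Lam_Un\<close> this word sign differs from \<open>Lam S\<close> by the factor
  \<open>Lam H\<close>, and \<open>planar\<close> makes that factor 1.\<close>

lemma W_Nil: "H \<subseteq> S \<Longrightarrow> closed H \<Longrightarrow> (\<And>v. even (deg H v)) \<Longrightarrow> W [] H = Lam S"
proof -
  assume H: "H \<subseteq> S" "closed H" "\<And>v. even (deg H v)"
  have "Lam (H \<union> (S - H)) = Lam H * Lam (S - H) * cr H (S - H)"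
    by (rule Lam_Un) (use H closed_Diff in auto)
  moreover have "H \<union> (S - H) = S" using H by auto
  ultimately show ?thesis using planar[OF H(2,3)] by (simp add: W_def)
qed

lemma upt_split: "i < m \<Longrightarrow> [0..<m] = [0..<i] @ i # [Suc i..<m]"
  using upt_add_eq_append[of 0 i "m - i"] by (simp add: upt_conv_Cons)

lemma map_upd_upt: "i < m \<Longrightarrow> map (f(i := y)) [0..<m] = map f [0..<i] @ y # map f [Suc i..<m]"
  by (simp add: upt_split)

text \<open>The base case of the shortening: all paths are empty. The entries form adjacent pairs of
  opposite half-edges, each of which leaves the sign of its internal order, and \<open>H\<close>
  consists of whole edges, so \<open>W_Nil\<close> handles the rest.\<close>

lemma closed_paths_sign:
  assumes e: "inj_on es {0..<2*n}" "es ` {0..<2*n} \<subseteq> S" and H: "H \<in> C (es ` {0..<2*n})"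
    and opp: "\<And>k. k < n \<Longrightarrow> es (2*k+1) = orev (es (2*k))"
  shows "W (map es [0..<2*n]) H = (\<Prod>k<n. sg (es (2*k)) (orev (es (2*k)))) * Lam S"
proof -
  let ?A = "\<lambda>j. es ` {2*j..<2*n}"
  have clA: "closed (?A j)" for j
    unfolding closed_def
  proof (intro conjI ballI)
    show "?A j \<subseteq> S" using e by auto
    fix h assume "h \<in> ?A j"
    then obtain i where i: "2*j \<le> i" "i < 2*n" "h = es i" by auto
    show "orev h \<in> ?A j"
    proof (cases "even i")
      case True
      then obtain k where "i = 2 * k" by blast
      then have "orev h = es (2*k+1)" "2*k+1 \<in> {2*j..<2*n}" using i opp[of k] by auto
      then show ?thesis by blast
    next
      case False
      then obtain k where "i = 2 * k + 1" using oddE by blast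
      then have "orev h = es (2*k)" "2*k \<in> {2*j..<2*n}" using i opp[of k] by auto
      then show ?thesis by blast
    qed
  qed
  have HS: "H \<subseteq> S - ?A 0" "closed (S - ?A 0 - H)" "\<And>v. even (deg H v)" using H by (auto simp: C_def)
  have "closed (S - (S - ?A 0 - H))" by (rule closed_Diff[OF HS(2)])
  moreover have "S - (S - ?A 0 - H) = ?A 0 \<union> H" using HS e by auto
  ultimately have clAH: "closed (?A 0 \<union> H)" by simp
  have clH: "closed H"
    unfolding closed_def
  proof (intro conjI ballI)
    show "H \<subseteq> S" using HS by auto
    fix h assume h: "h \<in> H"
    then have "orev h \<in> ?A 0 \<union> H" using clAH by (auto simp: closed_def)
    moreover have "orev h \<notin> ?A 0"
    proof
      assume "orev h \<in> ?A 0"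
      then have "h \<in> ?A 0" using clA[of 0] unfolding closed_def by (metis bar_bar)
      then show False using h HS(1) by blast
    qed
    ultimately show "orev h \<in> H" by blast
  qed
  have "W (map es [2*(n-m)..<2*n]) H = (\<Prod>k\<in>{n-m..<n}. sg (es (2*k)) (orev (es (2*k)))) * Lam S" if "m \<le> n" for m
    using that
  proof (induction m)
    case 0
    show ?case using W_Nil[OF _ clH HS(3)] HS by auto
  next
    case (Suc m)
    define j where "j = n - Suc m"
    have j: "j < n" "n - m = Suc j" using Suc.prems by (auto simp: j_def)
    have l: "map es [2*j..<2*n] = es (2*j) # es (2*j+1) # map es [2*Suc j..<2*n]"
      using j by (simp add: upt_conv_Cons)
    have m1: "2*j+1 \<in> {0..<2*n}" "2*j \<in> {0..<2*n}" using j by auto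
    have g: "es (2*j+1) \<in> S" using e m1 by blast
    have ng: "es (2*j+1) \<notin> ?A (Suc j)"
    proof
      assume "es (2*j+1) \<in> ?A (Suc j)"
      then obtain i where i: "i \<in> {2*Suc j..<2*n}" "es (2*j+1) = es i" by auto
      then have "2*j+1 = i" using e(1) m1 by (auto dest!: inj_onD)
      then show False using i by auto
    qed
    have "W (orev (es (2*j+1)) # es (2*j+1) # map es [2*Suc j..<2*n]) H =
        sg (orev (es (2*j+1))) (es (2*j+1)) * W (map es [2*Suc j..<2*n]) H"
    proof (rule W_pair)
      have "inj_on es {2*Suc j..<2*n}" using e(1) by (rule inj_on_subset) auto
      then show "distinct (map es [2*Suc j..<2*n])" by (simp add: distinct_map)
      show "set (map es [2*Suc j..<2*n]) \<subseteq> S" using e by auto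
      show "H \<subseteq> S - set (map es [2*Suc j..<2*n])" using HS by auto
      have "closed (?A (Suc j) \<union> H)" using clA[of "Suc j"] clH by (auto simp: closed_def)
      moreover have "S - set (map es [2*Suc j..<2*n]) - H = S - (?A (Suc j) \<union> H)" by auto
      ultimately show "closed (S - set (map es [2*Suc j..<2*n]) - H)" using closed_Diff by metis
      have "es (2*j+1) \<notin> H" using HS m1 by auto
      then show "es (2*j+1) \<in> S - set (map es [2*Suc j..<2*n]) - H" using g ng by auto
    qed
    moreover have o: "es (2*j+1) = orev (es (2*j))" "orev (es (2*j+1)) = es (2*j)"
      using opp[OF j(1)] by (auto simp: orev_def)
    ultimately have "W (map es [2*j..<2*n]) H = sg (es (2*j)) (orev (es (2*j))) * W (map es [2*Suc j..<2*n]) H"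
      unfolding l by simp
    also have "\<dots> = sg (es (2*j)) (orev (es (2*j))) * ((\<Prod>k\<in>{Suc j..<n}. sg (es (2*k)) (orev (es (2*k)))) * Lam S)"
      using Suc j by simp
    also have "\<dots> = (\<Prod>k\<in>{j..<n}. sg (es (2*k)) (orev (es (2*k)))) * Lam S"
      using j by (subst (2) prod.atLeast_Suc_lessThan) auto
    finally show ?case by (simp add: j_def)
  qed
  from this[of n] show ?thesis by (simp add: lessThan_atLeast0)
qed

lemma Lam_S_square: "Lam S * Lam S = 1"
  by (rule Lam_square) (simp add: closed_def)

definition path_factor :: "(nat \<Rightarrow> 'v \<times> 'v) \<Rightarrow> real \<Rightarrow> nat \<Rightarrow> complex" where
  "path_factor es w k = \<i> * cnj (eta (es (2*k))) * eta (es (2*k+1)) * exp (- \<i> / 2 * complex_of_real w)"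

text \<open>Induction on the size of \<open>H\<close>. A nonempty path loses its first vertex;
  \<open>turn\<close> gives the change of its phase and \<open>shorten\<close> that of the word
  sign. The other paths survive, as they avoid the two removed half-edges by
  \<open>path_avoids\<close>.\<close>

lemma tau_value_id:
  assumes e: "inj_on es {0..<2*n}" "es ` {0..<2*n} \<subseteq> S" and H: "H \<in> C (es ` {0..<2*n})"
    and p: "noncrossing_pairing pos H p"
    and path: "\<And>k. k < n \<Longrightarrow> path_rel pos H p es (2*k) (2*k+1) (w k)"
  shows "(\<Prod>k<n. path_factor es (w k) k) = Lam S * (\<Prod>e\<leftarrow>map es [0..<2*n]. sn e) * W (map es [0..<2*n]) H"
  using e H p path
proof (induction "card H" arbitrary: H es w rule: less_induct)
  case less
  note e = less.prems(1,2) and H = less.prems(3) and p = less.prems(4) and path = less.prems(5)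
  have pp: "p x \<in> H" "fst (p x) = fst x" "p x \<noteq> x" "p (p x) = x" if "x \<in> H" for x
    using p that unfolding noncrossing_pairing_def by auto
  have HS: "H \<subseteq> S - es ` {0..<2*n}" using H by (simp add: C_def)
  show ?case
  proof (cases "\<forall>k<n. es (2*k+1) = orev (es (2*k)) \<and> w k = 0")
    case True
    have "(\<Prod>k<n. path_factor es (w k) k) = (\<Prod>k<n. sn (es (2*k)) * sn (es (2*k+1)) * sg (es (2*k)) (orev (es (2*k))))"
    proof (rule prod.cong)
      fix k assume k: "k \<in> {..<n}"
      then have "es (2*k) \<in> S" using e by auto
      then show "path_factor es (w k) k = sn (es (2*k)) * sn (es (2*k+1)) * sg (es (2*k)) (orev (es (2*k)))"
        using True k reverse by (simp add: path_factor_def)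
    qed simp
    also have "\<dots> = (\<Prod>k<n. sn (es (2*k)) * sn (es (2*k+1))) * (\<Prod>k<n. sg (es (2*k)) (orev (es (2*k))))"
      by (simp add: prod.distrib)
    also have "(\<Prod>k<n. sn (es (2*k)) * sn (es (2*k+1))) = (\<Prod>e\<leftarrow>map es [0..<2*n]. sn e)"
      by (induction n) (auto simp: mult_ac)
    also have "(\<Prod>k<n. sg (es (2*k)) (orev (es (2*k)))) = Lam S * W (map es [0..<2*n]) H"
      using closed_paths_sign[OF e H] True Lam_S_square by simp
    finally show ?thesis by (simp add: mult_ac)
  next
    case False
    then obtain k where k: "k < n" "\<not> (es (2*k+1) = orev (es (2*k)) \<and> w k = 0)" by blast
    then obtain hs where hs: "hs \<noteq> []" "hd hs = orev (es (2*k))" "set hs \<subseteq> H"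
      "successively (\<lambda>x y. y = orev (p x)) hs" "orev (p (last hs)) = es (2*k+1)"
      "w k = (\<Sum>h\<leftarrow>hs. wang pos (orev h) (p h))"
      using path[OF k(1)] unfolding path_rel_iff by blast
    define a where "a = es (2*k)"
    define h where "h = orev a"
    define q where "q = p h"
    define H' where "H' = H - {h, q}"
    define es' where "es' = es(2*k := q)"
    define w' where "w' = w(k := w k - wang pos a q)"
    have ah: "a = orev h" by (simp add: h_def)
    have "hd hs \<in> set hs" using hs(1) by simp
    then have hH: "h \<in> H" using hs(2,3) by (auto simp: h_def a_def)
    have i2k: "2*k \<in> {0..<2*n}" "2*k+1 \<in> {0..<2*n}" using k by auto
    have aS: "a \<in> S" using e i2k by (auto simp: a_def)
    have "a \<in> es ` {0..<2*n}" unfolding a_def using i2k(1) by (rule imageI)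
    then have aH: "a \<notin> H" "orev h \<notin> H" using HS unfolding ah[symmetric] by blast+
    have q: "q \<in> H" "q \<noteq> h" "fst q = fst h" "p q = h" using pp[OF hH] by (auto simp: q_def)
    have qS: "q \<in> S" "q \<notin> es ` {0..<2*n}" using q HS by auto
    have es'_other: "es' i = es i" if "i \<noteq> 2*k" for i using that by (simp add: es'_def)
    have es'_k: "es' (2*k) = q" by (simp add: es'_def)
    have l: "map es [0..<2*n] = map es [0..<2*k] @ a # map es [Suc (2*k)..<2*n]"
      using upt_split[of "2*k" "2*n"] k by (simp add: a_def)
    have l': "map es' [0..<2*n] = map es [0..<2*k] @ q # map es [Suc (2*k)..<2*n]"
      unfolding es'_def by (rule map_upd_upt) (use k in simp)
    have st: "set (map es [0..<2*n]) = es ` {0..<2*n}" "set (map es' [0..<2*n]) = es' ` {0..<2*n}" by auto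
    have dl: "distinct (map es [0..<2*n])" using e by (simp add: distinct_map)
    have sgp1: "sgp (orev a) (H - {orev a, q}) * sgp q (H - {orev a, q}) = 1"
      using noncrossing_sgp[OF p _ hH] HS unfolding h_def q_def by blast
    have pre: "set (map es [0..<2*n]) \<subseteq> S" "H \<in> C (set (map es [0..<2*n]))" using e H by (auto simp: st)
    note sh = shorten[OF dl[unfolded l] pre[unfolded l] hH[unfolded h_def] q(1) q(2,3)[unfolded h_def] sgp1, folded l l']
    have inj': "inj_on es' {0..<2*n}"
      unfolding es'_def by (rule inj_on_fun_updI[OF e(1) qS(2)])
    have sub': "es' ` {0..<2*n} \<subseteq> S" using e qS by (auto simp: es'_def)
    have card: "card H' < card H" using hH HS finite_sub[of H] by (intro psubset_card_mono) (auto simp: H'_def)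
    have p': "noncrossing_pairing pos H' p" unfolding H'_def q_def by (rule noncrossing_remove[OF p hH])
    have pq: "p x \<in> H \<and> p (p x) = x" if "x \<in> H" for x using pp[OF that] by blast
    have path': "path_rel pos H' p es' (2*j) (2*j+1) (w' j)" if j: "j < n" for j
    proof (cases "j = k")
      case True
      show ?thesis
      \<comment> \<open>A path through a single vertex becomes empty: its end is then the reverse of
        its new start \<open>q\<close>.\<close>
      proof (cases "tl hs = []")
        case True
        then have hs1: "hs = [h]" using hs(1,2) by (cases hs) (auto simp: h_def a_def)
        have "es (2*k+1) = orev q" "w k = wang pos a q" using hs(5,6) by (auto simp: hs1 q_def ah)
        then show ?thesis using \<open>j = k\<close> es'_k es'_other[of "2*k+1"] by (simp add: path_rel_iff w'_def)
      next
        case False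
        then obtain x t where t: "hs = h # x # t" using hs(1,2) by (cases hs; cases "tl hs") (auto simp: h_def a_def)
        have x: "x = orev q" using hs(4) by (simp add: t q_def)
        have s: "successively (\<lambda>x y. y = orev (p x)) (x # t)" "set (x # t) \<subseteq> H" using hs t by auto
        have "hd (x # t) \<noteq> h" using x q(1) aH(1) ah by auto
        moreover have "orev (p (last (x # t))) \<noteq> orev h"
          using hs(5) e(1) i2k unfolding t ah[symmetric] a_def by (auto dest: inj_onD)
        ultimately have "h \<notin> set (x # t)" "p h \<notin> set (x # t)"
          using path_avoids[OF pq s _ hH aH(2)] by blast+
        then have "set (x # t) \<subseteq> H'" using s by (auto simp: H'_def q_def)
        moreover have "w' k = (\<Sum>h\<leftarrow>x # t. wang pos (orev h) (p h))"
          using hs(6) by (simp add: w'_def t ah q_def)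
        moreover have "orev (p (last (x # t))) = es' (2*k+1)" using hs(5) t es'_other by simp
        ultimately show ?thesis using s(1) x es'_k \<open>j = k\<close> unfolding path_rel_iff by force
      qed
    next
      case False
      have ij: "2*j \<in> {0..<2*n}" "2*j+1 \<in> {0..<2*n}" using j by auto
      have n1: "2*j \<noteq> 2*k" "2*j+1 \<noteq> 2*k" using False by presburger+
      have ej: "es' (2*j) = es (2*j)" "es' (2*j+1) = es (2*j+1)" "w' j = w j"
        using n1 False es'_other by (auto simp: w'_def)
      have ne: "es (2*j) \<noteq> a" "es (2*j+1) \<noteq> a"
        using e(1) ij i2k n1 unfolding a_def by (auto dest: inj_onD)
      from path[OF j] show ?thesis
        unfolding path_rel_iff ej
      proof (elim disjE exE conjE, goal_cases)
        case (2 gs)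
        have "hd gs \<noteq> h" using 2 ne(1) ah by (metis bar_bar)
        moreover have "orev (p (last gs)) \<noteq> orev h" using 2 ne(2) ah by simp
        ultimately have "h \<notin> set gs" "p h \<notin> set gs"
          using path_avoids[OF pq _ _ _ hH aH(2)] 2 by blast+
        then have "set gs \<subseteq> H'" using 2 by (auto simp: H'_def q_def)
        then show ?case using 2 by blast
      qed simp
    qed
    have IH: "(\<Prod>j<n. path_factor es' (w' j) j) = Lam S * (\<Prod>e\<leftarrow>map es' [0..<2*n]. sn e) * W (map es' [0..<2*n]) H'"
      using less.hyps[OF card inj' sub' _ p' path'] sh(1) by (simp add: H'_def h_def st)
    have f: "path_factor es (w k) k = (sn a * sn q * (sg a h * sg h q)) * path_factor es' (w' k) k"
    proof -
      have "exp (- \<i> / 2 * complex_of_real (w k)) = exp (- \<i> / 2 * complex_of_real (wang pos a q)) * exp (- \<i> / 2 * complex_of_real (w' k))"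
        by (simp add: w'_def exp_add[symmetric] algebra_simps)
      moreover have "path_factor es' (w' k) k = \<i> * cnj (eta q) * eta (es (2*k+1)) * exp (- \<i> / 2 * complex_of_real (w' k))"
        using es'_k es'_other[of "2*k+1"] unfolding path_factor_def by simp
      \<comment> \<open>The unit factor splits the phase at \<open>q\<close>: \<open>eta q\<close>
        completes the turn out of \<open>a\<close>, and \<open>cnj (eta q)\<close> starts the
        shorter path.\<close>
      moreover have "path_factor es (w k) k = (eta q * cnj (eta q)) * (\<i> * cnj (eta a) * eta (es (2*k+1)) * exp (- \<i> / 2 * complex_of_real (w k)))"
        unfolding path_factor_def a_def[symmetric] eta_unit[OF qS(1)] by simp
      ultimately have "path_factor es (w k) k = (cnj (eta a) * eta q * exp (- \<i> / 2 * complex_of_real (wang pos a q))) * path_factor es' (w' k) k"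
        by (simp only: mult_ac)
      also have "cnj (eta a) * eta q * exp (- \<i> / 2 * complex_of_real (wang pos a q)) = sn a * sn q * (sg a h * sg h q)"
        unfolding h_def by (rule turn) (use aS qS q in \<open>auto simp: h_def orev_def\<close>)
      finally show ?thesis by simp
    qed
    have fo: "path_factor es (w j) j = path_factor es' (w' j) j" if "j \<noteq> k" for j
    proof -
      have "2*j \<noteq> 2*k" "2*j+1 \<noteq> 2*k" using that by presburger+
      then show ?thesis using that by (simp add: path_factor_def es'_other w'_def)
    qed
    have "(\<Prod>j<n. path_factor es (w j) j) = path_factor es (w k) k * (\<Prod>j\<in>{..<n} - {k}. path_factor es (w j) j)"
      using k by (subst prod.remove[of _ k]) auto
    also have "\<dots> = (sn a * sn q * (sg a h * sg h q)) * (path_factor es' (w' k) k * (\<Prod>j\<in>{..<n} - {k}. path_factor es' (w' j) j))"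
      using f fo by simp
    also have "path_factor es' (w' k) k * (\<Prod>j\<in>{..<n} - {k}. path_factor es' (w' j) j) = (\<Prod>j<n. path_factor es' (w' j) j)"
      using k by (subst (2) prod.remove[of _ k]) auto
    also have "(sn a * sn q * (sg a h * sg h q)) * \<dots> =
       Lam S * (sn a * (sn q * (\<Prod>e\<leftarrow>map es' [0..<2*n]. sn e))) * (sg a h * sg h q * W (map es' [0..<2*n]) H')"
      unfolding IH by (simp only: mult_ac)
    also have "sn a * (sn q * (\<Prod>e\<leftarrow>map es' [0..<2*n]. sn e)) = (\<Prod>e\<leftarrow>map es [0..<2*n]. sn e)"
      unfolding l l' using sn_square[OF qS(1)] by simp
    also have "sg a h * sg h q * W (map es' [0..<2*n]) H' = W (map es [0..<2*n]) H"
      using sh(2) by (simp add: H'_def h_def)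
    finally show ?thesis .
  qed
qed

text \<open>Renaming the edges by \<open>s\<close> reduces to paths numbered in order, and the word
  sign then acquires the sign of \<open>s\<close>, which cancels the one in \<open>\<tau>\<close>.
  The right-hand side contains no trace of the pairing, the numbering or the orientations.\<close>

lemma tau_value:
  assumes e: "inj_on es {0..<2*n}" "es ` {0..<2*n} \<subseteq> S" and H: "H \<in> C (es ` {0..<2*n})"
    and t: "tau_rel pos eta es n H t"
  shows "t = Lam S * (\<Prod>e\<leftarrow>map es [0..<2*n]. sn e) * W (map es [0..<2*n]) H"
proof -
  obtain p s w where p: "noncrossing_pairing pos H p" and s: "s permutes {0..<2*n}"
    and path: "\<And>k. k < n \<Longrightarrow> path_rel pos H p es (s (2*k)) (s (2*k+1)) (w k)"
    and t: "t = of_int (sign s) * (\<Prod>k<n. \<i> * cnj (eta (es (s (2*k)))) * eta (es (s (2*k+1)))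
                      * exp (- \<i> / 2 * complex_of_real (w k)))"
    using t unfolding tau_rel_def by blast
  let ?f = "es \<circ> s"
  have im: "?f ` {0..<2*n} = es ` {0..<2*n}" using permutes_image[OF s] by (metis image_comp)
  have "inj_on ?f {0..<2*n}"
    using comp_inj_on[OF permutes_inj_on[OF s, of "{0..<2*n}"], of es] e(1) permutes_image[OF s] by simp
  then have "(\<Prod>k<n. path_factor ?f (w k) k) = Lam S * (\<Prod>e\<leftarrow>map ?f [0..<2*n]. sn e) * W (map ?f [0..<2*n]) H"
    by (rule tau_value_id[OF _ _ _ p]) (use e H path im in \<open>auto simp: path_rel_iff\<close>)
  moreover have "(\<Prod>e\<leftarrow>map ?f [0..<2*n]. sn e) = (\<Prod>e\<leftarrow>map es [0..<2*n]. sn e)"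
    by (rule prod_list_permute[OF s])
  moreover have "W (map ?f [0..<2*n]) H = of_int (sign s) * W (map es [0..<2*n]) H"
    unfolding W_def lsgn_permute[OF s] set_map set_upt im by simp
  moreover have "of_int (sign s) * of_int (sign s) = (1 :: complex)" by (simp add: sign_def)
  ultimately show ?thesis unfolding t by (simp add: path_factor_def mult_ac)
qed

text \<open>The shortening run backwards. If the reverse of some \<open>es i\<close> is not in the
  list, \<open>es i\<close> is replaced by \<open>q\<close>, the smaller configuration is
  decomposed, and the path at index \<open>i\<close> is lengthened at its start or at its end.
  Otherwise reversal is an involution without fixed points on the indices, and all paths are
  empty.\<close>

lemma exists_paths:
  assumes e: "inj_on es {0..<2*n}" "es ` {0..<2*n} \<subseteq> S" and H: "H \<in> C (es ` {0..<2*n})"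
    and p: "noncrossing_pairing pos H p"
  shows "\<exists>s w. s permutes {0..<2*n} \<and> (\<forall>k<n. path_rel pos H p es (s (2*k)) (s (2*k+1)) (w k))"
  using e H p
proof (induction "card H" arbitrary: H es rule: less_induct)
  case less
  note e = less.prems(1,2) and H = less.prems(3) and p = less.prems(4)
  have pp: "p x \<in> H" "fst (p x) = fst x" "p x \<noteq> x" "p (p x) = x" if "x \<in> H" for x
    using p that unfolding noncrossing_pairing_def by auto
  have HS: "H \<subseteq> S - es ` {0..<2*n}" "closed (S - es ` {0..<2*n} - H)" using H by (auto simp: C_def)
  show ?case
  proof (cases "\<forall>i<2*n. orev (es i) \<in> es ` {0..<2*n}")
    case True
    have "\<exists>j. i < 2*n \<longrightarrow> j < 2*n \<and> es j = orev (es i)" for i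
    proof (cases "i < 2*n")
      case i: True
      then obtain j where "j \<in> {0..<2*n}" "orev (es i) = es j" using True by blast
      then show ?thesis by (intro exI[of _ j]) simp
    qed simp
    then obtain f where f: "\<And>i. i < 2*n \<Longrightarrow> f i < 2*n \<and> es (f i) = orev (es i)" by metis
    have "\<exists>s. s permutes {0..<2*n} \<and> (\<forall>k<n. s (2 * k + 1) = f (s (2 * k)))"
    proof (rule exists_pairing_permutation)
      fix i assume i: "i < 2*n"
      have "es i \<in> S" using e i by auto
      then have "es (f i) \<noteq> es i" using f[OF i] by simp
      moreover have "es (f (f i)) = es i" using f[OF i] f[of "f i"] by simp
      then have "f (f i) = i" using e(1) f i by (metis atLeastLessThan_iff inj_onD le0)
      ultimately show "f i < 2*n \<and> f i \<noteq> i \<and> f (f i) = i" using f[OF i] by auto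
    qed
    then obtain s where s: "s permutes {0..<2*n}" "\<And>k. k < n \<Longrightarrow> s (2*k+1) = f (s (2*k))" by blast
    have "path_rel pos H p es (s (2*k)) (s (2*k+1)) 0" if "k < n" for k
    proof -
      have "s (2*k) < 2*n" using permutes_in_image[OF s(1), of "2*k"] that by auto
      then show ?thesis using f s(2)[OF that] by (simp add: path_rel_iff)
    qed
    then show ?thesis using s(1) by (intro exI[of _ s] exI[of _ "\<lambda>_. 0"]) auto
  next
    case False
    then obtain i where i: "i < 2*n" "orev (es i) \<notin> es ` {0..<2*n}" by blast
    define a where "a = es i"
    define h where "h = orev a"
    define q where "q = p h"
    define H' where "H' = H - {h, q}"
    define es' where "es' = es(i := q)"
    have ah: "a = orev h" by (simp add: h_def)
    have aS: "a \<in> S" "a \<in> es ` {0..<2*n}" using e i by (auto simp: a_def)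
    have hH: "h \<in> H"
    proof (rule ccontr)
      assume "h \<notin> H"
      then have "h \<in> S - es ` {0..<2*n} - H" using aS i by (auto simp: h_def a_def)
      then have "a \<in> S - es ` {0..<2*n} - H" using HS(2) by (auto simp: closed_def ah)
      then show False using aS by auto
    qed
    have q: "q \<in> H" "q \<noteq> h" "fst q = fst h" "p q = h" using pp[OF hH] by (auto simp: q_def)
    have qS: "q \<in> S" "q \<notin> es ` {0..<2*n}" using q HS by auto
    have es'_other: "es' j = es j" if "j \<noteq> i" for j using that by (simp add: es'_def)
    have es'_i: "es' i = q" by (simp add: es'_def)
    have l: "map es [0..<2*n] = map es [0..<i] @ a # map es [Suc i..<2*n]"
      using upt_split[OF i(1)] by (simp add: a_def)
    have l': "map es' [0..<2*n] = map es [0..<i] @ q # map es [Suc i..<2*n]"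
      unfolding es'_def by (rule map_upd_upt[OF i(1)])
    have st: "set (map es [0..<2*n]) = es ` {0..<2*n}" "set (map es' [0..<2*n]) = es' ` {0..<2*n}" by auto
    have dl: "distinct (map es [0..<2*n])" using e by (simp add: distinct_map)
    have sgp1: "sgp (orev a) (H - {orev a, q}) * sgp q (H - {orev a, q}) = 1"
      using noncrossing_sgp[OF p _ hH] HS unfolding h_def q_def by blast
    have pre: "set (map es [0..<2*n]) \<subseteq> S" "H \<in> C (set (map es [0..<2*n]))" using e H by (auto simp: st)
    note sh = shorten(1)[OF dl[unfolded l] pre[unfolded l] hH[unfolded h_def] q(1) q(2,3)[unfolded h_def] sgp1, folded l l']
    have inj': "inj_on es' {0..<2*n}"
      unfolding es'_def by (rule inj_on_fun_updI[OF e(1) qS(2)])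
    have sub': "es' ` {0..<2*n} \<subseteq> S" using e qS by (auto simp: es'_def)
    have card: "card H' < card H" using hH HS finite_sub[of H] by (intro psubset_card_mono) (auto simp: H'_def)
    have p': "noncrossing_pairing pos H' p" unfolding H'_def q_def by (rule noncrossing_remove[OF p hH])
    obtain s w where s: "s permutes {0..<2*n}"
      and path: "\<And>k. k < n \<Longrightarrow> path_rel pos H' p es' (s (2*k)) (s (2*k+1)) (w k)"
      using less.hyps[OF card inj' sub' sh[unfolded st, folded h_def, folded H'_def] p'] by blast
    have "\<exists>v. path_rel pos H p es (s (2*k)) (s (2*k+1)) v" if k: "k < n" for k
    proof -
      have ne: "s (2*k) \<noteq> s (2*k+1)" using permutes_inj[OF s] by (simp add: inj_eq)
      have H'H: "H' \<subseteq> H" by (auto simp: H'_def)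
      consider (start) "s (2*k) = i" | (stop) "s (2*k+1) = i" | (other) "s (2*k) \<noteq> i" "s (2*k+1) \<noteq> i" by blast
      then show ?thesis
      proof cases
        case other
        have m: "path_rel pos H p es a b v" if "path_rel pos H' p es' a b v" and eq: "es' a = es a" "es' b = es b" for a b v
          using that(1) unfolding path_rel_iff[of _ H'] eq
        proof (elim disjE exE, goal_cases)
          case 1
          then show ?case by (simp add: path_rel_iff)
        next
          case (2 hs)
          then have "set hs \<subseteq> H" using H'H by blast
          then show ?case unfolding path_rel_iff using 2 by blast
        qed
        show ?thesis using m[OF path[OF k]] other es'_other by blast
      next
        case start
        then have b: "es' (s (2*k+1)) = es (s (2*k+1))" using ne es'_other by metis
        from path[OF k] show ?thesis
          unfolding path_rel_iff[of _ H'] start es'_i b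
        proof (elim disjE exE conjE, goal_cases)
          case 1
          have "path_rel pos H p es i (s (2*k+1)) (wang pos (orev h) (p h))"
            unfolding path_rel_iff
            by (intro disjI2 exI[of _ "[h]"]) (use 1 hH in \<open>auto simp: h_def[symmetric] a_def[symmetric] q_def\<close>)
          then show ?case by blast
        next
          case (2 hs)
          have "path_rel pos H p es i (s (2*k+1)) (\<Sum>h\<leftarrow>h # hs. wang pos (orev h) (p h))"
            unfolding path_rel_iff
            by (intro disjI2 exI[of _ "h # hs"]) (use 2 hH H'H in \<open>auto simp: h_def[symmetric] a_def[symmetric] q_def successively_Cons\<close>)
          then show ?case by blast
        qed
      next
        \<comment> \<open>The shorter path ends at the midpoint of the edge of \<open>q\<close>; it
          is prolonged along \<open>q\<close> to the vertex and out along
          \<open>p q = h\<close>.\<close>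
        case stop
        then have b: "es' (s (2*k)) = es (s (2*k))" using ne es'_other by metis
        from path[OF k] show ?thesis
          unfolding path_rel_iff[of _ H'] stop es'_i b
        proof (elim disjE exE conjE, goal_cases)
          case 1
          have "path_rel pos H p es (s (2*k)) i (wang pos (orev q) (p q))"
            unfolding path_rel_iff
            by (intro disjI2 exI[of _ "[q]"]) (use 1 q in \<open>auto simp: a_def[symmetric] ah[symmetric]\<close>)
          then show ?case by blast
        next
          case (2 hs)
          have "path_rel pos H p es (s (2*k)) i (\<Sum>h\<leftarrow>hs @ [q]. wang pos (orev h) (p h))"
            unfolding path_rel_iff
            by (intro disjI2 exI[of _ "hs @ [q]"]) (use 2 q H'H in \<open>auto simp: a_def[symmetric] ah[symmetric] successively_append_iff\<close>)
          then show ?case by blast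
        qed
      qed
    qed
    then obtain v where "\<And>k. k < n \<Longrightarrow> path_rel pos H p es (s (2*k)) (s (2*k+1)) (v k)" by metis
    then show ?thesis using s by blast
  qed
qed

lemma tau_rel_iff:
  assumes e: "inj_on es {0..<2*n}" "es ` {0..<2*n} \<subseteq> S" and H: "H \<in> C (es ` {0..<2*n})"
  shows "tau_rel pos eta es n H t \<longleftrightarrow> t = Lam S * (\<Prod>e\<leftarrow>map es [0..<2*n]. sn e) * W (map es [0..<2*n]) H"
proof -
  obtain p where p: "noncrossing_pairing pos H p"
    using exists_noncrossing_pairing[of H] H by (auto simp: C_def)
  obtain s w where "s permutes {0..<2*n}" "\<forall>k<n. path_rel pos H p es (s (2*k)) (s (2*k+1)) (w k)"
    using exists_paths[OF e H p] by blast
  then have "\<exists>t. tau_rel pos eta es n H t" using p unfolding tau_rel_def by blast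
  then show ?thesis using tau_value[OF e H] by blast
qed

end

section \<open>Planarity\<close>

context halfedges
begin

text \<open>Each unordered pair occurs in both orders and contributes -1; the exponent counts the
  pairs.\<close>

lemma prod_sgp_Diff:
  assumes "finite A" "A \<subseteq> S"
  shows "(\<Prod>f\<in>A. sgp f (A - {f})) = (-1) ^ (card A * (card A - 1) div 2)"
  using assms
proof (induction A rule: finite_ranking_induct[where f = rk])
  case (insert m A)
  show ?case
  proof (cases "m \<in> A")
    case True then show ?thesis using insert by (simp add: insert_absorb)
  next
    case False
    have less: "rk f < rk m" if "f \<in> A" for f
      using insert.hyps(2)[OF that] rk_neq[of f m] insert.prems that False by fastforce
    have "sgp f (insert m A - {f}) = sgp f (A - {f})" if "f \<in> A" for f
    proof -
      have "insert m A - {f} = insert m (A - {f})" using that False by auto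
      then show ?thesis using False insert.hyps(1) less[OF that] by (simp add: sgp_insert sg_def)
    qed
    then have "(\<Prod>f\<in>A. sgp f (insert m A - {f})) = (-1) ^ (card A * (card A - 1) div 2)"
      using insert by simp
    moreover have "sgp m (insert m A - {m}) = (-1) ^ card A"
      using False less by (simp add: sgp_greater)
    moreover have "card A + card A * (card A - 1) div 2 = Suc (card A) * card A div 2"
    proof -
      have "Suc (card A) * card A = 2 * card A + card A * (card A - 1)"
        by (cases "card A") (auto simp: algebra_simps)
      then show ?thesis by simp
    qed
    ultimately show ?thesis using False insert
      by (simp del: mult_Suc add: power_add[symmetric])
  qed
qed simp

lemma prod_sgp_Diff_even:
  assumes "finite A" "A \<subseteq> S" "card A = 2 * k"
  shows "(\<Prod>f\<in>A. sgp f (A - {f})) = (-1) ^ k"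
proof -
  have "card A * (card A - 1) div 2 = k * (2 * k - 1)" using assms(3) by simp
  moreover have "even (k * (2 * k - 1)) \<longleftrightarrow> even k" by (cases k) auto
  ultimately show ?thesis using prod_sgp_Diff[OF assms(1,2)] by (simp add: minus_one_power_iff)
qed

text \<open>
  \<open>lft h g\<close> stands for: the origin of \<open>h\<close> is to the left of the edge of \<open>g\<close>. The last two
  assumptions say that the left-right order of two edges is the same at both ends of the
  range of heights they share.
\<close>

lemma Lam_even:
  assumes H: "closed H" "\<And>v. even (deg H v)"
    and lft_vertex: "\<And>h h' g. \<lbrakk>h \<in> S; h' \<in> S; g \<in> S; org h = org h'; org h \<noteq> org g; org h \<noteq> org (bar g)\<rbrakk> \<Longrightarrow> lft h g \<longleftrightarrow> lft h' g"
    and lft_end: "\<And>h g. \<lbrakk>h \<in> S; g \<in> S; org h = org g \<or> org h = org (bar g)\<rbrakk> \<Longrightarrow> lft h g"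
    and nested: "\<And>a b. \<lbrakk>a \<in> S; b \<in> S; rk a < rk b; rk b < rk (bar b); rk (bar b) < rk (bar a)\<rbrakk> \<Longrightarrow> lft b a \<longleftrightarrow> lft (bar b) a"
    and interleaved: "\<And>a b. \<lbrakk>a \<in> S; b \<in> S; rk a < rk b; rk b < rk (bar a); rk (bar a) < rk (bar b)\<rbrakk> \<Longrightarrow> lft b a \<longleftrightarrow> \<not> lft (bar a) b"
  shows "Lam H = 1"
proof -
  \<comment> \<open>The value -1 marks that \<open>h\<close> lies between the two halves of
    \<open>g\<close> in the order and that its origin is to the left of \<open>g\<close>.\<close>
  define \<delta> where "\<delta> h g = (if rk g < rk h \<and> rk h < rk (bar g) \<and> lft h g then -1 else 1 :: complex)" for h g
  have HS: "H \<subseteq> S" "finite H" using H(1) finite_sub by (auto simp: closed_def)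
  have lo: "finite (lo H)" "lo H \<subseteq> H" "lo H \<subseteq> S" using HS by (auto simp: lo_def)
  \<comment> \<open>Separated edges give trivial factors only. For interleaved edges exactly one of
    the two relevant factors is -1; for nested edges the two relevant factors agree.\<close>
  have chi1: "chi a b = (\<delta> b a * \<delta> (bar b) a) * (\<delta> a b * \<delta> (bar a) b)"
    if ab: "a \<in> lo H" "b \<in> lo H" "rk a < rk b" for a b
  proof -
    have S: "a \<in> S" "b \<in> S" "bar a \<in> S" "bar b \<in> S" and r: "rk a < rk (bar a)" "rk b < rk (bar b)"
      using ab lo by (auto simp: lo_def)
    have n: "bar a \<noteq> b" "bar a \<noteq> bar b"
      using ab r bar_eq_iff by (metis bar_bar less_asym, metis less_irrefl)
    then have n': "rk (bar a) \<noteq> rk b" "rk (bar a) \<noteq> rk (bar b)" using S rk_neq by blast+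
    consider "rk (bar a) < rk b" | "rk b < rk (bar a)" "rk (bar a) < rk (bar b)" | "rk (bar b) < rk (bar a)"
      using n' by linarith
    then show ?thesis
    proof cases
      case 1
      then show ?thesis using ab r unfolding chi_def \<delta>_def sg_def by simp
    next
      case 2
      then show ?thesis using ab r interleaved[OF S(1,2) ab(3) 2] unfolding chi_def \<delta>_def sg_def by simp
    next
      case 3
      then show ?thesis using ab r nested[OF S(1,2) ab(3) r(2) 3] unfolding chi_def \<delta>_def sg_def by simp
    qed
  qed
  have "Lam H = (\<Prod>a\<in>lo H. \<Prod>b\<in>{b \<in> lo H. rk a < rk b}. (\<delta> b a * \<delta> (bar b) a) * (\<delta> a b * \<delta> (bar a) b))"
    unfolding Lam_def by (intro prod.cong refl) (use chi1 in auto)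
  also have "\<dots> = (\<Prod>g\<in>lo H. \<Prod>b\<in>lo H - {g}. \<delta> b g * \<delta> (bar b) g)"
    by (rule prod_triangle_symmetrize[of _ _ "\<lambda>g b. \<delta> b g * \<delta> (bar b) g"]) (use lo inj_rk in \<open>auto intro: inj_on_subset\<close>)
  \<comment> \<open>For fixed \<open>g\<close> the product over \<open>H\<close> is grouped by
    vertices. Away from the ends of \<open>g\<close>, the factor is constant on an even number of
    half-edges, so only the two ends contribute.\<close>
  also have "\<dots> = (\<Prod>g\<in>lo H. - (sgp g ({h \<in> H. org h = org g} - {g}) * sgp (bar g) ({h \<in> H. org h = org (bar g)} - {bar g})))"
  proof (rule prod.cong)
    fix g assume g: "g \<in> lo H"
    have gS: "g \<in> S" "bar g \<in> S" "g \<in> H" "bar g \<in> H" "rk g < rk (bar g)"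
      using g lo H(1) by (auto simp: closed_def lo_def)
    have og: "org (bar g) \<noteq> org g" by (rule org_bar[OF gS(1)])
    define A where "A v = {h \<in> H. org h = v}" for v
    have fA: "finite (A v)" "A v \<subseteq> S" for v using HS by (auto simp: A_def)
    have "(\<Prod>b\<in>lo H - {g}. \<delta> b g * \<delta> (bar b) g) = (\<Prod>b\<in>lo H. \<delta> b g * \<delta> (bar b) g)"
      using lo g by (subst (2) prod.remove[of _ g]) (auto simp: \<delta>_def)
    also have "\<dots> = (\<Prod>h\<in>H. \<delta> h g)" by (rule prod_closed[OF H(1), symmetric])
    also have "\<dots> = (\<Prod>v\<in>org ` H. \<Prod>h\<in>A v. \<delta> h g)"
      unfolding A_def by (rule prod.group[symmetric]) (use HS in auto)
    also have "\<dots> = (\<Prod>v\<in>{org g, org (bar g)}. \<Prod>h\<in>A v. \<delta> h g)"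
    proof (rule prod.mono_neutral_right)
      show "\<forall>v\<in>org ` H - {org g, org (bar g)}. (\<Prod>h\<in>A v. \<delta> h g) = 1"
      proof
        fix v assume v: "v \<in> org ` H - {org g, org (bar g)}"
        then obtain h0 where h0: "h0 \<in> H" "org h0 = v" by auto
        have "\<delta> h g = \<delta> h0 g" if "h \<in> A v" for h
        proof -
          have S: "h \<in> S" "h0 \<in> S" "org h = v" using that h0 HS by (auto simp: A_def)
          have "rk h < rk (bar g) \<longleftrightarrow> rk h0 < rk (bar g)" "rk h < rk g \<longleftrightarrow> rk h0 < rk g"
            using contiguous[of h h0 "bar g"] contiguous[of h h0 g] S gS h0 v by auto
          moreover have "rk h \<noteq> rk g" "rk h0 \<noteq> rk g" using S h0 gS v rk_neq by (metis Diff_iff insertI1)+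
          moreover have "lft h g \<longleftrightarrow> lft h0 g" by (rule lft_vertex) (use S h0 gS v in auto)
          ultimately show ?thesis unfolding \<delta>_def by (auto simp: neq_iff)
        qed
        then have "(\<Prod>h\<in>A v. \<delta> h g) = \<delta> h0 g ^ card (A v)" by simp
        moreover have "even (card (A v))" using H(2)[of v] by (simp add: A_def deg_def)
        moreover have "\<delta> h0 g = 1 \<or> \<delta> h0 g = -1" by (simp add: \<delta>_def)
        ultimately show "(\<Prod>h\<in>A v. \<delta> h g) = 1" by auto
      qed
    qed (use HS gS in auto)
    also have "\<dots> = (\<Prod>h\<in>A (org g). \<delta> h g) * (\<Prod>h\<in>A (org (bar g)). \<delta> h g)"
      using og by simp
    also have "(\<Prod>h\<in>A (org g). \<delta> h g) = - sgp g (A (org g) - {g})"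
    proof -
      have gA: "g \<in> A (org g)" using gS by (simp add: A_def)
      have "(\<Prod>h\<in>A (org g). \<delta> h g) = (\<Prod>h\<in>A (org g) - {g}. \<delta> h g)"
        using fA gA by (subst prod.remove[of _ g]) (auto simp: \<delta>_def)
      also have "\<dots> = (\<Prod>h\<in>A (org g) - {g}. - sg g h)"
      proof (rule prod.cong)
        fix h assume "h \<in> A (org g) - {g}"
        then have h: "h \<in> S" "h \<noteq> g" "org h = org g" using HS by (auto simp: A_def)
        have "rk h \<noteq> rk g" using rk_neq h gS by blast
        moreover have "rk h < rk (bar g)" using contiguous[of g h "bar g"] h gS og by auto
        moreover have "lft h g" using lft_end h gS by blast
        ultimately show "\<delta> h g = - sg g h" by (auto simp: \<delta>_def sg_def)
      qed simp
      also have "\<dots> = (-1) ^ card (A (org g) - {g}) * sgp g (A (org g) - {g})"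
        by (simp add: prod_uminus sgp_def)
      \<comment> \<open>The minus sign of each edge comes from here: \<open>g\<close> is missing
        from an even set. At the upper end no such sign arises, as there \<open>\<delta> h g\<close>
        equals \<open>sg (bar g) h\<close>.\<close>
      also have "odd (card (A (org g) - {g}))"
        using H(2)[of "org g"] gA fA(1) card_Suc_Diff1[OF fA(1) gA] by (auto simp: A_def deg_def)
      ultimately show ?thesis by simp
    qed
    also have "(\<Prod>h\<in>A (org (bar g)). \<delta> h g) = sgp (bar g) (A (org (bar g)) - {bar g})"
    proof -
      have gA: "bar g \<in> A (org (bar g))" using gS by (simp add: A_def)
      have "(\<Prod>h\<in>A (org (bar g)). \<delta> h g) = (\<Prod>h\<in>A (org (bar g)) - {bar g}. \<delta> h g)"
        using fA gA by (subst prod.remove[of _ "bar g"]) (auto simp: \<delta>_def)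
      also have "\<dots> = sgp (bar g) (A (org (bar g)) - {bar g})"
        unfolding sgp_def
      proof (rule prod.cong)
        fix h assume "h \<in> A (org (bar g)) - {bar g}"
        then have h: "h \<in> S" "h \<noteq> bar g" "org h = org (bar g)" using HS by (auto simp: A_def)
        have "rk h \<noteq> rk (bar g)" using rk_neq h gS by blast
        moreover have "\<not> rk h < rk g" using contiguous[of "bar g" h g] h gS og by auto
        moreover have "rk h \<noteq> rk g" using rk_neq h gS og by metis
        moreover have "lft h g" using lft_end h gS by blast
        ultimately show "\<delta> h g = sg (bar g) h" by (auto simp: \<delta>_def sg_def)
      qed simp
      finally show ?thesis .
    qed
    finally show "(\<Prod>b\<in>lo H - {g}. \<delta> b g * \<delta> (bar b) g) =
        - (sgp g ({h \<in> H. org h = org g} - {g}) * sgp (bar g) ({h \<in> H. org h = org (bar g)} - {bar g}))"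
      by (simp add: A_def)
  qed simp
  \<comment> \<open>One minus sign per edge stands against one for every two half-edges at a vertex.
    Both count the edges of \<open>H\<close>, since the degrees add up to twice their
    number.\<close>
  also have "\<dots> = (-1) ^ card (lo H) * (\<Prod>h\<in>H. sgp h ({h' \<in> H. org h' = org h} - {h}))"
    by (subst prod_closed[OF H(1)]) (simp add: prod_uminus)
  also have "(\<Prod>h\<in>H. sgp h ({h' \<in> H. org h' = org h} - {h})) =
     (\<Prod>v\<in>org ` H. \<Prod>h\<in>{h \<in> H. org h = v}. sgp h ({h' \<in> H. org h' = org h} - {h}))"
    by (rule prod.group[symmetric]) (use HS in auto)
  also have "\<dots> = (\<Prod>v\<in>org ` H. (-1) ^ (deg H v div 2))"
  proof (rule prod.cong)
    fix v
    have "(\<Prod>h\<in>{h \<in> H. org h = v}. sgp h ({h' \<in> H. org h' = org h} - {h})) =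
       (\<Prod>h\<in>{h \<in> H. org h = v}. sgp h ({h \<in> H. org h = v} - {h}))"
      by (rule prod.cong) auto
    also have "\<dots> = (-1) ^ (deg H v div 2)"
      by (rule prod_sgp_Diff_even) (use HS H(2)[of v] in \<open>auto simp: deg_def\<close>)
    finally show "(\<Prod>h\<in>{h \<in> H. org h = v}. sgp h ({h' \<in> H. org h' = org h} - {h})) = (-1) ^ (deg H v div 2)" .
  qed simp
  also have "\<dots> = (-1) ^ (\<Sum>v\<in>org ` H. deg H v div 2)" by (simp add: power_sum)
  also have "(\<Sum>v\<in>org ` H. deg H v div 2) = card (lo H)"
  proof -
    have "2 * (\<Sum>v\<in>org ` H. deg H v div 2) = (\<Sum>v\<in>org ` H. deg H v)"
      using H(2) by (simp add: sum_distrib_left)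
    also have "\<dots> = card H"
      using sum.group[of H "org ` H" org "\<lambda>_. 1::nat"] HS by (simp add: deg_def)
    also have "\<dots> = 2 * card (lo H)"
    proof -
      have "card H = card (lo H) + card (bar ` lo H)"
        using closed_split[OF H(1)] lo(1) by (metis card_Un_disjoint finite_imageI)
      moreover have "card (bar ` lo H) = card (lo H)"
        by (rule card_image) (auto intro: inj_onI simp: bar_eq_iff)
      ultimately show ?thesis by simp
    qed
    finally show ?thesis by simp
  qed
  finally show ?thesis by (simp add: power_mult_distrib[symmetric])
qed

lemma closed_iff_complement: "H \<subseteq> S \<Longrightarrow> closed (S - H) \<longleftrightarrow> closed H"
  using closed_Diff[of "S - H"] closed_Diff[of H] by (auto simp: double_diff)

end

section \<open>Plane geometry: orientation, tilted heights and segments at a given height\<close>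

definition cross :: "complex \<Rightarrow> complex \<Rightarrow> real" where
  "cross d z = Re d * Im z - Im d * Re z"

lemma cross_antisym: "cross z d = - cross d z"
  by (simp add: cross_def)

lemma cross_polar: "cross d z = cmod d * cmod z * sin (Arg z - Arg d)"
proof (cases "d = 0 \<or> z = 0")
  case True
  then show ?thesis by (auto simp: cross_def)
next
  case False
  have p: "Re w = cmod w * cos (Arg w)" "Im w = cmod w * sin (Arg w)" for w
    using rcis_cmod_Arg[of w] by (metis Re_rcis, metis Im_rcis)
  show ?thesis
    unfolding cross_def sin_diff by (subst p(1)[of d], subst p(2)[of d], subst p(1)[of z], subst p(2)[of z]) (simp add: algebra_simps)
qed

text \<open>Both arguments lie in (0, pi] or both in (-pi, 0], so the angle from \<open>d\<close> to
  \<open>z\<close> is in (0, pi) and has positive sine.\<close>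

lemma cross_pos:
  assumes "d \<noteq> 0" "z \<noteq> 0" "Arg d < Arg z" "0 < Arg d \<longleftrightarrow> 0 < Arg z"
  shows "0 < cross d z"
proof -
  have "0 < sin (Arg z - Arg d)"
    by (rule sin_gt_zero) (use assms Arg_bounded[of d] Arg_bounded[of z] in auto)
  then show ?thesis using assms by (simp add: cross_polar)
qed

text \<open>
  A perturbed height. It separates the vertices, and horizontal segments rise exactly if
  their argument is \<open>\<pi>\<close>, which matches the branch cut of \<open>Arg\<close>.
\<close>

definition slant :: "real \<Rightarrow> complex \<Rightarrow> real" where
  "slant \<epsilon> z = Im z - \<epsilon> * Re z"

lemma slant_diff: "slant \<epsilon> (z - w) = slant \<epsilon> z - slant \<epsilon> w"
  by (simp add: slant_def algebra_simps)

lemma cross_slant: "cross d z = Re d * slant \<epsilon> z - slant \<epsilon> d * Re z"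
  by (simp add: cross_def slant_def algebra_simps)

text \<open>Every small enough positive tilt works for a given vector, and \<open>D\<close> is
  finite. The bound keeps the tilt from changing the sign of a nonzero \<open>Im d\<close>. For
  horizontal \<open>d\<close>, the tilted height is positive exactly if \<open>Re d\<close> is
  negative, which is the case \<open>Arg d = pi\<close>.\<close>

lemma exists_slant:
  assumes "finite D" "0 \<notin> D"
  shows "\<exists>\<epsilon>. \<forall>d\<in>D. slant \<epsilon> d \<noteq> 0 \<and> (0 < slant \<epsilon> d \<longleftrightarrow> 0 < Arg d)"
proof -
  have "eventually (\<lambda>\<epsilon>. slant \<epsilon> d \<noteq> 0 \<and> (0 < slant \<epsilon> d \<longleftrightarrow> 0 < Arg d)) (at_right 0)" if "d \<in> D" for d
  proof -
    have d: "d \<noteq> 0" using that assms(2) by auto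
    let ?b = "if Im d = 0 then 1 else \<bar>Im d\<bar> / (1 + \<bar>Re d\<bar>)"
    show ?thesis
    proof (rule eventually_at_rightI)
      show "0 < ?b" by (auto simp: add_pos_nonneg)
      fix e assume e: "e \<in> {0<..<?b}"
      show "slant e d \<noteq> 0 \<and> (0 < slant e d \<longleftrightarrow> 0 < Arg d)"
      proof (cases "Im d = 0")
        case True
        then have "Re d \<noteq> 0" using d by (simp add: complex_eq_iff)
        then show ?thesis using True e d
          by (auto simp: slant_def Arg_pos_iff mult_less_0_iff)
      next
        case False
        then have "e * (1 + \<bar>Re d\<bar>) < \<bar>Im d\<bar>" using e by (simp add: pos_less_divide_eq add_pos_nonneg)
        then have "e * \<bar>Re d\<bar> < \<bar>Im d\<bar>" using e by (simp add: algebra_simps)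
        then have "\<bar>e * Re d\<bar> < \<bar>Im d\<bar>" using e by (simp add: abs_mult)
        then show ?thesis using False d by (auto simp: slant_def Arg_pos_iff abs_if split: if_splits)
      qed
    qed
  qed
  then have "eventually (\<lambda>\<epsilon>. \<forall>d\<in>D. slant \<epsilon> d \<noteq> 0 \<and> (0 < slant \<epsilon> d \<longleftrightarrow> 0 < Arg d)) (at_right 0)"
    using assms(1) by (intro eventually_ball_finite) auto
  then show ?thesis using eventually_happens' trivial_limit_at_right_real by blast
qed

definition at_level :: "real \<Rightarrow> complex \<Rightarrow> complex \<Rightarrow> real \<Rightarrow> complex" where
  "at_level \<epsilon> a b y = a + of_real ((y - slant \<epsilon> a) / slant \<epsilon> (b - a)) * (b - a)"

lemma slant_affine: "slant \<epsilon> (a + of_real s * d) = slant \<epsilon> a + s * slant \<epsilon> d"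
  by (simp add: slant_def algebra_simps)

lemma slant_at_level: "slant \<epsilon> a < slant \<epsilon> b \<Longrightarrow> slant \<epsilon> (at_level \<epsilon> a b y) = y"
proof -
  assume "slant \<epsilon> a < slant \<epsilon> b"
  then have n: "slant \<epsilon> (b - a) \<noteq> 0" by (simp add: slant_diff)
  have "slant \<epsilon> (at_level \<epsilon> a b y) = slant \<epsilon> a + (y - slant \<epsilon> a) / slant \<epsilon> (b - a) * slant \<epsilon> (b - a)"
    unfolding at_level_def by (rule slant_affine)
  then show ?thesis using n by simp
qed

lemma at_level_in_segment:
  assumes "slant \<epsilon> a < slant \<epsilon> b" "slant \<epsilon> a \<le> y" "y \<le> slant \<epsilon> b"
  shows "at_level \<epsilon> a b y \<in> closed_segment a b"
proof -
  define s where "s = (y - slant \<epsilon> a) / slant \<epsilon> (b - a)"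
  have "0 \<le> s" "s \<le> 1" using assms by (auto simp: slant_diff s_def)
  then show ?thesis unfolding at_level_def in_segment s_def[symmetric]
    by (intro exI[of _ s]) (simp add: scaleR_conv_of_real algebra_simps)
qed

lemma at_level_ends:
  assumes "slant \<epsilon> a < slant \<epsilon> b"
  shows "at_level \<epsilon> a b (slant \<epsilon> a) = a" "at_level \<epsilon> a b (slant \<epsilon> b) = b"
  using assms by (simp_all add: at_level_def slant_diff)

text \<open>By \<open>cross_slant\<close> the cross product is also a determinant in the coordinates
  \<open>Re\<close> and \<open>slant\<close>. Divided by the positive
  \<open>slant \<epsilon> (b - a)\<close>, it is the horizontal displacement from \<open>z\<close>
  to the line at the height of \<open>z\<close>.\<close>

lemma left_iff:
  assumes "slant \<epsilon> a < slant \<epsilon> b"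
  shows "0 < cross (b - a) (z - a) \<longleftrightarrow> Re z < Re (at_level \<epsilon> a b (slant \<epsilon> z))"
proof -
  let ?d = "slant \<epsilon> (b - a)"
  have d: "0 < ?d" using assms by (simp add: slant_diff)
  have "Re (at_level \<epsilon> a b (slant \<epsilon> z)) = Re a + (slant \<epsilon> z - slant \<epsilon> a) / ?d * Re (b - a)"
    by (simp add: at_level_def)
  then have "?d * (Re (at_level \<epsilon> a b (slant \<epsilon> z)) - Re z) = cross (b - a) (z - a)"
    using d by (simp add: cross_slant[of _ _ \<epsilon>] slant_diff field_simps)
  then show ?thesis using d by (metis diff_gt_0_iff_gt zero_less_mult_pos mult_pos_pos)
qed

text \<open>A zero of \<open>D\<close> would be a common point of the segments, because
  \<open>slant\<close> and \<open>Re\<close> together determine a point. So the continuous function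
  \<open>D\<close> cannot change sign.\<close>

lemma disjoint_segments_order:
  assumes ab: "slant \<epsilon> a < slant \<epsilon> b" and cd: "slant \<epsilon> c < slant \<epsilon> d"
    and disj: "closed_segment a b \<inter> closed_segment c d = {}"
    and y: "slant \<epsilon> a \<le> y" "slant \<epsilon> c \<le> y" "y \<le> y'" "y' \<le> slant \<epsilon> b" "y' \<le> slant \<epsilon> d"
  defines "D \<equiv> \<lambda>y. Re (at_level \<epsilon> a b y) - Re (at_level \<epsilon> c d y)"
  shows "D y \<noteq> 0" "D y' \<noteq> 0" "0 < D y \<longleftrightarrow> 0 < D y'"
proof -
  have nz: "D t \<noteq> 0" if "y \<le> t" "t \<le> y'" for t
  proof
    assume "D t = 0"
    then have re: "Re (at_level \<epsilon> a b t) = Re (at_level \<epsilon> c d t)" by (simp add: D_def)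
    moreover have "slant \<epsilon> (at_level \<epsilon> a b t) = slant \<epsilon> (at_level \<epsilon> c d t)"
      using slant_at_level ab cd by simp
    ultimately have "at_level \<epsilon> a b t = at_level \<epsilon> c d t" by (simp add: slant_def complex_eq_iff)
    moreover have "at_level \<epsilon> a b t \<in> closed_segment a b" "at_level \<epsilon> c d t \<in> closed_segment c d"
      using that y ab cd by (auto intro!: at_level_in_segment)
    ultimately show False using disj by auto
  qed
  have cont: "continuous_on {y..y'} D"
    unfolding D_def at_level_def by (intro continuous_intros)
      (use ab cd in \<open>auto simp: slant_diff\<close>)
  show "D y \<noteq> 0" "D y' \<noteq> 0" using nz y by auto
  show "0 < D y \<longleftrightarrow> 0 < D y'"
  proof (rule ccontr)
    assume *: "\<not> (0 < D y \<longleftrightarrow> 0 < D y')"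
    have "\<exists>t\<ge>y. t \<le> y' \<and> D t = 0"
    proof (cases "0 < D y")
      case True
      then show ?thesis using * IVT2'[of D y' 0 y] y cont by auto
    next
      case False
      then show ?thesis using * IVT'[of D y 0 y'] y cont by auto
    qed
    then show False using nz by auto
  qed
qed

lemma dir_orev: "dir pos (orev h) = - dir pos h"
  by (simp add: dir_def orev_def)

section \<open>The order of the half-edges of an embedded graph\<close>

locale embedded_graph =
  fixes V :: "'v set" and E :: "'v set set" and pos :: "'v \<Rightarrow> complex" and \<epsilon> :: real
  assumes G: "planar_straight_graph V E pos"
    and slant: "\<lbrakk>u \<in> V; v \<in> V; u \<noteq> v\<rbrakk> \<Longrightarrow> slant \<epsilon> (pos v - pos u) \<noteq> 0 \<and>
      (0 < slant \<epsilon> (pos v - pos u) \<longleftrightarrow> 0 < Arg (pos v - pos u))"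
begin

definition ht :: "'v \<Rightarrow> real" where
  "ht v = slant \<epsilon> (pos v)"

definition before :: "'v \<times> 'v \<Rightarrow> 'v \<times> 'v \<Rightarrow> bool" where
  "before a b \<longleftrightarrow> ht (fst a) < ht (fst b) \<or> fst a = fst b \<and> hang pos a < hang pos b"

text \<open>Counting predecessors turns the order \<open>before\<close> into the numerical rank that
  \<open>halfedges\<close> expects.\<close>

definition rank :: "'v \<times> 'v \<Rightarrow> nat" where
  "rank a = card {b \<in> OE E. before b a}"

lemma finite_V: "finite V"
  using G by (simp add: planar_straight_graph_def)

lemma edge_doubleton: "e \<in> E \<Longrightarrow> \<exists>u v. e = {u, v} \<and> u \<noteq> v"
proof -
  have "\<forall>e\<in>E. \<exists>u v. e = {u, v} \<and> u \<noteq> v \<and> u \<in> V \<and> v \<in> V"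
    using G by (simp add: planar_straight_graph_def)
  then show "e \<in> E \<Longrightarrow> ?thesis" by blast
qed

lemma edge:
  assumes "h \<in> OE E"
  shows "fst h \<in> V" "snd h \<in> V" "fst h \<noteq> snd h" "{fst h, snd h} \<in> E"
proof -
  have e: "{fst h, snd h} \<in> E" using assms by (simp add: OE_def)
  have "\<forall>e\<in>E. \<exists>u v. e = {u, v} \<and> u \<noteq> v \<and> u \<in> V \<and> v \<in> V"
    using G by (simp add: planar_straight_graph_def)
  then obtain u v where "{fst h, snd h} = {u, v}" "u \<noteq> v" "u \<in> V" "v \<in> V" using e by blast
  then show "fst h \<in> V" "snd h \<in> V" "fst h \<noteq> snd h" by (auto simp: doubleton_eq_iff)
  show "{fst h, snd h} \<in> E" by (rule e)
qed

lemma finite_OE: "finite (OE E)"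
proof (rule finite_subset)
  show "OE E \<subseteq> V \<times> V" using edge by (auto simp: mem_Times_iff)
qed (use finite_V in simp)

lemma orev_in: "h \<in> OE E \<Longrightarrow> orev h \<in> OE E"
  by (simp add: OE_def orev_def insert_commute)

lemma orev_orev: "orev (orev h) = h"
  by (simp add: orev_def)

lemma ht_neq: "u \<in> V \<Longrightarrow> v \<in> V \<Longrightarrow> u \<noteq> v \<Longrightarrow> ht u \<noteq> ht v"
  using slant[of u v] by (auto simp: ht_def slant_diff)

lemma dir_nonzero: "h \<in> OE E \<Longrightarrow> dir pos h \<noteq> 0"
  using G edge[of h] inj_onD[of pos V "snd h" "fst h"] by (auto simp: planar_straight_graph_def dir_def)

lemma hang_pos_iff: "h \<in> OE E \<Longrightarrow> 0 < hang pos h \<longleftrightarrow> ht (fst h) < ht (snd h)"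
  using slant[of "fst h" "snd h"] edge[of h] by (simp add: hang_def dir_def slant_diff ht_def)

text \<open>If two edges left a vertex in the same direction, the far end of the shorter one would
  lie on the longer one, and a vertex lies on an edge only as one of its ends.\<close>

lemma hang_inj:
  assumes a: "a \<in> OE E" and b: "b \<in> OE E" and eq: "fst a = fst b" "hang pos a = hang pos b"
  shows "a = b"
proof -
  have main: "a = b" if a: "a \<in> OE E" and b: "b \<in> OE E" and eq: "fst a = fst b" "hang pos a = hang pos b"
    and le: "cmod (dir pos a) \<le> cmod (dir pos b)" for a b
  proof -
    define t where "t = cmod (dir pos a) / cmod (dir pos b)"
    have nz: "cmod (dir pos a) > 0" "cmod (dir pos b) > 0" using a b dir_nonzero by auto
    have t: "0 \<le> t" "t \<le> 1" using nz le by (auto simp: t_def)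
    have "dir pos a = of_real (cmod (dir pos a)) * cis (hang pos a)"
      "dir pos b = of_real (cmod (dir pos b)) * cis (hang pos b)"
      using rcis_cmod_Arg by (metis hang_def rcis_def)+
    then have "dir pos a = of_real t * dir pos b"
      using eq(2) nz by (metis (no_types, opaque_lifting) mult.assoc nonzero_eq_divide_eq of_real_mult order_less_irrefl t_def)
    then have "pos (snd a) = pos (fst b) + of_real t * (pos (snd b) - pos (fst b))"
      using eq(1) by (simp add: dir_def algebra_simps)
    also have "\<dots> = (1 - t) *\<^sub>R pos (fst b) + t *\<^sub>R pos (snd b)"
      by (simp add: scaleR_conv_of_real algebra_simps)
    finally have "pos (snd a) \<in> closed_segment (pos (fst b)) (pos (snd b))"
      using t unfolding in_segment by blast
    moreover have "\<forall>u v w. {u, v} \<in> E \<longrightarrow> w \<in> V \<longrightarrow> w \<noteq> u \<longrightarrow> w \<noteq> v \<longrightarrow>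
        pos w \<notin> closed_segment (pos u) (pos v)"
      using G by (simp add: planar_straight_graph_def)
    ultimately have "snd a = snd b" using edge[OF a] edge[OF b] eq(1) by metis
    then show ?thesis using eq(1) by (simp add: prod_eq_iff)
  qed
  show ?thesis
    using main[OF a b eq] main[OF b a eq(1)[symmetric] eq(2)[symmetric]]
    by (cases "cmod (dir pos a) \<le> cmod (dir pos b)") auto
qed

lemma before_trans: "before a b \<Longrightarrow> before b c \<Longrightarrow> before a c"
  by (auto simp: before_def)

lemma before_total: "a \<in> OE E \<Longrightarrow> b \<in> OE E \<Longrightarrow> a \<noteq> b \<Longrightarrow> before a b \<or> before b a"
  using ht_neq[of "fst a" "fst b"] hang_inj[of a b] edge[of a] edge[of b] by (force simp: before_def)

lemma rank_less_iff:
  assumes "a \<in> OE E" "b \<in> OE E"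
  shows "rank a < rank b \<longleftrightarrow> before a b"
proof -
  have main: "rank a < rank b" if "a \<in> OE E" "before a b" for a b
    unfolding rank_def
  proof (rule psubset_card_mono)
    have "\<not> before a a" by (auto simp: before_def)
    then show "{c \<in> OE E. before c a} \<subset> {c \<in> OE E. before c b}"
      using that before_trans by blast
  qed (use finite_OE in simp)
  show ?thesis
    using main[of a b] main[of b a] before_total[OF assms] assms by (metis less_irrefl less_asym)
qed

lemma segments_disjoint:
  assumes "a \<in> OE E" "b \<in> OE E" "{fst a, snd a} \<inter> {fst b, snd b} = {}"
  shows "closed_segment (pos (fst a)) (pos (snd a)) \<inter> closed_segment (pos (fst b)) (pos (snd b)) = {}"
proof -
  have "\<forall>a b c d. {a, b} \<in> E \<longrightarrow> {c, d} \<in> E \<longrightarrow> {a, b} \<noteq> {c, d} \<longrightarrow>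
        closed_segment (pos a) (pos b) \<inter> closed_segment (pos c) (pos d)
          \<subseteq> pos ` ({a, b} \<inter> {c, d})"
    using G by (simp add: planar_straight_graph_def)
  moreover have "{fst a, snd a} \<noteq> {fst b, snd b}" using assms(3) by auto
  ultimately have "closed_segment (pos (fst a)) (pos (snd a)) \<inter> closed_segment (pos (fst b)) (pos (snd b))
          \<subseteq> pos ` ({fst a, snd a} \<inter> {fst b, snd b})"
    using edge(4)[OF assms(1)] edge(4)[OF assms(2)] by meson
  then show ?thesis using assms(3) by auto
qed

text \<open>The value at the ends of \<open>g\<close> is a convention: there the order of the
  half-edges alone decides what \<open>Lam_even\<close> counts.\<close>

definition lft :: "'v \<times> 'v \<Rightarrow> 'v \<times> 'v \<Rightarrow> bool" where
  "lft h g \<longleftrightarrow> fst h = fst g \<or> fst h = snd g \<or> 0 < cross (dir pos g) (pos (fst h) - pos (fst g))"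

lemma cross_dir_pos:
  assumes "a \<in> OE E" "b \<in> OE E" "hang pos a < hang pos b" "0 < hang pos a \<longleftrightarrow> 0 < hang pos b"
  shows "0 < cross (dir pos a) (dir pos b)"
  using cross_pos assms dir_nonzero by (simp add: hang_def)

lemma cross_at_target:
  "snd a = snd b \<Longrightarrow> cross (dir pos a) (pos (fst b) - pos (fst a)) = cross (dir pos (orev b)) (dir pos (orev a))"
  by (simp add: dir_def orev_def cross_def algebra_simps)

text \<open>If the edges share an end, one side is true by convention, and the order of directions
  at that end makes the other true through a cross product. Otherwise the segments are disjoint, and
  their order is compared at the heights of the two ends of \<open>b\<close>.\<close>

lemma lft_nested:
  assumes a: "a \<in> OE E" and b: "b \<in> OE E" and "before a b" "before b (orev b)" "before (orev b) (orev a)"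
  shows "lft b a \<longleftrightarrow> lft (orev b) a"
proof -
  have va: "fst a \<in> V" "snd a \<in> V" "fst a \<noteq> snd a" and vb: "fst b \<in> V" "snd b \<in> V" "fst b \<noteq> snd b"
    using edge a b by auto
  have bb: "ht (fst b) < ht (snd b)" using assms(4) vb by (auto simp: before_def orev_def)
  have s1: "fst a = fst b \<or> ht (fst a) < ht (fst b)" and s2: "snd b = snd a \<or> ht (snd b) < ht (snd a)"
    using assms(3,5) by (auto simp: before_def orev_def)
  have aa: "ht (fst a) < ht (snd a)" using s1 s2 bb by auto
  have ha: "0 < hang pos a" "0 < hang pos b" "\<not> 0 < hang pos (orev a)" "\<not> 0 < hang pos (orev b)"
    using aa bb hang_pos_iff a b orev_in by (auto simp: orev_def)
  consider (same) "fst a = fst b" | (top) "fst a \<noteq> fst b" "snd a = snd b" | (free) "fst a \<noteq> fst b" "snd a \<noteq> snd b" by blast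
  then show ?thesis
  proof cases
    case same
    then have "hang pos a < hang pos b" using assms(3) by (simp add: before_def)
    then have "0 < cross (dir pos a) (dir pos b)" using cross_dir_pos a b ha by blast
    then show ?thesis using same by (simp add: lft_def orev_def dir_def)
  next
    case top
    then have "hang pos (orev b) < hang pos (orev a)" using assms(5) by (simp add: before_def orev_def)
    then have "0 < cross (dir pos (orev b)) (dir pos (orev a))" using cross_dir_pos a b ha orev_in by blast
    then show ?thesis using top cross_at_target[of a b] by (simp add: lft_def orev_def)
  next
    case free
    then have h: "ht (fst a) < ht (fst b)" "ht (snd b) < ht (snd a)" using s1 s2 by auto
    then have ne: "fst b \<noteq> snd a" "snd b \<noteq> fst a" "{fst a, snd a} \<inter> {fst b, snd b} = {}" using bb free by auto
    let ?A = "at_level \<epsilon> (pos (fst a)) (pos (snd a))" and ?B = "at_level \<epsilon> (pos (fst b)) (pos (snd b))"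
    note order = disjoint_segments_order[of \<epsilon> "pos (fst a)" "pos (snd a)" "pos (fst b)" "pos (snd b)"
        "ht (fst b)" "ht (snd b)", OF _ _ segments_disjoint[OF a b ne(3)]]
    have "0 < Re (?A (ht (fst b))) - Re (?B (ht (fst b))) \<longleftrightarrow> 0 < Re (?A (ht (snd b))) - Re (?B (ht (snd b)))"
      by (rule order(3)) (use aa bb h in \<open>auto simp: ht_def\<close>)
    moreover have "?B (ht (fst b)) = pos (fst b)" "?B (ht (snd b)) = pos (snd b)"
      using at_level_ends[of \<epsilon> "pos (fst b)" "pos (snd b)"] bb by (auto simp: ht_def)
    moreover have "lft b a \<longleftrightarrow> Re (pos (fst b)) < Re (?A (ht (fst b)))"
      "lft (orev b) a \<longleftrightarrow> Re (pos (snd b)) < Re (?A (ht (snd b)))"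
      using left_iff[of \<epsilon> "pos (fst a)" "pos (snd a)"] aa ne free by (auto simp: lft_def dir_def ht_def orev_def)
    ultimately show ?thesis by simp
  qed
qed

text \<open>The shared heights run from the lower end of \<open>b\<close> to the upper end of
  \<open>a\<close>. The order is read at the bottom as \<open>b\<close> relative to \<open>a\<close>
  and at the top as \<open>a\<close> relative to \<open>b\<close>, hence the negation; a tie at the
  top is excluded as the segments do not meet.\<close>

lemma lft_interleaved:
  assumes a: "a \<in> OE E" and b: "b \<in> OE E" and "before a b" "before b (orev a)" "before (orev a) (orev b)"
  shows "lft b a \<longleftrightarrow> \<not> lft (orev a) b"
proof -
  have va: "fst a \<in> V" "snd a \<in> V" "fst a \<noteq> snd a" and vb: "fst b \<in> V" "snd b \<in> V" "fst b \<noteq> snd b"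
    using edge a b by auto
  have s1: "fst a = fst b \<or> ht (fst a) < ht (fst b)" and s2: "snd a = snd b \<or> ht (snd a) < ht (snd b)"
    and s3: "fst b = snd a \<or> ht (fst b) < ht (snd a)"
    using assms(3,4,5) by (auto simp: before_def orev_def)
  have aa: "ht (fst a) < ht (snd a)" using s1 s3 va by auto
  have bb: "ht (fst b) < ht (snd b)" using s2 s3 vb by auto
  have ha: "0 < hang pos a" "0 < hang pos b" "\<not> 0 < hang pos (orev a)" "\<not> 0 < hang pos (orev b)"
    using aa bb hang_pos_iff a b orev_in by (auto simp: orev_def)
  have mid: "fst b \<noteq> snd a" "ht (fst b) < ht (snd a)"
    using assms(4) ha s3 by (auto simp: before_def orev_def)
  consider (same) "fst a = fst b" | (top) "fst a \<noteq> fst b" "snd a = snd b" | (free) "fst a \<noteq> fst b" "snd a \<noteq> snd b" by blast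
  then show ?thesis
  proof cases
    case same
    then have "snd a \<noteq> snd b" using assms(5) assms(3) by (auto simp: before_def orev_def prod_eq_iff)
    have "hang pos a < hang pos b" using assms(3) same by (simp add: before_def)
    then have "0 < cross (dir pos a) (dir pos b)" using cross_dir_pos a b ha by blast
    then have "\<not> 0 < cross (dir pos b) (pos (snd a) - pos (fst b))"
      using cross_antisym[of "dir pos a" "dir pos b"] same by (simp add: dir_def)
    then show ?thesis using same va \<open>snd a \<noteq> snd b\<close> by (auto simp: lft_def orev_def)
  next
    case top
    then have "hang pos (orev a) < hang pos (orev b)" using assms(5) by (simp add: before_def orev_def)
    then have "0 < cross (dir pos (orev a)) (dir pos (orev b))" using cross_dir_pos a b ha orev_in by blast
    then have "\<not> 0 < cross (dir pos a) (pos (fst b) - pos (fst a))"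
      using cross_at_target[of a b] top cross_antisym[of "dir pos (orev a)" "dir pos (orev b)"] by simp
    then show ?thesis using top mid by (auto simp: lft_def orev_def)
  next
    case free
    then have h: "ht (fst a) < ht (fst b)" "ht (snd a) < ht (snd b)" using s1 s2 by auto
    then have ne: "fst a \<noteq> snd b" "{fst a, snd a} \<inter> {fst b, snd b} = {}" using aa bb mid free by auto
    let ?A = "at_level \<epsilon> (pos (fst a)) (pos (snd a))" and ?B = "at_level \<epsilon> (pos (fst b)) (pos (snd b))"
    note order = disjoint_segments_order[of \<epsilon> "pos (fst a)" "pos (snd a)" "pos (fst b)" "pos (snd b)"
        "ht (fst b)" "ht (snd a)", OF _ _ segments_disjoint[OF a b ne(2)]]
    have "0 < Re (?A (ht (fst b))) - Re (?B (ht (fst b))) \<longleftrightarrow> 0 < Re (?A (ht (snd a))) - Re (?B (ht (snd a)))"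
      by (rule order(3)) (use aa bb h mid in \<open>auto simp: ht_def\<close>)
    moreover have "Re (?A (ht (snd a))) - Re (?B (ht (snd a))) \<noteq> 0"
      by (rule order(2)) (use aa bb h mid in \<open>auto simp: ht_def\<close>)
    moreover have "?B (ht (fst b)) = pos (fst b)" "?A (ht (snd a)) = pos (snd a)"
      using at_level_ends[of \<epsilon> "pos (fst b)" "pos (snd b)"] at_level_ends[of \<epsilon> "pos (fst a)" "pos (snd a)"] aa bb
      by (auto simp: ht_def)
    moreover have "lft b a \<longleftrightarrow> Re (pos (fst b)) < Re (?A (ht (fst b)))"
      using left_iff[of \<epsilon> "pos (fst a)" "pos (snd a)"] aa ne free mid by (auto simp: lft_def dir_def ht_def orev_def)
    moreover have "lft (orev a) b \<longleftrightarrow> Re (pos (snd a)) < Re (?B (ht (snd a)))"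
      using left_iff[of \<epsilon> "pos (fst b)" "pos (snd b)"] bb ne free mid by (auto simp: lft_def dir_def ht_def orev_def)
    ultimately show ?thesis by auto
  qed
qed

end

section \<open>Kac--Ward matrices of embedded graphs\<close>

locale ising_graph = embedded_graph V E pos \<epsilon>
  for V :: "'v set" and E :: "'v set set" and pos :: "'v \<Rightarrow> complex" and \<epsilon> :: real +
  fixes r :: "'v set \<Rightarrow> complex" and eta :: "'v \<times> 'v \<Rightarrow> complex"
  assumes eta: "\<forall>e\<in>OE E. eta e ^ 2 = dir pos e / complex_of_real (cmod (dir pos e))"
begin

text \<open>Both \<open>eta h\<close> and \<open>exp (\<i> / 2 * of_real (hang pos h))\<close> are
  square roots of the unit direction; this is the sign by which they differ.\<close>

definition sn :: "'v \<times> 'v \<Rightarrow> complex" where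
  "sn h = eta h * exp (- \<i> / 2 * of_real (hang pos h))"

definition rho :: "'v \<times> 'v \<Rightarrow> complex" where
  "rho h = r {fst h, snd h}"

lemma eta_sn: "eta h = sn h * exp (\<i> / 2 * of_real (hang pos h))"
  by (simp add: sn_def mult.assoc exp_add[symmetric])

lemma sn_sq: "h \<in> OE E \<Longrightarrow> sn h * sn h = 1"
proof -
  assume h: "h \<in> OE E"
  have "sn h * sn h = eta h ^ 2 * exp (- \<i> * of_real (hang pos h))"
    by (simp add: sn_def power2_eq_square exp_add[symmetric] algebra_simps mult_exp_exp)
  also have "eta h ^ 2 = exp (\<i> * of_real (hang pos h))"
    using eta h dir_nonzero[OF h] cis_Arg[of "dir pos h"] by (simp add: cis_conv_exp hang_def sgn_eq)
  finally show ?thesis by (simp add: exp_add[symmetric])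
qed

lemma sn_cases: "h \<in> OE E \<Longrightarrow> sn h = 1 \<or> sn h = -1"
  using sn_sq[of h] by (simp add: square_eq_1_iff)

lemma cnj_sn: "h \<in> OE E \<Longrightarrow> cnj (sn h) = sn h"
  using sn_cases[of h] by auto

lemma cnj_eta: "h \<in> OE E \<Longrightarrow> cnj (eta h) = sn h * exp (- \<i> / 2 * of_real (hang pos h))"
  by (simp add: eta_sn[of h] cnj_sn exp_cnj)

sublocale halfedges "OE E" orev fst rank sn rho
proof
  show "rank a < rank c \<longleftrightarrow> rank b < rank c"
    if "a \<in> OE E" "b \<in> OE E" "c \<in> OE E" "fst a = fst b" "fst c \<noteq> fst a" for a b c
    using that by (simp add: rank_less_iff before_def)
  show "inj_on rank (OE E)"
    using rank_less_iff before_total by (metis inj_onI less_irrefl)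
qed (use finite_OE orev_in orev_orev edge sn_sq in \<open>auto simp: orev_def\<close>)

lemma hang_less_iff: "a \<in> OE E \<Longrightarrow> b \<in> OE E \<Longrightarrow> fst a = fst b \<Longrightarrow> hang pos a < hang pos b \<longleftrightarrow> rank a < rank b"
  by (simp add: rank_less_iff before_def)

lemma lower_iff: "h \<in> OE E \<Longrightarrow> rank h < rank (orev h) \<longleftrightarrow> 0 < hang pos h"
  using rank_less_iff[of h "orev h"] orev_in[of h] hang_pos_iff[of h] edge[of h] by (auto simp: before_def orev_def)

lemma hang_orev: "h \<in> OE E \<Longrightarrow> hang pos (orev h) = (if 0 < hang pos h then hang pos h - pi else hang pos h + pi)"
  using Arg_minus[OF dir_nonzero[of h]] by (auto simp: hang_def dir_orev)

lemma sg_orev: "h \<in> OE E \<Longrightarrow> sg h (orev h) = (if 0 < hang pos h then 1 else -1)"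
  using lower_iff[of h] lo_cases[of h] by (auto simp: sg_def orev_orev)

lemma sg_same: "a \<in> OE E \<Longrightarrow> b \<in> OE E \<Longrightarrow> fst a = fst b \<Longrightarrow> a \<noteq> b \<Longrightarrow>
    sg a b = (if hang pos a < hang pos b then 1 else -1)"
  using rk_neq[of a b] by (auto simp: sg_def hang_less_iff neq_iff)

lemma Arg_quotient:
  assumes "z \<noteq> 0" "w \<noteq> 0"
  shows "Arg (z / w) = (if Arg z - Arg w \<le> - pi then Arg z - Arg w + 2 * pi
     else if pi < Arg z - Arg w then Arg z - Arg w - 2 * pi else Arg z - Arg w)"
proof -
  define \<theta> where "\<theta> = Arg z - Arg w"
  have zw: "z / w = of_real (cmod (z / w)) * exp (\<i> * of_real \<theta>)"
  proof -
    have "z = of_real (cmod z) * exp (\<i> * of_real (Arg z))" "w = of_real (cmod w) * exp (\<i> * of_real (Arg w))"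
      using rcis_cmod_Arg by (metis rcis_def cis_conv_exp)+
    note zw = this
    have "of_real (cmod (z / w)) * exp (\<i> * of_real \<theta>) =
        (of_real (cmod z) * exp (\<i> * of_real (Arg z))) / (of_real (cmod w) * exp (\<i> * of_real (Arg w)))"
      by (simp add: \<theta>_def norm_divide exp_diff right_diff_distrib)
    then show ?thesis by (simp only: zw[symmetric])
  qed
  have per: "exp (\<i> * of_real (\<theta> + 2 * pi)) = exp (\<i> * of_real \<theta>)" "exp (\<i> * of_real (\<theta> - 2 * pi)) = exp (\<i> * of_real \<theta>)"
    unfolding cis_conv_exp[symmetric] by (simp_all add: complex_eq_iff cos_diff sin_diff)
  have b: "- pi < Arg z" "Arg z \<le> pi" "- pi < Arg w" "Arg w \<le> pi" using Arg_bounded by auto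
  have n: "0 < cmod (z / w)" using assms by simp
  consider "\<theta> \<le> -pi" | "pi < \<theta>" | "-pi < \<theta>" "\<theta> \<le> pi" by linarith
  then show ?thesis
  proof cases
    case 1
    have "Arg (z / w) = \<theta> + 2 * pi"
      by (rule Arg_unique[of "cmod (z / w)"]) (use zw per n 1 b in \<open>auto simp: \<theta>_def\<close>)
    then show ?thesis using 1 by (simp add: \<theta>_def)
  next
    case 2
    have "Arg (z / w) = \<theta> - 2 * pi"
      by (rule Arg_unique[of "cmod (z / w)"]) (use zw per n 2 b in \<open>auto simp: \<theta>_def\<close>)
    moreover have "\<not> \<theta> \<le> - pi" using 2 pi_gt_zero by linarith
    ultimately show ?thesis using 2 by (simp add: \<theta>_def)
  next
    case 3
    have "Arg (z / w) = \<theta>"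
      by (rule Arg_unique[of "cmod (z / w)"]) (use zw n 3 in auto)
    then show ?thesis using 3 by (simp add: \<theta>_def)
  qed
qed

lemma wang_eq:
  assumes "e \<in> OE E" "q \<in> OE E"
  shows "wang pos e q = (if hang pos q - hang pos e \<le> - pi then hang pos q - hang pos e + 2 * pi
     else if pi < hang pos q - hang pos e then hang pos q - hang pos e - 2 * pi else hang pos q - hang pos e)"
  using Arg_quotient[OF dir_nonzero[OF assms(2)] dir_nonzero[OF assms(1)]] by (simp add: wang_def hang_def)

lemma exp_half_pi: "exp (- \<i> / 2 * of_real pi) = - \<i>" "exp (\<i> / 2 * of_real pi) = \<i>"
proof -
  have "exp (\<i> * of_real (- pi / 2)) = - \<i>" "exp (\<i> * of_real (pi / 2)) = \<i>"
    by (simp_all only: cis_conv_exp[symmetric]) (simp_all add: complex_eq_iff)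
  then show "exp (- \<i> / 2 * of_real pi) = - \<i>" "exp (\<i> / 2 * of_real pi) = \<i>"
    by (simp_all add: mult_ac)
qed

text \<open>The turning angle equals the difference of the arguments up to 0, 2 pi or -2 pi, and
  half of such a jump gives the sign. Whether a jump occurs is decided by comparing the argument of
  \<open>q\<close> with that of \<open>orev e\<close>, which is the argument of \<open>e\<close>
  shifted by pi; this is what the two order signs record.\<close>

lemma turn_sign:
  assumes e: "e \<in> OE E" and q: "q \<in> OE E" "fst q = snd e" "q \<noteq> orev e"
  shows "cnj (eta e) * eta q * exp (- \<i> / 2 * complex_of_real (wang pos e q)) =
      sn e * sn q * (sg e (orev e) * sg (orev e) q)"
proof -
  let ?d = "hang pos q - hang pos e"
  have lhs: "cnj (eta e) * eta q * exp (- \<i> / 2 * complex_of_real (wang pos e q)) =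
      sn e * sn q * exp (\<i> / 2 * of_real (?d - wang pos e q))"
    unfolding cnj_eta[OF e] eta_sn[of q]
    by (simp add: exp_add[symmetric] mult_exp_exp algebra_simps add_divide_distrib diff_divide_distrib)
  have h: "orev e \<in> OE E" "fst (orev e) = fst q" "orev e \<noteq> q"
    using orev_in[OF e] q by (auto simp: orev_def)
  have ne: "hang pos (orev e) \<noteq> hang pos q" using hang_inj[OF h(1) q(1)] h by auto
  have b: "- pi < hang pos q" "hang pos q \<le> pi" "- pi < hang pos e" "hang pos e \<le> pi"
    using Arg_bounded by (auto simp: hang_def)
  have E: "exp (\<i> / 2 * of_real (2 * pi)) = -1" "exp (\<i> / 2 * of_real (- (2 * pi))) = -1"
    by (simp_all add: exp_minus)
  have sgn: "sg e (orev e) * sg (orev e) q = (if ?d - wang pos e q = 0 then 1 else -1)"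
    "?d - wang pos e q = 0 \<or> ?d - wang pos e q = 2 * pi \<or> ?d - wang pos e q = - (2 * pi)"
    using sg_orev[OF e] sg_same[OF h(1) q(1) h(2,3)] wang_eq[OF e q(1)] hang_orev[OF e] b ne pi_gt_zero
    by (auto split: if_splits)
  have "exp (\<i> / 2 * of_real (?d - wang pos e q)) = (if ?d - wang pos e q = 0 then 1 else -1)"
    using sgn(2) E by (elim disjE) (simp_all only:, auto)
  then show ?thesis unfolding lhs sgn(1) by (simp only:)
qed

text \<open>Reversal shifts the argument by -pi for a rising edge and by pi otherwise, and half of
  this gives the phase -\<i> or \<i>.\<close>

lemma reverse_sign: "e \<in> OE E \<Longrightarrow> \<i> * cnj (eta e) * eta (orev e) = sn e * sn (orev e) * sg e (orev e)"
proof -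
  assume e: "e \<in> OE E"
  have "\<i> * cnj (eta e) * eta (orev e) = \<i> * (sn e * sn (orev e)) * exp (\<i> / 2 * of_real (hang pos (orev e) - hang pos e))"
    unfolding cnj_eta[OF e] eta_sn[of "orev e"]
    by (simp add: exp_add[symmetric] mult_exp_exp algebra_simps diff_divide_distrib)
  also have "\<dots> = sn e * sn (orev e) * sg e (orev e)"
    using exp_half_pi hang_orev[OF e] by (simp add: sg_orev[OF e])
  finally show ?thesis .
qed

sublocale kac_ward "OE E" rank sn rho pos eta
proof
  show "eta h * cnj (eta h) = 1" if "h \<in> OE E" for h
  proof -
    have "eta h * cnj (eta h) = (sn h * sn h) * (exp (\<i> / 2 * of_real (hang pos h)) * exp (- \<i> / 2 * of_real (hang pos h)))"
      unfolding cnj_eta[OF that] unfolding eta_sn[of h] by (simp only: mult_ac)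
    also have "\<dots> = 1" by (simp add: sn_sq[OF that] exp_add[symmetric])
    finally show ?thesis .
  qed
  show "Lam H = 1" if H: "closed H" "\<And>v. even (deg H v)" for H
  proof (rule Lam_even[OF H, where lft = lft])
    fix h h' g :: "'v \<times> 'v"
    assume "fst h = fst h'"
    then show "lft h g \<longleftrightarrow> lft h' g" by (simp add: lft_def)
  next
    fix h g :: "'v \<times> 'v"
    assume "fst h = fst g \<or> fst h = fst (orev g)"
    then show "lft h g" by (auto simp: lft_def orev_def)
  next
    fix a b assume "a \<in> OE E" "b \<in> OE E" "rank a < rank b" "rank b < rank (orev b)" "rank (orev b) < rank (orev a)"
    then show "lft b a \<longleftrightarrow> lft (orev b) a" by (intro lft_nested) (auto simp: rank_less_iff orev_in)
  next
    fix a b assume "a \<in> OE E" "b \<in> OE E" "rank a < rank b" "rank b < rank (orev a)" "rank (orev a) < rank (orev b)"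
    then show "lft b a \<longleftrightarrow> \<not> lft (orev a) b" by (intro lft_interleaved) (auto simp: rank_less_iff orev_in)
  qed
qed (use turn_sign reverse_sign hang_less_iff in auto)

lemma cnj_sg: "cnj (sg a b) = sg a b"
  by (simp add: sg_def)

text \<open>For a common origin the entry contains the turn from \<open>orev g\<close> to
  \<open>f\<close>. The conjugate of \<open>turn_sign\<close> evaluates it, once
  \<open>reverse_sign\<close> has rewritten \<open>\<i> * eta g\<close> in terms of
  \<open>eta (orev g)\<close>. On the diagonal the turn would be a backtracking, which has entry
  0.\<close>

lemma Khat_eq_B:
  assumes g: "g \<in> OE E" and f: "f \<in> OE E"
  shows "Khat pos r eta g f = B g f"
proof -
  have rev: "\<i> * cnj (eta g) * eta (orev g) = sn g * sn (orev g) * sg g (orev g)" by (rule reverse_sign[OF g])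
  consider (long) "f = orev g" | (short) "f \<noteq> orev g" "fst f = fst g" "f \<noteq> g" | (diag) "f = g" | (none) "f \<noteq> orev g" "fst f \<noteq> fst g"
    by blast
  then show ?thesis
  proof cases
    case long
    have "Tmat pos r (orev g) (orev g) = 0" using edge(3)[OF g] by (auto simp: Tmat_def orev_def)
    then have "Khat pos r eta g f = \<i> * eta g * cnj (eta (orev g))"
      by (simp add: Khat_def Kmat_def KWmat_def long)
    also have "\<dots> = - cnj (\<i> * cnj (eta g) * eta (orev g))" by simp
    also have "\<dots> = - (sn g * sn (orev g) * sg g (orev g))"
      unfolding rev using g by (simp add: cnj_sn cnj_sg orev_in)
    finally show ?thesis by (simp add: B_def long)
  next
    case short
    let ?w = "complex_of_real (wang pos (orev g) f)"
    have "f \<noteq> orev (orev g)" using short by (simp add: orev_orev)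
    then have T: "Tmat pos r (orev g) f = exp (\<i> / 2 * ?w) * (rho g * rho f)"
      using short by (simp add: Tmat_def orev_def rho_def insert_commute)
    have "cnj (eta (orev g)) * eta f * exp (- \<i> / 2 * ?w) = sn (orev g) * sn f * (sg (orev g) g * sg g f)"
      using turn_sign[OF orev_in[OF g] f] short by (simp add: orev_def)
    then have "cnj (cnj (eta (orev g)) * eta f * exp (- \<i> / 2 * ?w)) = cnj (sn (orev g) * sn f * (sg (orev g) g * sg g f))"
      by simp
    then have t: "eta (orev g) * cnj (eta f) * exp (\<i> / 2 * ?w) = sn (orev g) * sn f * (sg (orev g) g * sg g f)"
      using g f by (simp add: cnj_sn cnj_sg orev_in exp_cnj)
    have "eta g * cnj (eta g) = 1" by (rule eta_unit[OF g])
    then have i: "\<i> * eta (orev g) = sn g * sn (orev g) * sg g (orev g) * eta g"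
      using rev by (metis (no_types, opaque_lifting) mult.assoc mult.commute mult.right_neutral)
    have s2: "(sn g * sn (orev g) * sg g (orev g)) * (sn g * sn (orev g) * sg g (orev g)) = 1"
    proof -
      have "(sn g * sn (orev g) * sg g (orev g)) * (sn g * sn (orev g) * sg g (orev g)) =
        (sn g * sn g) * (sn (orev g) * sn (orev g)) * (sg g (orev g) * sg g (orev g))" by (simp only: mult_ac)
      then show ?thesis using g by (simp add: sn_sq orev_in sg_bar_square)
    qed
    then have "eta g = (sn g * sn (orev g) * sg g (orev g)) * (\<i> * eta (orev g))"
      unfolding i by (simp only: mult.assoc[symmetric]) simp
    then have ig: "\<i> * eta g = - (sn g * sn (orev g) * sg g (orev g)) * eta (orev g)"
      by (metis (no_types, opaque_lifting) complex_i_mult_minus mult.assoc mult.left_commute mult_minus_left)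
    have "Khat pos r eta g f = - (\<i> * eta g) * cnj (eta f) * exp (\<i> / 2 * ?w) * (rho g * rho f)"
      using short(1) by (simp add: Khat_def Kmat_def KWmat_def T)
    also have "\<dots> = (sn g * sn (orev g) * sg g (orev g)) * (eta (orev g) * cnj (eta f) * exp (\<i> / 2 * ?w)) * (rho g * rho f)"
      unfolding ig by (simp add: mult_ac)
    also have "\<dots> = (sn (orev g) * sn (orev g)) * (sg g (orev g) * sg (orev g) g) * (sn g * sn f * sg g f * (rho g * rho f))"
      unfolding t by (simp only: mult_ac)
    also have "\<dots> = B g f"
      using g short sg_bar_square[OF g] by (simp add: sn_sq orev_in B_def sg_swap[of "orev g" g])
    finally show ?thesis .
  next
    case diag
    have "Tmat pos r (orev g) g = 0" by (simp add: Tmat_def orev_orev)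
    moreover have "orev g \<noteq> g" using edge(3)[OF g] by (auto simp: orev_def prod_eq_iff)
    ultimately show ?thesis by (simp add: Khat_def Kmat_def KWmat_def B_def diag)
  next
    case none
    then have "Tmat pos r (orev g) f = 0" by (simp add: Tmat_def orev_def)
    then show ?thesis using none by (simp add: Khat_def Kmat_def KWmat_def B_def)
  qed
qed

section \<open>Configurations and even subgraphs as sets of half-edges\<close>

lemma deg_outside: "H \<subseteq> OE E \<Longrightarrow> v \<notin> V \<Longrightarrow> deg H v = 0"
proof -
  assume "H \<subseteq> OE E" "v \<notin> V"
  then have "{h \<in> H. fst h = v} = {}" using edge(1) by blast
  then show ?thesis unfolding deg_def by (simp only: card.empty)
qed

lemma configs_eq_C:
  assumes es: "es ` {0..<2*n} \<subseteq> OE E"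
  shows "configs V E es n = C (es ` {0..<2*n})"
proof (intro equalityI subsetI)
  let ?A = "es ` {0..<2*n}"
  fix H assume "H \<in> configs V E es n"
  then have H: "H \<subseteq> OE E" "\<And>k. k < 2*n \<Longrightarrow> es k \<notin> H"
    "\<And>k. k < 2*n \<Longrightarrow> orev (es k) \<notin> ?A \<Longrightarrow> orev (es k) \<in> H"
    "\<And>v. v \<in> V \<Longrightarrow> even (deg H v)"
    "\<And>h. h \<in> OE E \<Longrightarrow> (\<And>k. k < 2*n \<Longrightarrow> {fst (es k), snd (es k)} \<noteq> {fst h, snd h}) \<Longrightarrow> h \<in> H \<longleftrightarrow> orev h \<in> H"
    by (auto simp: configs_def deg_def)
  have "orev h \<in> OE E - ?A - H" if h: "h \<in> OE E - ?A - H" for h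
  proof -
    have nA: "orev h \<notin> ?A"
    proof
      assume "orev h \<in> ?A"
      then obtain k where k: "k < 2*n" "es k = orev h" by auto
      then have "orev (es k) = h" by (simp add: orev_orev)
      then show False using H(3)[OF k(1)] h by auto
    qed
    have "{fst (es k), snd (es k)} \<noteq> {fst h, snd h}" if k: "k < 2*n" for k
    proof
      assume "{fst (es k), snd (es k)} = {fst h, snd h}"
      then have "es k = h \<or> es k = orev h" by (auto simp: doubleton_eq_iff orev_def prod_eq_iff)
      moreover have "es k \<in> ?A" using k by auto
      ultimately show False using h nA by auto
    qed
    then have "orev h \<notin> H" using H(5)[of h] h by blast
    then show ?thesis using h nA orev_in by blast
  qed
  moreover have "H \<subseteq> OE E - ?A" using H(1,2) by auto
  moreover have "even (deg H v)" for v using H(4) deg_outside[OF H(1)] by (cases "v \<in> V") auto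
  ultimately show "H \<in> C ?A" by (auto simp: C_def closed_def)
next
  let ?A = "es ` {0..<2*n}"
  fix H assume "H \<in> C ?A"
  then have H: "H \<subseteq> OE E - ?A" "\<And>h. h \<in> OE E - ?A - H \<Longrightarrow> orev h \<in> OE E - ?A - H" "\<And>v. even (deg H v)"
    by (auto simp: C_def closed_def)
  show "H \<in> configs V E es n"
    unfolding configs_def
  proof (intro CollectI conjI allI impI ballI)
    show "H \<subseteq> OE E" using H by auto
    show "es k \<notin> H" if "k < 2*n" for k using H(1) that by auto
    show "orev (es k) \<in> H" if k: "k < 2*n" "orev (es k) \<notin> ?A" for k
    proof (rule ccontr)
      assume "orev (es k) \<notin> H"
      moreover have kA: "es k \<in> ?A" using k by auto
      ultimately have "orev (es k) \<in> OE E - ?A - H" using es k orev_in[of "es k"] by blast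
      from H(2)[OF this] show False using kA by (simp add: orev_orev)
    qed
    show "even (card {h \<in> H. fst h = v})" for v using H(3)[of v] by (simp add: deg_def)
    show "h \<in> H \<longleftrightarrow> orev h \<in> H"
      if h: "h \<in> OE E" "\<forall>k<2*n. {fst (es k), snd (es k)} \<noteq> {fst h, snd h}" for h
    proof -
      have "h \<notin> ?A" using h(2) by auto
      moreover have "orev h \<notin> ?A"
      proof
        assume "orev h \<in> ?A"
        then obtain k where k: "k < 2*n" "es k = orev h" by auto
        then have "{fst (es k), snd (es k)} = {fst h, snd h}" by (simp add: orev_def insert_commute)
        then show False using h(2) k by blast
      qed
      ultimately show ?thesis using H(2)[of h] H(2)[of "orev h"] h(1) orev_in[of h] by (auto simp: orev_orev)
    qed
  qed
qed

lemma prod_OE: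
  fixes f :: "'v set \<Rightarrow> complex"
  assumes "F \<subseteq> E"
  shows "(\<Prod>h\<in>OE F. f {fst h, snd h}) = (\<Prod>e\<in>F. f e ^ 2)"
proof -
  have finF: "finite F"
  proof (rule finite_subset)
    show "F \<subseteq> (\<lambda>h. {fst h, snd h}) ` OE E"
    proof
      fix e assume "e \<in> F"
      then obtain u v where "e = {u, v}" using assms edge_doubleton by blast
      then show "e \<in> (\<lambda>h. {fst h, snd h}) ` OE E" using \<open>e \<in> F\<close> assms
        by (intro image_eqI[of _ _ "(u, v)"]) (auto simp: OE_def)
    qed
  qed (use finite_OE in simp)
  have finO: "finite (OE F)"
    by (rule finite_subset[OF _ finite_OE]) (use assms in \<open>auto simp: OE_def\<close>)
  have "(\<Prod>h\<in>OE F. f {fst h, snd h}) = (\<Prod>e\<in>F. \<Prod>h\<in>{h \<in> OE F. {fst h, snd h} = e}. f {fst h, snd h})"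
    by (rule prod.group[symmetric]) (use finF finO in \<open>auto simp: OE_def\<close>)
  also have "\<dots> = (\<Prod>e\<in>F. f e ^ 2)"
  proof (rule prod.cong)
    fix e assume e: "e \<in> F"
    then obtain u v where uv: "e = {u, v}" "u \<noteq> v" using assms edge_doubleton by blast
    have "{h \<in> OE F. {fst h, snd h} = e} = {(u, v), (v, u)}"
      using e uv by (auto simp: OE_def doubleton_eq_iff insert_commute)
    then show "(\<Prod>h\<in>{h \<in> OE F. {fst h, snd h} = e}. f {fst h, snd h}) = f e ^ 2"
      using uv by (simp add: power2_eq_square insert_commute)
  qed simp
  finally show ?thesis .
qed

lemma deg_OE:
  assumes "F \<subseteq> E"
  shows "deg (OE F) v = card {e \<in> F. v \<in> e}"
  unfolding deg_def
proof (rule bij_betw_same_card)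
  show "bij_betw (\<lambda>h. {fst h, snd h}) {h \<in> OE F. fst h = v} {e \<in> F. v \<in> e}"
    unfolding bij_betw_def
  proof
    show "inj_on (\<lambda>h. {fst h, snd h}) {h \<in> OE F. fst h = v}"
      by (auto simp: inj_on_def doubleton_eq_iff)
    show "(\<lambda>h. {fst h, snd h}) ` {h \<in> OE F. fst h = v} = {e \<in> F. v \<in> e}"
    proof (intro equalityI subsetI)
      fix e assume e: "e \<in> {e \<in> F. v \<in> e}"
      then obtain u w where uw: "e = {u, w}" using assms edge_doubleton by blast
      then obtain y where "e = {v, y}" using e by auto
      then show "e \<in> (\<lambda>h. {fst h, snd h}) ` {h \<in> OE F. fst h = v}"
        using e by (intro image_eqI[of _ _ "(v, y)"]) (auto simp: OE_def)
    qed (auto simp: OE_def)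
  qed
qed

lemma C_empty_iff: "H \<in> C {} \<longleftrightarrow> closed H \<and> (\<forall>v. even (deg H v))"
  using closed_iff_complement[of H] by (auto simp: C_def closed_def)

text \<open>Closed sets of half-edges correspond to sets of edges, and the two halves of an edge
  contribute \<open>r e ^ 2 = x e\<close>. By \<open>W_Nil\<close> all even subgraphs carry the
  common sign \<open>Lam (OE E)\<close>.\<close>

lemma R_Nil:
  assumes x: "\<forall>e\<in>E. r e ^ 2 = x e"
  shows "R [] = Lam (OE E) * Z_Ising V E x"
proof -
  have "(\<Sum>H\<in>C {}. wt H) = (\<Sum>F\<in>even_subgraphs V E. \<Prod>e\<in>F. x e)"
  proof (rule sum.reindex_bij_witness[where i = OE and j = "\<lambda>H. (\<lambda>h. {fst h, snd h}) ` H"])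
    fix H assume H: "H \<in> C {}"
    then have cl: "closed H" "H \<subseteq> OE E" "\<And>v. even (deg H v)" by (auto simp: C_empty_iff closed_def)
    let ?F = "(\<lambda>h. {fst h, snd h}) ` H"
    have FE: "?F \<subseteq> E" using cl edge(4) by auto
    show eq: "OE ?F = H"
    proof (intro equalityI subsetI)
      fix h assume "h \<in> OE ?F"
      then obtain k where k: "k \<in> H" "{fst h, snd h} = {fst k, snd k}" by (auto simp: OE_def)
      then have "h = k \<or> h = orev k" by (auto simp: doubleton_eq_iff orev_def prod_eq_iff)
      then show "h \<in> H" using k cl by (auto simp: closed_def)
    qed (auto simp: OE_def)
    show "?F \<in> even_subgraphs V E"
      using FE cl(3) deg_OE[OF FE] unfolding eq by (simp add: even_subgraphs_def)
    show "(\<Prod>e\<in>?F. x e) = wt H"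
    proof -
      have "wt H = (\<Prod>h\<in>OE ?F. r {fst h, snd h})" unfolding eq by (simp add: wt_def rho_def)
      also have "\<dots> = (\<Prod>e\<in>?F. r e ^ 2)" by (rule prod_OE[OF FE])
      also have "\<dots> = (\<Prod>e\<in>?F. x e)" by (rule prod.cong) (use x FE in auto)
      finally show ?thesis by simp
    qed
  next
    fix F assume F: "F \<in> even_subgraphs V E"
    then have FE: "F \<subseteq> E" by (simp add: even_subgraphs_def)
    have sub: "OE F \<subseteq> OE E" using FE by (auto simp: OE_def)
    have "even (deg (OE F) v)" for v
      using F deg_OE[OF FE, of v] deg_outside[OF sub, of v] by (cases "v \<in> V") (auto simp: even_subgraphs_def)
    moreover have "orev h \<in> OE F" if "h \<in> OE F" for h using that by (simp add: OE_def orev_def insert_commute)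
    then have "closed (OE F)" using sub by (simp add: closed_def)
    ultimately show "OE F \<in> C {}" by (simp add: C_empty_iff)
    show "(\<lambda>h. {fst h, snd h}) ` OE F = F"
    proof (intro equalityI subsetI)
      fix e assume e: "e \<in> F"
      then obtain u v where uv: "e = {u, v}" using FE edge_doubleton by blast
      then show "e \<in> (\<lambda>h. {fst h, snd h}) ` OE F"
        using e by (intro image_eqI[of _ _ "(u, v)"]) (auto simp: OE_def)
    qed (auto simp: OE_def)
  qed
  moreover have "W [] H = Lam (OE E)" if "H \<in> C {}" for H
    by (rule W_Nil) (use that in \<open>auto simp: C_empty_iff closed_def\<close>)
  ultimately show ?thesis by (simp add: R_def Z_Ising_def sum_distrib_left[symmetric])
qed

text \<open>\<open>M\<close> inverts \<open>B\<close> on both sides, and any other candidate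
  \<open>N\<close> satisfies N = (M B) N = M (B N) = M. The description also prescribes 0 outside
  the edges, hence the case distinction.\<close>

lemma mat_inv_Khat:
  assumes R: "R [] \<noteq> 0"
  shows "mat_inv_on (OE E) (Khat pos r eta) = (\<lambda>f e. if f \<in> OE E \<and> e \<in> OE E then M f e else 0)"
    (is "_ = ?M")
  unfolding mat_inv_on_def
proof (rule the_equality, goal_cases)
  case 1
  have "(\<Sum>f\<in>OE E. Khat pos r eta e f * ?M f g) = (\<Sum>f\<in>OE E. B e f * M f g)"
    "(\<Sum>f\<in>OE E. ?M e f * Khat pos r eta f g) = (\<Sum>f\<in>OE E. M e f * B f g)"
    if "e \<in> OE E" "g \<in> OE E" for e g
    using that by (auto intro!: sum.cong simp: Khat_eq_B)
  then show ?case using B_M[OF R] M_B[OF R] by auto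
next
  case (2 N)
  have inv: "(\<Sum>f\<in>OE E. B e f * N f g) = (if e = g then 1 else 0)" if "e \<in> OE E" "g \<in> OE E" for e g
    using 2 that by (auto simp: Khat_eq_B[symmetric] cong: sum.cong)
  show ?case
  proof (intro ext)
    fix a b
    show "N a b = ?M a b"
    proof (cases "a \<in> OE E \<and> b \<in> OE E")
      case True
      have "N a b = (\<Sum>f\<in>OE E. (if a = f then 1 else 0) * N f b)"
        using True finite_OE by (simp add: if_distrib[where f = "\<lambda>c. c * _"] cong: if_cong)
      also have "\<dots> = (\<Sum>f\<in>OE E. (\<Sum>g\<in>OE E. M a g * B g f) * N f b)"
        by (rule sum.cong) (use True M_B[OF R] in auto)
      also have "\<dots> = (\<Sum>g\<in>OE E. M a g * (\<Sum>f\<in>OE E. B g f * N f b))"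
        unfolding sum_distrib_left sum_distrib_right by (subst sum.swap) (simp add: mult.assoc)
      also have "\<dots> = (\<Sum>g\<in>OE E. M a g * (if g = b then 1 else 0))"
        by (rule sum.cong) (use inv True in auto)
      also have "\<dots> = (\<Sum>g\<in>OE E. if g = b then M a b else 0)" by (rule sum.cong) auto
      also have "\<dots> = M a b" using True finite_OE by simp
      finally show ?thesis using True by simp
    next
      case False
      then have "N a b = 0" using 2 by blast
      then show ?thesis using False by auto
    qed
  qed
qed

lemma cweight_wt: "cweight r H = wt H"
  by (simp add: cweight_def wt_def rho_def)

theorem pfaffian_expansion:
  assumes x: "\<forall>e\<in>E. r e ^ 2 = x e" and Z: "Z_Ising V E x \<noteq> 0"
    and es: "es ` {0..<2*n} \<subseteq> OE E" "inj_on es {0..<2*n}"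
  shows "(\<forall>H\<in>configs V E es n. \<exists>!t. tau_rel pos eta es n H t) \<and>
         pfaffian n (\<lambda>j k. mat_inv_on (OE E) (Khat pos r eta) (es j) (es k)) =
           (1 / Z_Ising V E x) *
           (\<Sum>H\<in>configs V E es n. (THE t. tau_rel pos eta es n H t) * cweight r H)"
proof
  let ?L = "Lam (OE E)" and ?p = "\<Prod>e\<leftarrow>map es [0..<2*n]. sn e"
  have L: "?L * ?L = 1" by (rule Lam_S_square)
  then have L0: "?L \<noteq> 0" by auto
  have R: "R [] = ?L * Z_Ising V E x" by (rule R_Nil[OF x])
  have R0: "R [] \<noteq> 0" using L0 Z R by simp
  have tau: "tau_rel pos eta es n H t \<longleftrightarrow> t = ?L * ?p * W (map es [0..<2*n]) H"
    if "H \<in> configs V E es n" for H t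
    using tau_rel_iff[OF es(2,1)] that configs_eq_C[OF es(1)] by simp
  show "\<forall>H\<in>configs V E es n. \<exists>!t. tau_rel pos eta es n H t" using tau by simp
  have "pfaffian n (\<lambda>j k. mat_inv_on (OE E) (Khat pos r eta) (es j) (es k)) = pfaffian n (\<lambda>j k. M (es j) (es k))"
  proof -
    have "(\<Prod>i<n. mat_inv_on (OE E) (Khat pos r eta) (es (\<sigma> (2*i))) (es (\<sigma> (2*i+1)))) =
        (\<Prod>i<n. M (es (\<sigma> (2*i))) (es (\<sigma> (2*i+1))))" if "\<sigma> permutes {0..<2*n}" for \<sigma>
    proof (rule prod.cong)
      fix i assume "i \<in> {..<n}"
      then have "\<sigma> (2*i) \<in> {0..<2*n}" "\<sigma> (2*i+1) \<in> {0..<2*n}"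
        using permutes_in_image[OF that] by auto
      then have "es (\<sigma> (2*i)) \<in> OE E" "es (\<sigma> (2*i+1)) \<in> OE E" using es(1) by blast+
      then show "mat_inv_on (OE E) (Khat pos r eta) (es (\<sigma> (2*i))) (es (\<sigma> (2*i+1))) = M (es (\<sigma> (2*i))) (es (\<sigma> (2*i+1)))"
        unfolding mat_inv_Khat[OF R0] by simp
    qed simp
    then show ?thesis unfolding pfaffian_def
      by (intro arg_cong2[where f = "(/)"] arg_cong2[where f = "(*)"] sum.cong refl) auto
  qed
  also have "\<dots> = R (map es [0..<2*n]) / R []"
    using R_pfaffian[OF R0 es(2,1)] R0 by simp
  \<comment> \<open>The sign in \<open>R []\<close> is its own inverse, so it moves to the
    numerator, where it turns word signs into values of \<open>\<tau>\<close>.\<close>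
  also have "\<dots> = (1 / Z_Ising V E x) * (?L * R (map es [0..<2*n]))"
  proof -
    have "1 / R [] = (1 / Z_Ising V E x) * ?L"
      using L0 Z by (simp add: R divide_simps L)
    moreover have "R (map es [0..<2*n]) / R [] = R (map es [0..<2*n]) * (1 / R [])" by simp
    ultimately show ?thesis by (simp only: mult_ac)
  qed
  also have "?L * R (map es [0..<2*n]) = (\<Sum>H\<in>configs V E es n. (THE t. tau_rel pos eta es n H t) * cweight r H)"
  proof -
    have "(\<Sum>H\<in>configs V E es n. (THE t. tau_rel pos eta es n H t) * cweight r H) =
        (\<Sum>H\<in>configs V E es n. ?L * ?p * W (map es [0..<2*n]) H * wt H)"
      by (rule sum.cong) (simp_all add: tau cweight_wt)
    then show ?thesis unfolding R_def configs_eq_C[OF es(1)] by (simp add: sum_distrib_left mult_ac)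
  qed
  finally show "pfaffian n (\<lambda>j k. mat_inv_on (OE E) (Khat pos r eta) (es j) (es k)) =
           (1 / Z_Ising V E x) *
           (\<Sum>H\<in>configs V E es n. (THE t. tau_rel pos eta es n H t) * cweight r H)" .
qed

end

theorem theorem1p2:
  fixes V :: "'v set" and E :: "'v set set" and pos :: "'v \<Rightarrow> complex"
    and x r :: "'v set \<Rightarrow> complex" and eta :: "'v \<times> 'v \<Rightarrow> complex"
    and n :: nat and es :: "nat \<Rightarrow> 'v \<times> 'v"
  assumes G: "planar_straight_graph V E pos"
    and sqrt_x: "\<forall>e\<in>E. r e ^ 2 = x e"
    and eta: "\<forall>e\<in>OE E. eta e ^ 2 = dir pos e / complex_of_real (cmod (dir pos e))"
    and Z: "Z_Ising V E x \<noteq> 0"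
    and es_edges: "es ` {0..<2*n} \<subseteq> OE E"
    and es_distinct: "inj_on es {0..<2*n}"
  shows "(\<forall>H\<in>configs V E es n. \<exists>!t. tau_rel pos eta es n H t) \<and>
         pfaffian n (\<lambda>j k. mat_inv_on (OE E) (Khat pos r eta) (es j) (es k)) =
           (1 / Z_Ising V E x) *
           (\<Sum>H\<in>configs V E es n. (THE t. tau_rel pos eta es n H t) * cweight r H)"
proof -
  \<comment> \<open>All pairs of distinct vertices are taken, not only adjacent ones, since the
    tilted heights must separate all vertices.\<close>
  let ?D = "(\<lambda>(u, v). pos v - pos u) ` {(u, v) \<in> V \<times> V. u \<noteq> v}"
  have V: "finite V" "inj_on pos V" using G by (auto simp: planar_straight_graph_def)
  have "finite {(u, v) \<in> V \<times> V. u \<noteq> v}" by (rule finite_subset[of _ "V \<times> V"]) (use V in auto)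
  then have "finite ?D" by simp
  moreover have "0 \<notin> ?D" using V(2) by (auto dest: inj_onD)
  ultimately obtain \<epsilon> where "\<forall>d\<in>?D. slant \<epsilon> d \<noteq> 0 \<and> (0 < slant \<epsilon> d \<longleftrightarrow> 0 < Arg d)"
    using exists_slant by blast
  then interpret ising_graph V E pos \<epsilon> r eta
    by unfold_locales (use G eta in auto)
  show ?thesis by (rule pfaffian_expansion[OF sqrt_x Z es_edges es_distinct])
qed

end
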